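(* Let $f$ be a nonconstant meromorphic function on $\mathbb D=\{z\in\mathbb C:|z|<1\}$, and let $a_1,\dots,a_q$ be distinct points in $\overline{\mathbb C}$. Then for any $\delta>0$ $$(q-2)T_f(r)\le\sum_{j=1}^q\overline N_f(r,a_j)+O\Big(\log T_f(r)+\log\frac{1}{1-r}\Big)$$ holds for all $r\in(0,1)$ outside a set $E_\delta$ with $\int_{E_\delta}(1-r)^{-1}dr<\infty$.
   Context: Let $D(r)=\{z\in\mathbb C:|z|<r\}$, $dd^c=\frac{\sqrt{-1}}{2\pi}\partial\bar\partial$, and let $\omega_{FS}=dd^c\log(|\zeta_0|^2+|\zeta_1|^2)$ be the Fubini–Study form on $\mathbb P^1(\mathbb C)=\overline{\mathbb C}$. Fix $r_0\in(0,1)$. For $r_0<r<1$, viewing $f$ as a holomorphic map to $\mathbb P^1(\mathbb C)$, $$T_f(r)=\int_{r_0}^r\frac{dt}{t}\int_{D(t)}f^*\omega_{FS},\qquad \overline N_f(r,a)=\int_{r_0}^r\frac{\overline n_f(t,a)}{t}dt,$$ where $\overline n_f(t,a)$ is the number of points of $D(t)$ where $f=a$ (poles if $a=\infty$), counted without multiplicity. Convention: the error term $O(A_1+\cdots+A_m)$ denotes a quantity bounded above by $C(1+A_1^++\cdots+A_m^+)$ with $A^+=\max(A,0)$ and $C$ a constant independent of $r$ and $\delta$; the interval $(0,r_0]$, where the functions are not defined, is understood to be contained in $E_\delta$. *)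

theory Defs
  imports "HOL-Complex_Analysis.Complex_Analysis"
begin

text \<open>Points of the Riemann sphere: \<^term>\<open>Some w\<close> is the finite point \<open>w\<close>,
  \<^term>\<open>None\<close> is \<open>\<infinity>\<close>.\<close>

type_synonym riemann_sphere = "complex option"

text \<open>A meromorphic function on a domain is represented by \<open>f :: complex \<Rightarrow> complex\<close> with
  \<open>f nicely_meromorphic_on D\<close>: off the poles \<open>f\<close> is holomorphic, and the dummy value at
  a pole is 0. The associated holomorphic map to the sphere is the following.\<close>

definition sphere_map :: "(complex \<Rightarrow> complex) \<Rightarrow> complex \<Rightarrow> riemann_sphere" where
  "sphere_map f z = (if is_pole f z then None else Some (f z))"

definition partial_x :: "(complex \<Rightarrow> complex) \<Rightarrow> complex \<Rightarrow> complex" where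
  "partial_x u z = vector_derivative (\<lambda>t::real. u (z + of_real t)) (at 0)"

definition partial_y :: "(complex \<Rightarrow> complex) \<Rightarrow> complex \<Rightarrow> complex" where
  "partial_y u z = vector_derivative (\<lambda>t::real. u (z + \<i> * of_real t)) (at 0)"

definition wirtinger :: "(complex \<Rightarrow> complex) \<Rightarrow> complex \<Rightarrow> complex" where
  "wirtinger u z = (partial_x u z - \<i> * partial_y u z) / 2"

definition wirtinger_bar :: "(complex \<Rightarrow> complex) \<Rightarrow> complex \<Rightarrow> complex" where
  "wirtinger_bar u z = (partial_x u z + \<i> * partial_y u z) / 2"

text \<open>A (1,1)-form on a plane domain is identified with its density with respect to
  \<open>dx \<and> dy\<close>. The factor \<open>- 2 \<i>\<close> below comes from \<open>dz \<and> d(cnj z) = - 2 \<i> dx \<and> dy\<close>;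
  the resulting density is the Laplacian of \<open>u\<close> divided by \<open>4 \<pi>\<close>.\<close>

definition ddc :: "(complex \<Rightarrow> real) \<Rightarrow> complex \<Rightarrow> real" where
  "ddc u z = Re (\<i> / (2 * of_real pi)
     * wirtinger (wirtinger_bar (\<lambda>w. of_real (u w))) z * (- 2 * \<i>))"

definition fs_potential :: "complex \<Rightarrow> complex \<Rightarrow> real" where
  "fs_potential \<zeta>0 \<zeta>1 = ln ((cmod \<zeta>0)\<^sup>2 + (cmod \<zeta>1)\<^sup>2)"

text \<open>The pullback of the Fubini--Study form is \<open>dd\<^sup>c log (|f0|\<^sup>2 + |f1|\<^sup>2)\<close> for any
  holomorphic lift \<open>(f0, f1)\<close> of the map to homogeneous coordinates near the point. We use
  the lift \<open>(1, f)\<close> away from the poles and \<open>(1/f, 1)\<close> at a pole; the latter is holomorphic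
  there because \<open>f\<close> has the value 0 at its poles and \<open>inverse 0 = 0\<close>.\<close>

definition fs_pullback :: "(complex \<Rightarrow> complex) \<Rightarrow> complex \<Rightarrow> real" where
  "fs_pullback f z =
     (if is_pole f z then ddc (\<lambda>w. fs_potential (inverse (f w)) 1) z
      else ddc (\<lambda>w. fs_potential 1 (f w)) z)"

definition nev_T :: "real \<Rightarrow> (complex \<Rightarrow> complex) \<Rightarrow> real \<Rightarrow> real" where
  "nev_T r0 f r = integral {r0..r} (\<lambda>t. integral (ball 0 t) (fs_pullback f) / t)"

definition nbar :: "(complex \<Rightarrow> complex) \<Rightarrow> real \<Rightarrow> riemann_sphere \<Rightarrow> nat" where
  "nbar f t a = card {z \<in> ball 0 t. sphere_map f z = a}"

definition nev_Nbar :: "real \<Rightarrow> (complex \<Rightarrow> complex) \<Rightarrow> real \<Rightarrow> riemann_sphere \<Rightarrow> real" where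
  "nev_Nbar r0 f r a = integral {r0..r} (\<lambda>t. real (nbar f t a) / t)"

definition pos_part :: "real \<Rightarrow> real" where
  "pos_part x = max x 0"

end

theory Submission
  imports Defs
begin

text \<open>
  The proof is the Fubini--Study form of Nevanlinna's argument. On a disc of radius \<open>R < 1\<close> write
  \<open>f = v / u\<close> with \<open>u\<close>, \<open>v\<close> holomorphic and without common zeros, and let
  \<open>W = u v' - u' v\<close> and \<open>N = |u|^2 + |v|^2\<close>. The Laplacian of \<open>ln N\<close> is \<open>4 |W|^2 / N^2\<close>, four times
  the squared spherical derivative of \<open>f\<close>; hence, after passing from areas to circles
  (\<open>integral_ball_polar\<close>), \<open>T_f(r)\<close> is half the growth of the mean of \<open>ln N\<close> over the circle of
  radius \<open>r\<close> (\<open>circ_mean_fs_potential\<close>, \<open>height_fs_density\<close>).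

  For a target \<open>a\<close> let \<open>L_a\<close> be the linear form of norm one in \<open>(u, v)\<close> that vanishes exactly where
  \<open>f = a\<close>, so that \<open>x_a = |L_a|^2 / N\<close> is the squared chordal distance from \<open>f\<close> to \<open>a\<close>. Where \<open>L_a\<close>
  vanishes to order \<open>m\<close>, \<open>W\<close> vanishes to order at least \<open>m - 1\<close>. Jensen's formula for \<open>W\<close> and for the
  \<open>L_a\<close> therefore gives (\<open>second_main_inequality\<close>)
  \<open>(q - 2) T_f(r) \<le> \<Sum> Nbar(r, a) + (m(r) - m(r1)) / 2\<close>,
  where \<open>m(r)\<close> is the mean of \<open>ln (|W|^2 / N^2 * \<Prod> 1 / x_a)\<close> over the circle of radius \<open>r\<close>.

  It remains to bound \<open>m(r)\<close>. At each point at most one \<open>x_a\<close> is small, so the product of the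
  \<open>1 / x_a\<close> is at most a constant times their sum (\<open>prod_inverse_chord_le\<close>). The function \<open>1 / x\<close> is
  not integrable over the sphere, but \<open>1 / (x (ln x)^2)\<close> is. Rather than a singular potential for the
  latter, the proof uses the smooth potentials \<open>ln (|L_a|^2 + e N)\<close> with \<open>e > 0\<close>: each of them is again
  of the form \<open>ln (|h1|^2 + |h2|^2)\<close>, its Laplacian is \<open>4 |W|^2 / N^2 * e (1 + e) / (x_a + e)^2\<close>, and
  its mean grows by at most \<open>2 T_f(r) + O(1)\<close>, uniformly in \<open>e\<close> (\<open>height_peak_le\<close>). Summing over
  \<open>e = 2^-k\<close> with weights \<open>1 / (k + 1)^2\<close> produces functions that dominate
  \<open>|W|^2 / N^2 / (x_a (ln x_a)^2)\<close> and whose twice integrated circle means are \<open>O(1 + T_f(r))\<close>.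
  Borel's growth lemma, applied to both integrations (\<open>growth_circ_mean_incseq\<close>), bounds the
  circle means themselves by a power of \<open>(1 + T_f(r)) / (1 - r)\<close> outside an exceptional set. Concavity
  of the logarithm turns this into the error term; the factors \<open>(ln x_a)^2\<close> cost only
  \<open>ln T_f(r)\<close>, because the mean of \<open>ln (1 / x_a)\<close> is at most \<open>2 T_f(r) + O(1)\<close> by the First Main
  Theorem (\<open>proximity_le\<close>).
\<close>

section \<open>Means over circles\<close>

definition circ_mean :: "(complex \<Rightarrow> 'a::euclidean_space) \<Rightarrow> real \<Rightarrow> 'a" where
  "circ_mean \<phi> s = (1 / (2 * pi)) *\<^sub>R integral {0..2*pi} (\<lambda>t. \<phi> (of_real s * cis t))"

lemma circle_in_ball: "0 \<le> s \<Longrightarrow> s < R \<Longrightarrow> of_real s * cis t \<in> ball 0 R"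
  by (simp add: norm_mult)

lemma continuous_on_circle:
  fixes \<phi> :: "complex \<Rightarrow> 'a::euclidean_space"
  assumes "continuous_on (ball 0 R) \<phi>" "0 \<le> s" "s < R"
  shows "continuous_on X (\<lambda>t. \<phi> (of_real s * cis t))"
  by (rule continuous_on_compose2[OF assms(1)])
     (use assms in \<open>auto intro!: continuous_intros simp: norm_mult\<close>)

lemma integrable_on_circle:
  fixes \<phi> :: "complex \<Rightarrow> 'a::euclidean_space"
  assumes "continuous_on (ball 0 R) \<phi>" "0 \<le> s" "s < R"
  shows "(\<lambda>t. \<phi> (of_real s * cis t)) integrable_on {0..2*pi}"
  by (intro integrable_continuous_interval continuous_on_circle[OF assms])

lemma continuous_on_circ_mean:
  fixes \<phi> :: "complex \<Rightarrow> 'a::euclidean_space"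
  assumes "continuous_on (ball 0 R) \<phi>"
  shows "continuous_on {0..<R} (circ_mean \<phi>)"
proof -
  have "continuous_on ({0..<R} \<times> cbox 0 (2*pi)) (\<lambda>(s,t). \<phi> (of_real s * cis t))"
    unfolding case_prod_unfold
    by (rule continuous_on_compose2[OF assms])
       (auto intro!: continuous_intros simp: norm_mult)
  from integral_continuous_on_param[OF this]
  show ?thesis unfolding circ_mean_def by (auto intro!: continuous_intros)
qed

lemma has_vector_derivative_along:
  assumes "(\<phi> has_derivative (\<lambda>h. A * h + B * cnj h)) (at (p t))"
    and "(p has_vector_derivative v) (at t)"
  shows "((\<lambda>t::real. \<phi> (p t) :: complex) has_vector_derivative (A * v + B * cnj v)) (at t)"
proof -
  have "((\<phi> \<circ> p) has_derivative ((\<lambda>h. A * h + B * cnj h) \<circ> (\<lambda>x. x *\<^sub>R v))) (at t)"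
    by (rule diff_chain_at) (use assms in \<open>auto simp: has_vector_derivative_def\<close>)
  then show ?thesis
    by (simp add: has_vector_derivative_def o_def algebra_simps scaleR_conv_of_real)
qed

text \<open>Here \<open>A\<close> and \<open>B\<close> are the Wirtinger derivatives of \<open>\<phi>\<close>. The radial derivative is the mean of
  \<open>z A + cnj z B\<close> divided by the radius, and the mean of the angular derivative \<open>\<i> (z A - cnj z B)\<close>
  vanishes by periodicity, so the two halves agree. Applying this twice yields the Laplacian
  without second-order calculus in polar coordinates.\<close>

lemma circ_mean_has_derivative:
  fixes \<phi> A B :: "complex \<Rightarrow> complex"
  assumes D: "\<And>z. z \<in> ball 0 R \<Longrightarrow> (\<phi> has_derivative (\<lambda>h. A z * h + B z * cnj h)) (at z)"
    and cA: "continuous_on (ball 0 R) A" and cB: "continuous_on (ball 0 R) B"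
    and s: "0 < s" "s < R"
  shows "(circ_mean \<phi> has_vector_derivative (2 / s) *\<^sub>R circ_mean (\<lambda>z. z * A z) s) (at s)"
    and "(circ_mean \<phi> has_vector_derivative (2 / s) *\<^sub>R circ_mean (\<lambda>z. cnj z * B z) s) (at s)"
proof -
  let ?c = "\<lambda>t. of_real s * cis t"
  have c\<phi>: "continuous_on (ball 0 R) \<phi>"
    using has_derivative_continuous[OF D] by (intro continuous_at_imp_continuous_on) blast
  have radial: "((\<lambda>x. integral (cbox 0 (2*pi)) (\<lambda>t. \<phi> (of_real x * cis t))) has_vector_derivative
      integral (cbox 0 (2*pi)) (\<lambda>t. A (?c t) * cis t + B (?c t) * cnj (cis t)))
      (at s within {0<..<R})"
  proof (rule leibniz_rule_vector_derivative)
    fix x t assume x: "x \<in> {0<..<R}"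
    have "((\<lambda>x. of_real x * cis t) has_vector_derivative cis t) (at x)"
      by (auto intro!: derivative_eq_intros simp: has_vector_derivative_def scaleR_conv_of_real)
    moreover have "of_real x * cis t \<in> ball 0 R"
      using x by (intro circle_in_ball) auto
    ultimately have "((\<lambda>x. \<phi> (of_real x * cis t)) has_vector_derivative
        (A (of_real x * cis t) * cis t + B (of_real x * cis t) * cnj (cis t))) (at x)"
      using has_vector_derivative_along[OF D, of "\<lambda>x. of_real x * cis t" x "cis t"] by blast
    then show "((\<lambda>x. \<phi> (of_real x * cis t)) has_vector_derivative
        (A (of_real x * cis t) * cis t + B (of_real x * cis t) * cnj (cis t))) (at x within {0<..<R})"
      by (rule has_vector_derivative_at_within)
  next
    fix x assume "x \<in> {0<..<R}"
    then show "(\<lambda>t. \<phi> (of_real x * cis t)) integrable_on cbox 0 (2*pi)"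
      using integrable_on_circle[OF c\<phi>] by auto
  next
    have "continuous_on ({0<..<R} \<times> cbox 0 (2*pi)) (\<lambda>p. A (of_real (fst p) * cis (snd p)))"
      by (rule continuous_on_compose2[OF cA]) (auto intro!: continuous_intros simp: norm_mult)
    moreover have "continuous_on ({0<..<R} \<times> cbox 0 (2*pi)) (\<lambda>p. B (of_real (fst p) * cis (snd p)))"
      by (rule continuous_on_compose2[OF cB]) (auto intro!: continuous_intros simp: norm_mult)
    ultimately show "continuous_on ({0<..<R} \<times> cbox 0 (2*pi)) (\<lambda>(x,t). A (of_real x * cis t) * cis t
         + B (of_real x * cis t) * cnj (cis t))"
      unfolding case_prod_unfold by (auto intro!: continuous_intros)
  qed (use s in auto)
  have angular: "((\<lambda>t. \<i> * (?c t * A (?c t)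
        - cnj (?c t) * B (?c t))) has_integral
      (\<phi> (of_real s * cis (2*pi)) - \<phi> (of_real s * cis 0))) {0..2*pi}"
  proof (rule fundamental_theorem_of_calculus)
    fix t :: real
    have "(cis has_vector_derivative \<i> * cis t) (at t)"
      unfolding has_vector_derivative_def by (auto intro!: derivative_eq_intros)
    then have "((\<lambda>t. ?c t) has_vector_derivative of_real s * (\<i> * cis t)) (at t)"
      by (auto intro!: derivative_eq_intros)
    moreover have "?c t \<in> ball 0 R"
      using s by (intro circle_in_ball) auto
    ultimately have "((\<lambda>t. \<phi> (?c t)) has_vector_derivative
        (A (?c t) * (of_real s * (\<i> * cis t)) + B (?c t) * cnj (of_real s * (\<i> * cis t)))) (at t)"
      using has_vector_derivative_along[OF D, of "\<lambda>t. ?c t" t "of_real s * (\<i> * cis t)"] by blast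
    then show "((\<lambda>t. \<phi> (?c t)) has_vector_derivative
      \<i> * (?c t * A (?c t)
        - cnj (?c t) * B (?c t))) (at t within {0..2*pi})"
      by (rule has_vector_derivative_at_within[OF has_vector_derivative_eq_rhs]) (simp add: algebra_simps)
  qed auto
  have iA: "(\<lambda>t. ?c t * A (?c t)) integrable_on {0..2*pi}"
    by (rule integrable_on_circle[of R "\<lambda>z. z * A z" s]) (use cA s in \<open>auto intro!: continuous_intros\<close>)
  have iB: "(\<lambda>t. cnj (?c t) * B (?c t)) integrable_on {0..2*pi}"
    by (rule integrable_on_circle[of R "\<lambda>z. cnj z * B z" s]) (use cB s in \<open>auto intro!: continuous_intros\<close>)
  have "\<i> * (integral {0..2*pi} (\<lambda>t. ?c t * A (?c t))
      - integral {0..2*pi} (\<lambda>t. cnj (?c t) * B (?c t))) = 0"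
    using integral_unique[OF angular] iA iB
    by (simp only: integral_mult_right integral_diff) simp
  then have eq: "circ_mean (\<lambda>z. z * A z) s = circ_mean (\<lambda>z. cnj z * B z) s"
    by (simp add: circ_mean_def)
  have "of_real s * integral {0..2*pi} (\<lambda>t. A (?c t) * cis t + B (?c t) * cnj (cis t))
     = integral {0..2*pi} (\<lambda>t. ?c t * A (?c t)
          + cnj (?c t) * B (?c t))"
    by (subst integral_mult_right[symmetric]) (simp add: algebra_simps)
  also have "\<dots> = (2 * pi) *\<^sub>R (circ_mean (\<lambda>z. z * A z) s + circ_mean (\<lambda>z. cnj z * B z) s)"
    by (subst integral_add[OF iA iB]) (simp add: circ_mean_def scaleR_conv_of_real field_simps)
  finally have *: "integral {0..2*pi} (\<lambda>t. A (?c t) * cis t + B (?c t) * cnj (cis t))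
     = (2 * pi / s) *\<^sub>R (circ_mean (\<lambda>z. z * A z) s + circ_mean (\<lambda>z. cnj z * B z) s)"
    using s by (simp add: scaleR_conv_of_real field_simps)
  have "(circ_mean \<phi> has_vector_derivative (1/s) *\<^sub>R (circ_mean (\<lambda>z. z * A z) s + circ_mean (\<lambda>z. cnj z * B z) s)) (at s)"
  proof -
    have "(circ_mean \<phi> has_vector_derivative (1 / (2*pi)) *\<^sub>R integral (cbox 0 (2*pi))
        (\<lambda>t. A (?c t) * cis t + B (?c t) * cnj (cis t))) (at s within {0<..<R})"
      using has_vector_derivative_scaleR[OF DERIV_const[of "1/(2*pi)"] radial]
      unfolding circ_mean_def[abs_def] by simp
    moreover have "at s within {0<..<R} = at s" using s by (intro at_within_open) auto
    ultimately show ?thesis using s by (simp only: cbox_interval *) simp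
  qed
  then show "(circ_mean \<phi> has_vector_derivative (2 / s) *\<^sub>R circ_mean (\<lambda>z. z * A z) s) (at s)"
    and "(circ_mean \<phi> has_vector_derivative (2 / s) *\<^sub>R circ_mean (\<lambda>z. cnj z * B z) s) (at s)"
    by (auto simp: eq scaleR_2[symmetric])
qed

lemma Re_circ_mean:
  assumes "continuous_on (ball 0 R) \<phi>" "0 \<le> s" "s < R"
  shows "Re (circ_mean \<phi> s) = circ_mean (\<lambda>z. Re (\<phi> z)) s"
  using integral_linear[OF integrable_on_circle[OF assms] bounded_linear_Re]
  by (simp add: circ_mean_def o_def)

lemma circ_mean_cong:
  assumes "\<And>z. cmod z = \<bar>s\<bar> \<Longrightarrow> \<phi> z = \<psi> z"
  shows "circ_mean \<phi> s = circ_mean \<psi> s"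
  unfolding circ_mean_def using assms by (simp add: norm_mult)

lemma circ_mean_0 [simp]: "circ_mean \<phi> 0 = \<phi> 0"
  by (simp add: circ_mean_def)

lemma circ_mean_const [simp]: "circ_mean (\<lambda>_. c) s = c"
  by (simp add: circ_mean_def)

lemma integrable_on_sphere:
  fixes \<phi> :: "complex \<Rightarrow> 'a::euclidean_space"
  assumes "continuous_on (sphere 0 s) \<phi>" "0 \<le> s"
  shows "(\<lambda>t. \<phi> (of_real s * cis t)) integrable_on {0..2*pi}"
  by (intro integrable_continuous_interval continuous_on_compose2[OF assms(1)])
     (use assms(2) in \<open>auto intro!: continuous_intros simp: norm_mult\<close>)

lemma circ_mean_add:
  assumes "continuous_on (sphere 0 s) \<phi>" "continuous_on (sphere 0 s) \<psi>" "0 \<le> s"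
  shows "circ_mean (\<lambda>z. \<phi> z + \<psi> z) s = circ_mean \<phi> s + circ_mean \<psi> s"
  unfolding circ_mean_def
  by (subst integral_add) (use assms in \<open>auto intro!: integrable_on_sphere simp: scaleR_add_right\<close>)

lemma circ_mean_cmult:
  fixes \<phi> :: "complex \<Rightarrow> real"
  shows "circ_mean (\<lambda>z. c * \<phi> z) s = c * circ_mean \<phi> s"
  by (simp add: circ_mean_def)

lemma circ_mean_diff:
  fixes \<phi> :: "complex \<Rightarrow> real"
  assumes "continuous_on (sphere 0 s) \<phi>" "continuous_on (sphere 0 s) \<psi>" "0 \<le> s"
  shows "circ_mean (\<lambda>z. \<phi> z - \<psi> z) s = circ_mean \<phi> s - circ_mean \<psi> s"
  unfolding circ_mean_def
  by (subst integral_diff) (use assms in \<open>auto intro!: integrable_on_sphere simp: diff_divide_distrib\<close>)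

lemma circ_mean_sum:
  assumes "\<And>i. i \<in> I \<Longrightarrow> continuous_on (sphere 0 s) (\<phi> i)" "0 \<le> s"
  shows "circ_mean (\<lambda>z. \<Sum>i\<in>I. \<phi> i z) s = (\<Sum>i\<in>I. circ_mean (\<phi> i) s)"
  using assms
proof (induction I rule: infinite_finite_induct)
  case (insert i I)
  then show ?case
    by (simp add: circ_mean_add continuous_on_sum)
qed auto

lemma circ_mean_mono:
  fixes \<phi> \<psi> :: "complex \<Rightarrow> real"
  assumes "continuous_on (sphere 0 s) \<phi>" "continuous_on (sphere 0 s) \<psi>" "0 \<le> s"
    and "\<And>z. cmod z = s \<Longrightarrow> \<phi> z \<le> \<psi> z"
  shows "circ_mean \<phi> s \<le> circ_mean \<psi> s"
  unfolding circ_mean_def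
  by (intro scaleR_left_mono integral_le integrable_on_sphere) (use assms in \<open>auto simp: norm_mult\<close>)

lemma circ_mean_nonneg:
  fixes \<phi> :: "complex \<Rightarrow> real"
  assumes "continuous_on (sphere 0 s) \<phi>" "0 \<le> s" "\<And>z. cmod z = s \<Longrightarrow> 0 \<le> \<phi> z"
  shows "0 \<le> circ_mean \<phi> s"
  using circ_mean_mono[of s "\<lambda>_. 0" \<phi>] assms by simp

text \<open>Jensen's inequality, from the tangent of \<open>ln\<close> at the mean value.\<close>

lemma circ_mean_ln_le:
  fixes \<phi> :: "complex \<Rightarrow> real"
  assumes c: "continuous_on (sphere 0 s) \<phi>" and s: "0 \<le> s" and pos: "\<And>z. cmod z = s \<Longrightarrow> 0 < \<phi> z"
  shows "circ_mean (\<lambda>z. ln (\<phi> z)) s \<le> ln (circ_mean \<phi> s)" and "0 < circ_mean \<phi> s"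
proof -
  have cl: "continuous_on (sphere 0 s) (\<lambda>z. ln (\<phi> z))"
    by (intro continuous_intros c) (use pos in force)
  have "compact (sphere (0::complex) s)" "sphere (0::complex) s \<noteq> {}"
    using s by (auto simp: sphere_eq_empty)
  then obtain z0 where z0: "z0 \<in> sphere 0 s" "\<And>z. z \<in> sphere 0 s \<Longrightarrow> \<phi> z0 \<le> \<phi> z"
    using continuous_attains_inf[OF _ _ c] by blast
  have "\<phi> z0 = circ_mean (\<lambda>_. \<phi> z0) s" by simp
  also have "\<dots> \<le> circ_mean \<phi> s"
    by (rule circ_mean_mono) (use c s z0 in auto)
  finally show pos': "0 < circ_mean \<phi> s" using pos[of z0] z0 by simp
  let ?m = "circ_mean \<phi> s"
  have "circ_mean (\<lambda>z. ln (\<phi> z)) s \<le> circ_mean (\<lambda>z. (ln ?m - 1) + (1 / ?m) * \<phi> z) s"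
  proof (rule circ_mean_mono)
    fix z assume "cmod z = s"
    note p = pos[OF this]
    have "ln (\<phi> z / ?m) \<le> \<phi> z / ?m - 1" using p pos' by (intro ln_le_minus_one) simp
    then show "ln (\<phi> z) \<le> (ln ?m - 1) + (1 / ?m) * \<phi> z" using p pos' by (simp add: ln_div)
  qed (rule cl s continuous_on_add continuous_on_mult continuous_on_const c)+
  also have "\<dots> = (ln ?m - 1) + (1 / ?m) * ?m"
    using c s by (subst circ_mean_add) (auto intro!: continuous_on_mult simp del: times_divide_eq_left simp: circ_mean_cmult)
  finally show "circ_mean (\<lambda>z. ln (\<phi> z)) s \<le> ln ?m" using pos' by simp
qed

section \<open>Integration in polar coordinates\<close>

definition complex_of_vec :: "real^2 \<Rightarrow> complex" where
  "complex_of_vec v = Complex (v $ 1) (v $ 2)"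

lemma complex_of_vec_measurable [measurable]: "complex_of_vec \<in> borel_measurable borel"
  unfolding complex_of_vec_def Complex_eq
  by (intro borel_measurable_continuous_onI continuous_intros)

lemma vimage_complex_of_vec_box:
  "complex_of_vec -` box l u = box (vector [Re l, Im l]) (vector [Re u, Im u])"
  by (auto simp: complex_of_vec_def in_box_complex_iff mem_box_cart forall_2 vector_2)

lemma lborel_complex_eq_distr: "lborel = distr lborel borel complex_of_vec"
proof (rule lborel_eqI)
  fix l u :: complex assume le: "\<And>b. b \<in> Basis \<Longrightarrow> l \<bullet> b \<le> u \<bullet> b"
  have le': "Re l \<le> Re u" "Im l \<le> Im u" using le[of 1] le[of \<i>] by (auto simp: Basis_complex_def)
  have B: "(Basis :: (real^2) set) = {axis 1 1, axis 2 1}"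
    by (auto simp: Basis_vec_def UNIV_2)
  have ne: "axis 1 (1::real) \<noteq> (axis 2 1 :: real^2)" by (simp add: axis_eq_axis)
  have "emeasure (distr lborel borel complex_of_vec) (box l u)
      = emeasure lborel (box (vector [Re l, Im l]) (vector [Re u, Im u]) :: (real^2) set)"
    by (subst emeasure_distr) (auto simp: vimage_complex_of_vec_box)
  also have "\<dots> = ennreal ((Re u - Re l) * (Im u - Im l))"
    using le' ne by (subst emeasure_lborel_box) (auto simp: B inner_axis vector_2)
  also have "\<dots> = (\<Prod>b\<in>Basis. (u - l) \<bullet> b)"
    by (simp add: Basis_complex_def)
  finally show "emeasure (distr lborel borel complex_of_vec) (box l u) = (\<Prod>b\<in>Basis. (u - l) \<bullet> b)" .
qed simp

text \<open>Orthogonal maps of \<open>real^2\<close> preserve area, and the coordinate map carries this over to the complex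
  plane.\<close>

lemma lborel_distr_rotation: "distr lborel borel (\<lambda>z. cis \<alpha> * z) = (lborel :: complex measure)"
proof (rule lborel_eqI[symmetric])
  fix l u :: complex assume le: "\<And>b. b \<in> Basis \<Longrightarrow> l \<bullet> b \<le> u \<bullet> b"
  define f :: "real^2 \<Rightarrow> real^2" where
    "f = (\<lambda>v. vector [cos \<alpha> * v$1 + sin \<alpha> * v$2, - sin \<alpha> * v$1 + cos \<alpha> * v$2])"
  define g :: "real^2 \<Rightarrow> real^2" where
    "g = (\<lambda>v. vector [cos \<alpha> * v$1 - sin \<alpha> * v$2, sin \<alpha> * v$1 + cos \<alpha> * v$2])"
  have sc: "cos \<alpha> * cos \<alpha> + sin \<alpha> * sin \<alpha> = 1"
    using sin_cos_squared_add3[of \<alpha>] by simp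
  have fg: "f (g v) = v" for v
  proof -
    have "f (g v) $ 1 = v $ 1"
      using sc unfolding f_def g_def vector_2 by algebra
    moreover have "f (g v) $ 2 = v $ 2"
      using sc unfolding f_def g_def vector_2 by algebra
    ultimately show ?thesis by (simp add: vec_eq_iff forall_2)
  qed
  have gf: "g (f v) = v" for v
  proof -
    have "g (f v) $ 1 = v $ 1"
      using sc unfolding f_def g_def vector_2 by algebra
    moreover have "g (f v) $ 2 = v $ 2"
      using sc unfolding f_def g_def vector_2 by algebra
    ultimately show ?thesis by (simp add: vec_eq_iff forall_2)
  qed
  have orth: "orthogonal_transformation f"
    unfolding orthogonal_transformation_def
  proof (intro conjI allI)
    show "linear f" by (rule linearI) (auto simp: f_def vec_eq_iff forall_2 vector_2 algebra_simps)
    fix v w :: "real^2"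
    show "f v \<bullet> f w = v \<bullet> w"
      unfolding f_def inner_vec_def sum_2 vector_2 inner_real_def using sc by algebra
  qed
  have lin_g: "linear g" by (rule linearI) (auto simp: g_def vec_eq_iff forall_2 vector_2 algebra_simps)
  let ?B = "complex_of_vec -` box l u"
  have cg: "cis \<alpha> * complex_of_vec v = complex_of_vec (g v)" for v
    by (auto simp: complex_of_vec_def g_def vector_2 complex_eq_iff algebra_simps)
  have "emeasure (distr lborel borel (\<lambda>z. cis \<alpha> * z)) (box l u) =
        emeasure (distr lborel borel complex_of_vec) ((\<lambda>z. cis \<alpha> * z) -` box l u)"
    by (subst emeasure_distr) (auto simp: lborel_complex_eq_distr[symmetric])
  also have "\<dots> = emeasure lborel (complex_of_vec -` (\<lambda>z. cis \<alpha> * z) -` box l u)"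
    by (subst emeasure_distr) (auto intro!: borel_open open_vimage continuous_intros)
  also have "complex_of_vec -` (\<lambda>z. cis \<alpha> * z) -` box l u = f ` ?B"
    by (auto simp: cg gf intro!: image_eqI[where f=f, OF fg[symmetric]])
  also have "emeasure lborel (f ` ?B) = emeasure lebesgue (f ` ?B)"
  proof -
    have "open (g -` ?B)"
      using linear_continuous_on[OF linear_conv_bounded_linear[THEN iffD1, OF lin_g], of UNIV]
      unfolding vimage_complex_of_vec_box by (intro open_vimage open_box)
    moreover have "f ` ?B = g -` ?B" by (auto simp: gf intro!: image_eqI[where f=f, OF fg[symmetric]])
    ultimately show ?thesis by simp
  qed
  also have "\<dots> = emeasure lebesgue ?B"
  proof -
    have "?B \<in> lmeasurable" by (simp add: vimage_complex_of_vec_box)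
    then show ?thesis
      using measurable_orthogonal_image[OF orth, of ?B] measure_orthogonal_image[OF orth, of ?B]
      by (simp add: emeasure_eq_measure2)
  qed
  also have "\<dots> = emeasure (distr lborel borel complex_of_vec) (box l u)"
    by (subst emeasure_distr) (auto simp: vimage_complex_of_vec_box)
  also have "\<dots> = emeasure lborel (box l u)"
    by (simp add: lborel_complex_eq_distr[symmetric])
  also have "\<dots> = (\<Prod>b\<in>Basis. (u - l) \<bullet> b)" using le by (rule emeasure_lborel_box)
  finally show "emeasure (distr lborel borel (\<lambda>z. cis \<alpha> * z)) (box l u) = (\<Prod>b\<in>Basis. (u - l) \<bullet> b)" .
qed simp

lemma distr_norm_ball:
  assumes "0 < R"
  shows "distr (density lborel (indicator (ball (0::complex) R))) borel norm
    = density lborel (\<lambda>s. ennreal (2 * pi * s) * indicator {0..R} s)" (is "?M = ?N")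
proof (rule measure_eqI_lessThan)
  show "sets ?M = sets borel" "sets ?N = sets borel" by auto
  fix x :: real
  have ball: "emeasure lborel (ball (0::complex) r) = ennreal (pi * r\<^sup>2)" if "r \<ge> 0" for r
    using that by (simp add: emeasure_ball unit_ball_vol_2)
  have cball: "emeasure lborel (cball (0::complex) r) = ennreal (pi * r\<^sup>2)" if "r \<ge> 0" for r
    using that by (simp add: emeasure_cball unit_ball_vol_2)
  have "emeasure ?M {x<..} = emeasure lborel (ball (0::complex) R \<inter> norm -` {x<..})"
  proof -
    have *: "norm -` {x<..} \<in> sets (borel :: complex measure)"
      using measurable_sets[of norm borel borel "{x<..}"] by simp
    have "emeasure ?M {x<..} = emeasure (density lborel (indicator (ball (0::complex) R))) (norm -` {x<..})"
      by (subst emeasure_distr) auto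
    also have "\<dots> = (\<integral>\<^sup>+z. indicator (ball (0::complex) R) z * indicator (norm -` {x<..}) z \<partial>lborel)"
      by (rule emeasure_density) (use * in \<open>auto intro!: borel_measurable_indicator\<close>)
    also have "\<dots> = (\<integral>\<^sup>+z. indicator (ball (0::complex) R \<inter> norm -` {x<..}) z \<partial>lborel)"
      by (simp add: indicator_inter_arith)
    also have "\<dots> = emeasure lborel (ball (0::complex) R \<inter> norm -` {x<..})"
      using * by (subst nn_integral_indicator) auto
    finally show ?thesis .
  qed
  also have "\<dots> = ennreal (pi * (R\<^sup>2 - (max 0 (min x R))\<^sup>2))"
  proof (cases "0 \<le> x \<and> x < R")
    case True
    have "ball (0::complex) R \<inter> norm -` {x<..} = ball 0 R - cball 0 x" by auto
    then show ?thesis using True assms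
      by (simp add: emeasure_Diff ball cball ennreal_minus[symmetric] right_diff_distrib subset_iff)
  next
    case False
    then consider "x < 0" | "x \<ge> R" by linarith
    then show ?thesis
    proof cases
      case 1
      then have "ball (0::complex) R \<inter> norm -` {x<..} = ball 0 R"
        by (auto intro: less_le_trans[OF _ norm_ge_zero])
      then show ?thesis using 1 assms by (simp add: ball)
    next
      case 2
      then have "ball (0::complex) R \<inter> norm -` {x<..} = {}" by auto
      then show ?thesis using 2 assms by simp
    qed
  qed
  finally have M: "emeasure ?M {x<..} = ennreal (pi * (R\<^sup>2 - (max 0 (min x R))\<^sup>2))" .
  then show "emeasure ?M {x<..} < \<infinity>" by simp
  let ?c = "max 0 (min x R)"
  have "emeasure ?N {x<..} = (\<integral>\<^sup>+s. ennreal (2 * pi * s) * indicator {?c..R} s \<partial>lborel)"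
    by (subst emeasure_density, simp, simp, rule nn_integral_cong_AE)
       (use AE_lborel_singleton[of ?c] in eventually_elim, auto simp: indicator_def)
  also have "\<dots> = ennreal (pi * R\<^sup>2 - pi * ?c\<^sup>2)"
    by (rule nn_integral_FTC_Icc) (use assms in \<open>auto intro!: derivative_eq_intros\<close>)
  finally show "emeasure ?M {x<..} = emeasure ?N {x<..}"
    by (simp add: M right_diff_distrib)
qed

lemma integral_periodic_shift:
  fixes h :: "real \<Rightarrow> real"
  assumes c: "continuous_on UNIV h" and per: "\<And>x. h (x + 2 * pi) = h x" and \<beta>: "0 \<le> \<beta>" "\<beta> \<le> 2 * pi"
  shows "integral {0..2*pi} (\<lambda>x. h (x + \<beta>)) = integral {0..2*pi} h"
proof -
  have i: "h integrable_on {a..b}" for a b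
    by (rule integrable_continuous_interval[OF continuous_on_subset[OF c]]) auto
  have sh: "integral {a..b} (\<lambda>x. h (x + c)) = integral {a+c..b+c} h" for a b c
    using integral_shift_Icc_real[of a b h c] by (simp add: o_def add.commute)
  have "integral {0..2*pi} (\<lambda>x. h (x + \<beta>)) = integral {\<beta>..2*pi+\<beta>} h"
    using sh[of 0 "2*pi" \<beta>] by simp
  also have "\<dots> = integral {\<beta>..2*pi} h + integral {2*pi..2*pi+\<beta>} h"
    using \<beta> i by (intro Henstock_Kurzweil_Integration.integral_combine[symmetric]) auto
  also have "integral {2*pi..2*pi+\<beta>} h = integral {0..\<beta>} h"
    using sh[of 0 \<beta> "2*pi"] per by (simp add: algebra_simps)
  also have "integral {\<beta>..2*pi} h + integral {0..\<beta>} h = integral {0..2*pi} h"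
    using \<beta> i Henstock_Kurzweil_Integration.integral_combine[of 0 \<beta> "2*pi" h] by auto
  finally show ?thesis .
qed

text \<open>Averaging the integral over all rotations of the disc (Tonelli) replaces \<open>\<phi>\<close> by its circle mean,
  a function of the modulus alone, and the image of area under the modulus has density \<open>2 \<pi> s\<close>.\<close>

theorem integral_ball_polar:
  fixes \<phi> :: "complex \<Rightarrow> real"
  assumes c: "continuous_on (ball 0 R) \<phi>" and nn: "\<And>z. z \<in> ball 0 R \<Longrightarrow> \<phi> z \<ge> 0"
    and t: "0 < t" "t < R"
  shows "integral (ball 0 t) \<phi> = integral {0..t} (\<lambda>s. 2 * pi * s * circ_mean \<phi> s)"
proof -
  define \<psi> where "\<psi> = (\<lambda>z. indicator (ball 0 t) z *\<^sub>R \<phi> z)"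
  let ?P = "\<integral>\<^sup>+z. ennreal (\<psi> z) \<partial>lborel" and ?I = "integral {0..t} (\<lambda>s. 2 * pi * s * circ_mean \<phi> s)"
  have \<psi>0: "\<psi> z \<ge> 0" for z using nn t by (auto simp: \<psi>_def indicator_def)
  have \<psi>m [measurable]: "\<psi> \<in> borel_measurable borel"
    unfolding \<psi>_def
    by (rule borel_measurable_continuous_on_indicator) (use t in \<open>auto intro: continuous_on_subset[OF c]\<close>)
  have cis_m [measurable]: "cis \<in> borel_measurable borel"
    by (intro borel_measurable_continuous_onI continuous_intros)
  have cm: "continuous_on {0..t} (circ_mean \<phi>)"
    by (rule continuous_on_subset[OF continuous_on_circ_mean[OF c]]) (use t in auto)
  have cm0: "circ_mean \<phi> s \<ge> 0" if "s \<in> {0..t}" for s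
  proof -
    have "0 \<le> integral {0..2*pi} (\<lambda>x. \<phi> (of_real s * cis x))"
      by (rule Henstock_Kurzweil_Integration.integral_nonneg[OF integrable_on_circle[OF c]])
         (use that t nn in \<open>auto simp: norm_mult\<close>)
    then show ?thesis by (simp add: circ_mean_def)
  qed
  define F where "F = (\<lambda>s. indicator {0..t} s *\<^sub>R (2 * pi * circ_mean \<phi> s))"
  have Fm [measurable]: "F \<in> borel_measurable borel"
    unfolding F_def
    by (rule borel_measurable_continuous_on_indicator) (use cm in \<open>auto intro!: continuous_intros\<close>)
  have J: "(\<integral>\<^sup>+\<alpha>. indicator {0..2*pi} \<alpha> * ennreal (\<psi> (cis \<alpha> * z)) \<partial>lborel)
     = indicator (ball 0 t) z * ennreal (F (norm z))" for z
  proof (cases "z \<in> ball 0 t")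
    case False
    then show ?thesis by (simp add: \<psi>_def norm_mult)
  next
    case True
    define \<beta> where "\<beta> = Arg2pi z"
    have \<beta>: "0 \<le> \<beta>" "\<beta> \<le> 2 * pi" using Arg2pi[of z] by (auto simp: \<beta>_def)
    have z: "z = of_real (norm z) * cis \<beta>"
      using Arg2pi[of z] by (simp add: \<beta>_def cis_conv_exp is_Arg_def)
    let ?h = "\<lambda>x. \<phi> (of_real (norm z) * cis x)"
    have ch: "continuous_on X ?h" for X
      by (rule continuous_on_circle[OF c]) (use True t in auto)
    have e: "\<phi> (cis \<alpha> * z) = ?h (\<alpha> + \<beta>)" for \<alpha>
      by (subst z) (simp add: cis_mult[symmetric] mult_ac)
    have "((\<lambda>x. ?h (x + \<beta>)) has_integral integral {0..2*pi} (\<lambda>x. ?h (x + \<beta>))) {0..2*pi}"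
      by (intro integrable_integral integrable_continuous_interval continuous_on_compose2[OF ch])
         (auto intro!: continuous_intros)
    also have "integral {0..2*pi} (\<lambda>x. ?h (x + \<beta>)) = integral {0..2*pi} ?h"
    proof (rule integral_periodic_shift[OF ch _ \<beta>])
      have "cis (x + 2 * pi) = cis x" for x by (simp add: cis_mult[symmetric])
      then show "?h (x + 2 * pi) = ?h x" for x by simp
    qed
    finally have "(\<integral>\<^sup>+\<alpha>. ennreal (indicator {0..2*pi} \<alpha> * ?h (\<alpha> + \<beta>)) \<partial>lborel) = ennreal (integral {0..2*pi} ?h)"
      using True t nn by (intro nn_integral_has_integral_lebesgue) (auto simp: norm_mult)
    also have "integral {0..2*pi} ?h = F (norm z)"
      using True by (simp add: F_def circ_mean_def)
    finally show ?thesis using True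
      by (simp add: \<psi>_def norm_mult e ennreal_mult'[symmetric] ennreal_indicator[symmetric])
  qed
  have "2 * pi * ?P
      = (\<integral>\<^sup>+\<alpha>. indicator {0..2*pi} \<alpha> * ?P \<partial>lborel)"
    by (simp add: nn_integral_multc ennreal_mult)
  also have "\<dots> = (\<integral>\<^sup>+\<alpha>. (\<integral>\<^sup>+z. indicator {0..2*pi} \<alpha> * ennreal (\<psi> (cis \<alpha> * z)) \<partial>lborel) \<partial>lborel)"
  proof (intro nn_integral_cong)
    fix \<alpha> :: real
    have "?P = (\<integral>\<^sup>+z. ennreal (\<psi> z) \<partial>distr lborel borel (\<lambda>z. cis \<alpha> * z))"
      by (simp add: lborel_distr_rotation)
    also have "\<dots> = (\<integral>\<^sup>+z. ennreal (\<psi> (cis \<alpha> * z)) \<partial>lborel)"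
      by (rule nn_integral_distr) auto
    finally show "indicator {0..2*pi} \<alpha> * ?P
        = (\<integral>\<^sup>+z. indicator {0..2*pi} \<alpha> * ennreal (\<psi> (cis \<alpha> * z)) \<partial>lborel)"
      by (simp add: nn_integral_cmult)
  qed
  also have "\<dots> = (\<integral>\<^sup>+z. (\<integral>\<^sup>+\<alpha>. indicator {0..2*pi} \<alpha> * ennreal (\<psi> (cis \<alpha> * z)) \<partial>lborel) \<partial>lborel)"
    by (rule lborel_pair.Fubini') measurable
  also have "\<dots> = (\<integral>\<^sup>+z. indicator (ball (0::complex) t) z * ennreal (F (norm z)) \<partial>lborel)"
    by (simp add: J)
  also have "\<dots> = (\<integral>\<^sup>+z. ennreal (F (norm z)) \<partial>density lborel (indicator (ball (0::complex) t)))"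
    by (subst nn_integral_density) (auto intro!: borel_measurable_indicator)
  also have "\<dots> = (\<integral>\<^sup>+s. ennreal (F s) \<partial>distr (density lborel (indicator (ball (0::complex) t))) borel norm)"
    by (subst nn_integral_distr) auto
  also have "\<dots> = (\<integral>\<^sup>+s. ennreal (2 * pi * s) * indicator {0..t} s * ennreal (F s) \<partial>lborel)"
    by (subst distr_norm_ball[OF t(1)], subst nn_integral_density) auto
  also have "\<dots> = (\<integral>\<^sup>+s. ennreal (2 * pi) * ennreal (indicator {0..t} s * (2 * pi * s * circ_mean \<phi> s)) \<partial>lborel)"
    by (rule nn_integral_cong) (auto simp: F_def indicator_def cm0 ennreal_mult'[symmetric] mult_ac)
  also have "\<dots> = ennreal (2 * pi) * (\<integral>\<^sup>+s. ennreal (indicator {0..t} s * (2 * pi * s * circ_mean \<phi> s)) \<partial>lborel)"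
  proof (rule nn_integral_cmult)
    have "(\<lambda>s. indicator {0..t} s *\<^sub>R (2 * pi * s * circ_mean \<phi> s)) \<in> borel_measurable borel"
      by (rule borel_measurable_continuous_on_indicator) (use cm in \<open>auto intro!: continuous_intros\<close>)
    then show "(\<lambda>s. ennreal (indicator {0..t} s * (2 * pi * s * circ_mean \<phi> s))) \<in> borel_measurable lborel" by simp
  qed
  also have "(\<integral>\<^sup>+s. ennreal (indicator {0..t} s * (2 * pi * s * circ_mean \<phi> s)) \<partial>lborel)
     = ennreal (?I)"
    by (rule nn_integral_has_integral_lebesgue)
       (use cm cm0 in \<open>auto intro!: integrable_integral integrable_continuous_interval continuous_intros\<close>)
  finally have "?P = ennreal (?I)"
    by (subst (asm) ennreal_mult_cancel_left) auto
  then have "(\<psi> has_integral ?I) UNIV"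
    using \<psi>0 cm cm0 by (intro nn_integral_has_integral)
      (auto intro!: Henstock_Kurzweil_Integration.integral_nonneg integrable_continuous_interval continuous_intros)
  also have "\<psi> = (\<lambda>z. if z \<in> ball 0 t then \<phi> z else 0)" by (auto simp: \<psi>_def)
  finally have "(\<phi> has_integral ?I) (ball 0 t)"
    unfolding has_integral_restrict_UNIV .
  then show ?thesis by (rule integral_unique)
qed

section \<open>The Fubini--Study potential of a holomorphic pair\<close>

definition wronskian :: "(complex \<Rightarrow> complex) \<Rightarrow> (complex \<Rightarrow> complex) \<Rightarrow> complex \<Rightarrow> complex" where
  "wronskian u v z = u z * deriv v z - deriv u z * v z"

definition sq_norm :: "(complex \<Rightarrow> complex) \<Rightarrow> (complex \<Rightarrow> complex) \<Rightarrow> complex \<Rightarrow> real" where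
  "sq_norm u v z = (cmod (u z))\<^sup>2 + (cmod (v z))\<^sup>2"

text \<open>The squared spherical derivative of \<open>v / u\<close>, written without division by \<open>u\<close>.\<close>

definition fs_density :: "(complex \<Rightarrow> complex) \<Rightarrow> (complex \<Rightarrow> complex) \<Rightarrow> complex \<Rightarrow> real" where
  "fs_density u v z = (cmod (wronskian u v z))\<^sup>2 / (sq_norm u v z)\<^sup>2"

text \<open>The Wirtinger derivative of \<open>ln (|u|^2 + |v|^2)\<close> with respect to \<open>z\<close>.\<close>

definition fs_deriv :: "(complex \<Rightarrow> complex) \<Rightarrow> (complex \<Rightarrow> complex) \<Rightarrow> complex \<Rightarrow> complex" where
  "fs_deriv u v z = (deriv u z * cnj (u z) + deriv v z * cnj (v z)) / of_real (sq_norm u v z)"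

lemma of_real_sq_norm: "of_real (sq_norm u v z) = u z * cnj (u z) + v z * cnj (v z)"
  unfolding sq_norm_def of_real_add complex_norm_square ..

lemma sq_norm_pos: "u z \<noteq> 0 \<or> v z \<noteq> 0 \<Longrightarrow> sq_norm u v z > 0"
  by (auto simp: sq_norm_def intro: add_pos_nonneg add_nonneg_pos)

lemma fs_potential_sq_norm: "fs_potential (u z) (v z) = ln (sq_norm u v z)"
  by (simp add: fs_potential_def sq_norm_def)

lemma has_derivative_cnj_comp:
  assumes "(f has_field_derivative d) (at z)"
  shows "((\<lambda>w. cnj (f w)) has_derivative (\<lambda>h. cnj d * cnj h)) (at z)"
  using has_derivative_cnj[OF has_field_derivative_imp_has_derivative[OF assms]] by simp

lemma has_derivative_fs_potential:
  assumes u: "(u has_field_derivative deriv u z) (at z)" and v: "(v has_field_derivative deriv v z) (at z)"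
    and nz: "u z \<noteq> 0 \<or> v z \<noteq> 0"
  shows "((\<lambda>w. of_real (fs_potential (u w) (v w)) :: complex) has_derivative
      (\<lambda>h. fs_deriv u v z * h + cnj (fs_deriv u v z) * cnj h)) (at z)"
proof -
  note u' = has_field_derivative_imp_has_derivative[OF u] and v' = has_field_derivative_imp_has_derivative[OF v]
  note cu = has_derivative_cnj_comp[OF u] and cv = has_derivative_cnj_comp[OF v]
  have pos: "sq_norm u v z > 0" using sq_norm_pos[of u z v] nz by blast
  let ?a = "deriv u z * cnj (u z) + deriv v z * cnj (v z)"
  have "((\<lambda>w. u w * cnj (u w) + v w * cnj (v w)) has_derivative (\<lambda>h. ?a * h + cnj ?a * cnj h)) (at z)"
    by (rule has_derivative_eq_rhs[OF has_derivative_add[OF has_derivative_mult[OF u' cu] has_derivative_mult[OF v' cv]]])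
       (auto simp: algebra_simps)
  then have "((\<lambda>w. Re (u w * cnj (u w) + v w * cnj (v w))) has_derivative (\<lambda>h. Re (?a * h + cnj ?a * cnj h))) (at z)"
    by (rule has_derivative_Re)
  then have "((\<lambda>w. sq_norm u v w) has_derivative (\<lambda>h. Re (?a * h + cnj ?a * cnj h))) (at z)"
    by (simp only: of_real_sq_norm[symmetric] Re_complex_of_real)
  from has_derivative_ln[OF pos this]
  have "((\<lambda>w. ln (sq_norm u v w)) has_derivative (\<lambda>h. Re (?a * h + cnj ?a * cnj h) * inverse (sq_norm u v z))) (at z)" .
  from has_derivative_of_real[OF this, where 'a=complex]
  have "((\<lambda>w. of_real (ln (sq_norm u v w)) :: complex) has_derivative
     (\<lambda>h. of_real (Re (?a * h + cnj ?a * cnj h) * inverse (sq_norm u v z)))) (at z)" .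
  moreover have "of_real (Re (?a * h + cnj ?a * cnj h) * inverse (sq_norm u v z))
      = fs_deriv u v z * h + cnj (fs_deriv u v z) * cnj h" for h
  proof -
    have "of_real (Re (?a * h + cnj ?a * cnj h)) = ?a * h + cnj ?a * cnj h"
    proof -
      have "of_real (Re (w + cnj w)) = w + cnj w" for w by (simp add: complex_eq_iff)
      from this[of "?a * h"] show ?thesis by (simp only: complex_cnj_mult[of ?a h])
    qed
    moreover have "(a * h + cnj a * cnj h) * inverse (of_real n) = a / of_real n * h + cnj (a / of_real n) * cnj h"
      for a :: complex and n :: real by (simp add: divide_inverse algebra_simps)
    ultimately show ?thesis unfolding fs_deriv_def of_real_mult of_real_inverse by presburger
  qed
  ultimately show ?thesis by (simp only: fs_potential_sq_norm)
qed

text \<open>The pure second derivative of the potential, twice with respect to \<open>z\<close>; the mixed second derivative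
  is \<open>fs_density\<close>.\<close>

definition fs_deriv2 :: "(complex \<Rightarrow> complex) \<Rightarrow> (complex \<Rightarrow> complex) \<Rightarrow> complex \<Rightarrow> complex" where
  "fs_deriv2 u v z = (deriv (deriv u) z * cnj (u z) + deriv (deriv v) z * cnj (v z)) / of_real (sq_norm u v z)
     - (fs_deriv u v z)\<^sup>2"

text \<open>The mixed derivative is \<open>((|u'|^2 + |v'|^2) N - |u' cnj u + v' cnj v|^2) / N^2\<close>, whose numerator is
  \<open>|W|^2\<close> by Lagrange's identity.\<close>

lemma has_derivative_fs_deriv:
  assumes u: "(u has_field_derivative deriv u z) (at z)" and v: "(v has_field_derivative deriv v z) (at z)"
    and u2: "(deriv u has_field_derivative deriv (deriv u) z) (at z)" 
    and v2: "(deriv v has_field_derivative deriv (deriv v) z) (at z)"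
    and nz: "u z \<noteq> 0 \<or> v z \<noteq> 0"
  shows "(fs_deriv u v has_derivative (\<lambda>h. fs_deriv2 u v z * h + of_real (fs_density u v z) * cnj h)) (at z)"
proof -
  note u' = has_field_derivative_imp_has_derivative[OF u] and v' = has_field_derivative_imp_has_derivative[OF v]
  note u2' = has_field_derivative_imp_has_derivative[OF u2] and v2' = has_field_derivative_imp_has_derivative[OF v2]
  note cu = has_derivative_cnj_comp[OF u] and cv = has_derivative_cnj_comp[OF v]
  let ?N = "u z * cnj (u z) + v z * cnj (v z)"
  let ?a = "deriv u z * cnj (u z) + deriv v z * cnj (v z)"
  have N0: "?N \<noteq> 0" using sq_norm_pos[of u z v] nz unfolding of_real_sq_norm[symmetric] by simp
  have dN: "((\<lambda>w. u w * cnj (u w) + v w * cnj (v w)) has_derivative (\<lambda>h. ?a * h + cnj ?a * cnj h)) (at z)"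
    by (rule has_derivative_eq_rhs[OF has_derivative_add[OF has_derivative_mult[OF u' cu] has_derivative_mult[OF v' cv]]])
       (auto simp: algebra_simps)
  have da: "((\<lambda>w. deriv u w * cnj (u w) + deriv v w * cnj (v w)) has_derivative
     (\<lambda>h. (deriv (deriv u) z * cnj (u z) + deriv (deriv v) z * cnj (v z)) * h
        + (deriv u z * cnj (deriv u z) + deriv v z * cnj (deriv v z)) * cnj h)) (at z)"
    by (rule has_derivative_eq_rhs[OF has_derivative_add[OF has_derivative_mult[OF u2' cu] has_derivative_mult[OF v2' cv]]])
       (auto simp: algebra_simps)
  have Q: "of_real (fs_density u v z) = 
     ((deriv u z * cnj (deriv u z) + deriv v z * cnj (deriv v z)) * ?N - ?a * cnj ?a) / (?N * ?N)"
    unfolding fs_density_def of_real_divide complex_norm_square[of "wronskian u v z"]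
    unfolding of_real_power of_real_sq_norm wronskian_def power2_eq_square[of ?N]
    by (rule arg_cong2[where f="(/)"]) (simp_all add: algebra_simps)
  have "((\<lambda>w. (deriv u w * cnj (u w) + deriv v w * cnj (v w)) / (u w * cnj (u w) + v w * cnj (v w)))
     has_derivative (\<lambda>h. fs_deriv2 u v z * h + of_real (fs_density u v z) * cnj h)) (at z)"
    by (rule has_derivative_eq_rhs[OF has_derivative_divide'[OF da dN N0]])
       (use N0 in \<open>simp add: fun_eq_iff Q fs_deriv2_def fs_deriv_def of_real_sq_norm divide_simps\<close>, simp add: algebra_simps power2_eq_square)
  then show ?thesis unfolding fs_deriv_def[abs_def] of_real_sq_norm .
qed

lemma wirtinger_has_derivative:
  assumes "(\<phi> has_derivative (\<lambda>h. A * h + B * cnj h)) (at z)"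
  shows "wirtinger \<phi> z = A" "wirtinger_bar \<phi> z = B"
proof -
  have px: "partial_x \<phi> z = A + B"
  proof -
    have "((\<lambda>t::real. z + of_real t) has_vector_derivative 1) (at 0)"
      by (auto intro!: derivative_eq_intros simp: has_vector_derivative_def scaleR_conv_of_real)
    from has_vector_derivative_along[where \<phi>=\<phi> and A=A and B=B, OF _ this] assms
    have "((\<lambda>t::real. \<phi> (z + of_real t)) has_vector_derivative A * 1 + B * cnj 1) (at 0)" by simp
    then show ?thesis by (simp add: partial_x_def vector_derivative_at)
  qed
  have py: "partial_y \<phi> z = A * \<i> - B * \<i>"
  proof -
    have "((\<lambda>t::real. z + \<i> * of_real t) has_vector_derivative \<i>) (at 0)"
      by (auto intro!: derivative_eq_intros simp: has_vector_derivative_def scaleR_conv_of_real)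
    from has_vector_derivative_along[where \<phi>=\<phi> and A=A and B=B, OF _ this] assms
    have "((\<lambda>t::real. \<phi> (z + \<i> * of_real t)) has_vector_derivative A * \<i> + B * cnj \<i>) (at 0)" by simp
    then show ?thesis by (simp add: partial_y_def vector_derivative_at)
  qed
  show "wirtinger \<phi> z = A" "wirtinger_bar \<phi> z = B"
    by (simp_all add: wirtinger_def wirtinger_bar_def px py field_simps)
qed

lemma ddc_fs_potential:
  assumes S: "open S" "z \<in> S" and u: "u holomorphic_on S" and v: "v holomorphic_on S"
    and nz: "u z \<noteq> 0 \<or> v z \<noteq> 0"
  shows "ddc (\<lambda>w. fs_potential (u w) (v w)) z = fs_density u v z / pi"
proof -
  define S' where "S' = S \<inter> (\<lambda>w. sq_norm u v w) -` {0<..}"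
  have op: "open S'" unfolding S'_def sq_norm_def
    by (intro continuous_open_preimage S) (auto intro!: continuous_intros holomorphic_on_imp_continuous_on u v)
  have z: "z \<in> S'" using S sq_norm_pos[of u z v] nz by (auto simp: S'_def)
  have nz': "u w \<noteq> 0 \<or> v w \<noteq> 0" if "w \<in> S'" for w using that by (auto simp: S'_def sq_norm_def)
  have sub: "w \<in> S" if "w \<in> S'" for w using that by (auto simp: S'_def)
  have bar: "cnj (fs_deriv u v w) = wirtinger_bar (\<lambda>w. of_real (fs_potential (u w) (v w))) w" if "w \<in> S'" for w
    by (rule wirtinger_has_derivative(2)[symmetric, OF has_derivative_fs_potential])
       (use nz'[OF that] sub[OF that] S u v in \<open>auto intro: holomorphic_derivI\<close>)
  have "(fs_deriv u v has_derivative (\<lambda>h. fs_deriv2 u v z * h + of_real (fs_density u v z) * cnj h)) (at z)"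
    by (rule has_derivative_fs_deriv)
       (use nz S u v holomorphic_deriv[OF u] holomorphic_deriv[OF v] in \<open>auto intro: holomorphic_derivI\<close>)
  from has_derivative_cnj[OF this]
  have "((\<lambda>w. cnj (fs_deriv u v w)) has_derivative (\<lambda>h. of_real (fs_density u v z) * h + cnj (fs_deriv2 u v z) * cnj h)) (at z)"
    by (simp add: add.commute)
  then have "(wirtinger_bar (\<lambda>w. of_real (fs_potential (u w) (v w))) has_derivative
      (\<lambda>h. of_real (fs_density u v z) * h + cnj (fs_deriv2 u v z) * cnj h)) (at z)"
    by (rule has_derivative_transform_within_open[OF _ op z bar])
  from wirtinger_has_derivative(1)[OF this] show ?thesis by (simp add: ddc_def)
qed

text \<open>Two applications of \<open>circ_mean_has_derivative\<close>: first to the potential, then to \<open>z\<close> times its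
  \<open>z\<close>-derivative, whose mean vanishes at radius \<open>0\<close>.\<close>

theorem circ_mean_fs_potential:
  assumes u: "u holomorphic_on ball 0 R" and v: "v holomorphic_on ball 0 R"
    and nz: "\<And>z. z \<in> ball 0 R \<Longrightarrow> u z \<noteq> 0 \<or> v z \<noteq> 0" and r: "0 < r1" "r1 \<le> r" "r < R"
  shows "circ_mean (\<lambda>z. fs_potential (u z) (v z)) r - circ_mean (\<lambda>z. fs_potential (u z) (v z)) r1 =
    integral {r1..r} (\<lambda>t. integral {0..t} (\<lambda>s. 4 * s * circ_mean (fs_density u v) s) / t)"
proof -
  note u2 = holomorphic_deriv[OF u open_ball] and v2 = holomorphic_deriv[OF v open_ball]
  note u3 = holomorphic_deriv[OF u2 open_ball] and v3 = holomorphic_deriv[OF v2 open_ball]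
  note cu = u[THEN holomorphic_on_imp_continuous_on] v[THEN holomorphic_on_imp_continuous_on]
    u2[THEN holomorphic_on_imp_continuous_on] v2[THEN holomorphic_on_imp_continuous_on]
    u3[THEN holomorphic_on_imp_continuous_on] v3[THEN holomorphic_on_imp_continuous_on]
  note du = holomorphic_derivI[OF u open_ball] holomorphic_derivI[OF v open_ball]
    holomorphic_derivI[OF u2 open_ball] holomorphic_derivI[OF v2 open_ball]
  have N0: "sq_norm u v z \<noteq> 0" if "z \<in> ball 0 R" for z using sq_norm_pos[of u z v] nz[OF that] by simp
  have cN: "continuous_on (ball 0 R) (sq_norm u v)"
    unfolding sq_norm_def[abs_def] by (intro continuous_intros cu)
  have cA: "continuous_on (ball 0 R) (fs_deriv u v)"
    unfolding fs_deriv_def[abs_def] using N0 by (intro continuous_intros cu cN) auto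
  have cP: "continuous_on (ball 0 R) (fs_deriv2 u v)"
    unfolding fs_deriv2_def[abs_def] using N0 by (intro continuous_intros cu cN cA) auto
  have cQ: "continuous_on (ball 0 R) (fs_density u v)"
    unfolding fs_density_def[abs_def] wronskian_def using N0 by (intro continuous_intros cu cN) auto
  have cU: "continuous_on (ball 0 R) (\<lambda>z. of_real (fs_potential (u z) (v z)) :: complex)"
    unfolding fs_potential_sq_norm using N0 by (intro continuous_intros cN) auto
  let ?U = "\<lambda>z. of_real (fs_potential (u z) (v z)) :: complex"
  let ?V = "\<lambda>z. z * fs_deriv u v z"
  have dU: "(?U has_derivative (\<lambda>h. fs_deriv u v z * h + cnj (fs_deriv u v z) * cnj h)) (at z)"
    if "z \<in> ball 0 R" for z
    by (rule has_derivative_fs_potential) (use that du nz in blast)+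
  have cV: "continuous_on (ball 0 R) ?V" by (intro continuous_intros cA)
  have dV: "(?V has_derivative (\<lambda>h. (fs_deriv u v z + z * fs_deriv2 u v z) * h + (z * of_real (fs_density u v z)) * cnj h)) (at z)"
    if "z \<in> ball 0 R" for z
  proof -
    have "(fs_deriv u v has_derivative (\<lambda>h. fs_deriv2 u v z * h + of_real (fs_density u v z) * cnj h)) (at z)"
      by (rule has_derivative_fs_deriv) (use that du nz in blast)+
    from has_derivative_mult[OF has_derivative_ident this]
    show ?thesis by (rule has_derivative_eq_rhs) (auto simp: algebra_simps)
  qed
  define \<zeta> where "\<zeta> = (\<lambda>t. Re (circ_mean ?V t))"
  have \<zeta>': "(\<zeta> has_vector_derivative 2 * t * circ_mean (fs_density u v) t) (at t)" if t: "0 < t" "t < R" for t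
  proof -
    have "(circ_mean ?V has_vector_derivative
       (2 / t) *\<^sub>R circ_mean (\<lambda>z. cnj z * (z * of_real (fs_density u v z))) t) (at t)"
      by (rule circ_mean_has_derivative(2)[OF dV]) (use t in \<open>auto intro!: continuous_intros cA cP cQ\<close>)
    from bounded_linear.has_vector_derivative[OF bounded_linear_Re this]
    have "(\<zeta> has_vector_derivative (2 / t) * Re (circ_mean (\<lambda>z. cnj z * (z * of_real (fs_density u v z))) t)) (at t)"
      by (simp add: \<zeta>_def)
    also have "Re (circ_mean (\<lambda>z. cnj z * (z * of_real (fs_density u v z))) t)
       = circ_mean (\<lambda>z. Re (cnj z * (z * of_real (fs_density u v z)))) t"
      by (rule Re_circ_mean[where R=R]) (use t in \<open>auto intro!: continuous_intros cQ\<close>)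
    also have "\<dots> = circ_mean (\<lambda>z. t\<^sup>2 * fs_density u v z) t"
    proof (rule circ_mean_cong)
      fix z assume z: "cmod z = \<bar>t\<bar>"
      have "cnj z * (z * of_real (fs_density u v z)) = of_real ((cmod z)\<^sup>2 * fs_density u v z)"
        unfolding of_real_mult complex_norm_square by (simp add: mult_ac)
      then have "Re (cnj z * (z * of_real (fs_density u v z))) = (cmod z)\<^sup>2 * fs_density u v z"
        by (simp only: Re_complex_of_real)
      then show "Re (cnj z * (z * of_real (fs_density u v z))) = t\<^sup>2 * fs_density u v z"
        using z by (simp only: power2_abs)
    qed
    also have "\<dots> = t\<^sup>2 * circ_mean (fs_density u v) t"
      by (simp add: circ_mean_def)
    finally show ?thesis using t by (simp add: power2_eq_square mult_ac)
  qed
  have c\<zeta>: "continuous_on {0..<R} \<zeta>"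
    unfolding \<zeta>_def by (intro continuous_intros continuous_on_circ_mean cV)
  have \<zeta>_eq: "integral {0..t} (\<lambda>s. 4 * s * circ_mean (fs_density u v) s) = 2 * \<zeta> t" if t: "0 < t" "t < R" for t
  proof -
    have "((\<lambda>s. 2 * s * circ_mean (fs_density u v) s) has_integral \<zeta> t - \<zeta> 0) {0..t}"
      by (rule fundamental_theorem_of_calculus_interior)
         (use t \<zeta>' in \<open>auto intro: continuous_on_subset[OF c\<zeta>]\<close>)
    from has_integral_mult_right[OF this, of 2] show ?thesis
      by (intro integral_unique) (simp add: \<zeta>_def mult_ac)
  qed
  let ?M = "circ_mean (\<lambda>z. fs_potential (u z) (v z))"
  have "((\<lambda>t. 2 * \<zeta> t / t) has_integral ?M r
      - ?M r1) {r1..r}"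
  proof (rule fundamental_theorem_of_calculus[OF r(2)])
    fix t assume t: "t \<in> {r1..r}"
    then have t': "0 < t" "t < R" using r by auto
    have "(circ_mean ?U has_vector_derivative (2 / t) *\<^sub>R circ_mean ?V t) (at t)"
      by (rule circ_mean_has_derivative(1)[OF dU]) (use t' in \<open>auto intro!: continuous_intros cA\<close>)
    from bounded_linear.has_vector_derivative[OF bounded_linear_Re this]
    have "((\<lambda>t. Re (circ_mean ?U t)) has_vector_derivative 2 * \<zeta> t / t) (at t)" by (simp add: \<zeta>_def)
    then have "(?M has_vector_derivative 2 * \<zeta> t / t) (at t)"
    proof (rule has_vector_derivative_transform_within_open)
      show "open {0<..<R}" "t \<in> {0<..<R}" using t' by auto
      fix x assume "x \<in> {0<..<R}"
      then show "Re (circ_mean ?U x) = ?M x"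
        by (subst Re_circ_mean[OF cU]) auto
    qed
    then show "(?M has_vector_derivative 2 * \<zeta> t / t) (at t within {r1..r})"
      by (rule has_vector_derivative_at_within)
  qed
  moreover have "integral {r1..r} (\<lambda>t. integral {0..t} (\<lambda>s. 4 * s * circ_mean (fs_density u v) s) / t)
     = integral {r1..r} (\<lambda>t. 2 * \<zeta> t / t)"
    by (rule Henstock_Kurzweil_Integration.integral_cong) (use \<zeta>_eq r in auto)
  ultimately show ?thesis by (simp add: integral_unique)
qed

section \<open>Jensen's formula\<close>

lemma circ_mean_holomorphic:
  assumes l: "l holomorphic_on ball 0 R" and s: "0 < s" "s < R"
  shows "circ_mean l s = l 0"
proof -
  have "((\<lambda>_. 0) has_integral circ_mean l s - circ_mean l 0) {0..s}"
  proof (rule fundamental_theorem_of_calculus_interior)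
    show "continuous_on {0..s} (circ_mean l)"
      by (rule continuous_on_subset[OF continuous_on_circ_mean[OF holomorphic_on_imp_continuous_on[OF l]]]) (use s in auto)
    fix x assume x: "x \<in> {0<..<s}"
    have "(circ_mean l has_vector_derivative (2 / x) *\<^sub>R circ_mean (\<lambda>z. cnj z * 0) x) (at x)"
    proof (rule circ_mean_has_derivative(2))
      fix z :: complex assume "z \<in> ball 0 R"
      from holomorphic_derivI[OF l open_ball this]
      show "(l has_derivative (\<lambda>h. deriv l z * h + 0 * cnj h)) (at z)"
        by (simp add: has_field_derivative_def)
    next
      show "continuous_on (ball 0 R) (deriv l)"
        by (intro holomorphic_on_imp_continuous_on holomorphic_deriv l open_ball)
    qed (use x s in auto)
    then show "(circ_mean l has_vector_derivative 0) (at x)" by simp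
  qed (use s in auto)
  then show ?thesis by simp
qed

lemma circ_mean_ln_nonvanishing:
  assumes k: "k holomorphic_on ball 0 R" and nz: "\<And>z. z \<in> ball 0 R \<Longrightarrow> k z \<noteq> 0" and s: "0 < s" "s < R"
  shows "circ_mean (\<lambda>z. ln (cmod (k z))) s = ln (cmod (k 0))"
proof -
  obtain l where l: "l holomorphic_on ball 0 R" "\<And>z. z \<in> ball 0 R \<Longrightarrow> k z = exp (l z)"
    using contractible_imp_holomorphic_log[OF k convex_imp_contractible[OF convex_ball] nz] by blast
  have "circ_mean (\<lambda>z. ln (cmod (k z))) s = circ_mean (\<lambda>z. Re (l z)) s"
    by (rule circ_mean_cong) (use l s in auto)
  also have "\<dots> = Re (circ_mean l s)"
    by (rule Re_circ_mean[symmetric, OF holomorphic_on_imp_continuous_on[OF l(1)]]) (use s in auto)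
  also have "\<dots> = ln (cmod (k 0))"
    using l s by (simp add: circ_mean_holomorphic[OF l(1) s])
  finally show ?thesis .
qed

text \<open>For \<open>b\<close> inside the circle, \<open>|z - b| = |r - z cnj b / r|\<close> on \<open>|z| = r\<close>, and the right-hand side is
  the modulus of a function without zeros in a neighbourhood of the disc.\<close>

lemma circ_mean_ln_linear:
  assumes r: "0 < r" and b: "cmod b \<noteq> r"
  shows "circ_mean (\<lambda>z. ln (cmod (z - b))) r = ln (max r (cmod b))"
proof (cases "cmod b < r")
  case False
  then have "circ_mean (\<lambda>z. ln (cmod (z - b))) r = ln (cmod (0 - b))"
    using r b by (intro circ_mean_ln_nonvanishing[where R="cmod b"] holomorphic_intros) auto
  then show ?thesis using False b by (simp add: max_def)
next
  case True
  have "circ_mean (\<lambda>z. ln (cmod (z - b))) r = circ_mean (\<lambda>z. ln (cmod ((of_real r - z * cnj b / of_real r)))) r"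
  proof (rule circ_mean_cong)
    fix z assume z: "cmod z = \<bar>r\<bar>"
    have "cmod z * cmod (z - b) = cmod z * cmod (cnj (z - b))" by (simp only: complex_mod_cnj)
    also have "\<dots> = cmod (z * cnj z - z * cnj b)" by (simp only: norm_mult[symmetric]) (simp add: algebra_simps)
    also have "z * cnj z = of_real (r\<^sup>2)" using z r complex_norm_square[of z] by simp
    also have "of_real (r\<^sup>2) - z * cnj b = of_real r * (of_real r - z * cnj b / of_real r)"
      using r by (simp add: field_simps power2_eq_square)
    also have "cmod \<dots> = r * cmod (of_real r - z * cnj b / of_real r)" using r by (simp add: norm_mult)
    finally show "ln (cmod (z - b)) = ln (cmod (of_real r - z * cnj b / of_real r))"
      using z r by simp
  qed
  also have "\<dots> = ln (cmod (of_real r - 0 * cnj b / of_real r))"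
  proof (rule circ_mean_ln_nonvanishing)
    \<comment> \<open>The zero of \<open>r - z cnj b / r\<close> is the mirror image of \<open>b\<close>, of modulus \<open>r^2 / |b| > r\<close>.\<close>
    define R where "R = (if b = 0 then 2 * r else r\<^sup>2 / cmod b)"
    show "(\<lambda>z. of_real r - z * cnj b / of_real r) holomorphic_on ball 0 R"
      using r by (intro holomorphic_intros) auto
    show "r < R" using True r by (auto simp: R_def field_simps power2_eq_square)
    fix z :: complex assume "z \<in> ball 0 R"
    then have z: "cmod z < R" by simp
    have "cmod z * cmod b < r\<^sup>2"
      using z r by (auto simp: R_def field_simps split: if_splits)
    show "of_real r - z * cnj b / of_real r \<noteq> 0"
    proof
      assume "of_real r - z * cnj b / of_real r = 0"
      then have "z * cnj b = of_real (r\<^sup>2)" using r by (simp add: field_simps power2_eq_square)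
      then have "cmod (z * cnj b) = r\<^sup>2" using r by (simp only: norm_of_real) simp
      then show False using \<open>cmod z * cmod b < r\<^sup>2\<close> by (simp add: norm_mult)
    qed
  qed (use r in auto)
  also have "\<dots> = ln (max r (cmod b))" using r True by simp
  finally show ?thesis .
qed

lemma holomorphic_zeros_factorization:
  assumes h: "h holomorphic_on A" and A: "open A" "connected A" and fin: "finite {b\<in>A. h b = 0}"
    and nz: "\<exists>z\<in>A. h z \<noteq> 0"
  obtains k where "k holomorphic_on A" "\<And>z. z \<in> A \<Longrightarrow> k z \<noteq> 0"
    "\<And>z. z \<in> A \<Longrightarrow> h z = k z * (\<Prod>b\<in>{b\<in>A. h b = 0}. (z - b) ^ nat (zorder h b))"
proof -
  let ?Z = "{b\<in>A. h b = 0}"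
  let ?f = "\<lambda>z. \<Prod>b\<in>?Z. (z - b) ^ nat (zorder h b)"
  have pos: "zorder h b > 0" if "b \<in> ?Z" for b
    using zorder_exist_zero[OF h A _ nz, of b] that by auto
  show thesis
  proof (rule holomorphic_zorder_factorization[OF h A, of ?f])
    show "?f holomorphic_on A" by (intro holomorphic_intros)
    show "?f z = 0 \<longleftrightarrow> h z = 0" if "z \<in> A" for z
      using that fin pos by (fastforce simp: prod_zero_iff)
    \<comment> \<open>The product has the same zeros with the same orders, hence the quotient has none.\<close>
    show "zorder ?f z = zorder h z" if z: "z \<in> A" for z
    proof (cases "z \<in> ?Z")
      case True
      show ?thesis
      proof (rule zorder_eqI[of UNIV z "\<lambda>w. \<Prod>b\<in>?Z - {z}. (w - b) ^ nat (zorder h b)"])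
        show "(\<lambda>w. \<Prod>b\<in>?Z - {z}. (w - b) ^ nat (zorder h b)) holomorphic_on UNIV"
          by (intro holomorphic_intros)
        show "(\<Prod>b\<in>?Z - {z}. (z - b) ^ nat (zorder h b)) \<noteq> 0"
          using fin by (simp add: prod_zero_iff)
        show "?f w = (\<Prod>b\<in>?Z - {z}. (w - b) ^ nat (zorder h b)) * (w - z) powi zorder h z" for w
          using pos[OF True] prod.remove[OF fin True, of "\<lambda>b. (w - b) ^ nat (zorder h b)"]
          by (simp add: power_int_def mult.commute)
      qed auto
    next
      case False
      have "h analytic_on {z}" using h A z analytic_at by blast
      then have "zorder h z = 0" using False z by (intro zorder_eq_0I) auto
      moreover have "zorder ?f z = 0"
        using False z fin by (intro zorder_eq_0I analytic_intros) (auto simp: prod_zero_iff)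
      ultimately show ?thesis by simp
    qed
  qed (use that in auto)
qed

text \<open>Jensen's formula between two radii. Every zero \<open>b\<close> contributes its order times the growth of
  \<open>ln (max s |b|)\<close>, so zeros outside the larger circle drop out and the value at the origin cancels.\<close>

theorem jensen_formula:
  assumes h: "h holomorphic_on ball 0 R" and nz: "\<exists>z\<in>ball 0 R. h z \<noteq> 0"
    and r: "0 < r1" "r1 \<le> r" "r < R"
    and nz1: "\<And>z. cmod z = r1 \<Longrightarrow> h z \<noteq> 0" and nzr: "\<And>z. cmod z = r \<Longrightarrow> h z \<noteq> 0"
  shows "circ_mean (\<lambda>z. ln (cmod (h z))) r - circ_mean (\<lambda>z. ln (cmod (h z))) r1 =
    (\<Sum>b\<in>{b\<in>ball 0 r. h b = 0}. real_of_int (zorder h b) * (ln r - ln (max r1 (cmod b))))"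
proof -
  obtain R' where R': "r < R'" "R' < R" using dense r by blast
  let ?Z = "{b\<in>ball 0 R'. h b = 0}"
  have nc: "\<not> h constant_on ball 0 R" if "z \<in> ball 0 R" "h z = 0" for z
    using nz that unfolding constant_on_def by force
  have "finite {b\<in>cball 0 R'. h b = 0}"
  proof (cases "\<exists>z\<in>ball 0 R. h z = 0")
    case True
    then show ?thesis
      using nc R' by (intro holomorphic_compact_finite_zeros[OF h]) auto
  next
    case False
    then have "{b\<in>cball 0 R'. h b = 0} = {}" using R' by auto
    then show ?thesis by (simp only: finite.emptyI)
  qed
  then have fin: "finite ?Z" by (rule finite_subset[rotated]) auto
  have h': "h holomorphic_on ball 0 R'" by (rule holomorphic_on_subset[OF h]) (use R' in auto)
  have nz': "\<exists>z\<in>ball 0 R'. h z \<noteq> 0"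
    using nzr[of "of_real r"] r R' by (intro bexI[of _ "of_real r"]) auto
  obtain k where k: "k holomorphic_on ball 0 R'" "\<And>z. z \<in> ball 0 R' \<Longrightarrow> k z \<noteq> 0"
    "\<And>z. z \<in> ball 0 R' \<Longrightarrow> h z = k z * (\<Prod>b\<in>?Z. (z - b) ^ nat (zorder h b))"
    using holomorphic_zeros_factorization[OF h' open_ball _ fin nz'] by auto
  have pos: "zorder h b > 0" if "b \<in> ?Z" for b
    using zorder_exist_zero[OF h' open_ball _ _ nz', of b] that by auto
  have mean: "circ_mean (\<lambda>z. ln (cmod (h z))) s = ln (cmod (k 0))
      + (\<Sum>b\<in>?Z. real_of_int (zorder h b) * ln (max s (cmod b)))"
    if s: "0 < s" "s < R'" and nzs: "\<And>z. cmod z = s \<Longrightarrow> h z \<noteq> 0" for s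
  proof -
    have ck: "continuous_on (sphere 0 s) (\<lambda>z. ln (cmod (k z)))"
      by (intro continuous_intros holomorphic_on_imp_continuous_on[OF holomorphic_on_subset[OF k(1)]])
         (use k(2) s in auto)
    have cb: "continuous_on (sphere 0 s) (\<lambda>z. ln (cmod (z - b)))" if "b \<in> ?Z" for b
      by (intro continuous_intros) (use nzs that in auto)
    let ?s = "\<lambda>z. \<Sum>b\<in>?Z. real_of_int (zorder h b) * ln (cmod (z - b))"
    have "circ_mean (\<lambda>z. ln (cmod (h z))) s
       = circ_mean (\<lambda>z. ln (cmod (k z)) + ?s z) s"
    proof (rule circ_mean_cong)
      fix z assume z: "cmod z = \<bar>s\<bar>"
      then have zB: "z \<in> ball 0 R'" using s by simp
      have zb': "z - b \<noteq> 0" if "b \<in> ?Z" for b using nzs[of b] that z s by auto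
      have "ln (cmod (h z)) = ln (cmod (k z)) + ln (\<Prod>b\<in>?Z. cmod (z - b) ^ nat (zorder h b))"
        unfolding k(3)[OF zB] norm_mult prod_norm[symmetric] norm_power
        by (rule ln_mult_pos) (use k(2)[OF zB] zb' in \<open>auto intro!: prod_pos\<close>)
      also have "ln (\<Prod>b\<in>?Z. cmod (z - b) ^ nat (zorder h b)) = (\<Sum>b\<in>?Z. ln (cmod (z - b) ^ nat (zorder h b)))"
        by (rule ln_prod) (use fin zb' in auto)
      also have "\<dots> = ?s z"
      proof (rule sum.cong)
        fix b assume b: "b \<in> ?Z"
        have "real (nat (zorder h b)) = real_of_int (zorder h b)" using pos[OF b] by simp
        then show "ln (cmod (z - b) ^ nat (zorder h b)) = real_of_int (zorder h b) * ln (cmod (z - b))"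
          using zb'[OF b] by (simp add: ln_realpow)
      qed simp
      finally show "ln (cmod (h z)) = ln (cmod (k z)) + ?s z" .
    qed
    also have "\<dots> = circ_mean (\<lambda>z. ln (cmod (k z))) s
       + (\<Sum>b\<in>?Z. real_of_int (zorder h b) * circ_mean (\<lambda>z. ln (cmod (z - b))) s)"
    proof (subst circ_mean_add)
      show "continuous_on (sphere 0 s) ?s"
        by (intro continuous_on_sum continuous_on_mult cb continuous_on_const)
      have "circ_mean ?s s
        = (\<Sum>b\<in>?Z. circ_mean (\<lambda>z. real_of_int (zorder h b) * ln (cmod (z - b))) s)"
        by (rule circ_mean_sum) (use s in \<open>auto intro!: continuous_on_mult cb continuous_on_const\<close>)
      then show "circ_mean (\<lambda>z. ln (cmod (k z))) s + circ_mean ?s s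
        = circ_mean (\<lambda>z. ln (cmod (k z))) s + (\<Sum>b\<in>?Z. real_of_int (zorder h b) * circ_mean (\<lambda>z. ln (cmod (z - b))) s)"
        by (simp only: circ_mean_cmult)
    qed (use s ck in auto)
    also have "circ_mean (\<lambda>z. ln (cmod (k z))) s = ln (cmod (k 0))"
      by (rule circ_mean_ln_nonvanishing[OF k(1,2)]) (use s in auto)
    also have "(\<Sum>b\<in>?Z. real_of_int (zorder h b) * circ_mean (\<lambda>z. ln (cmod (z - b))) s)
       = (\<Sum>b\<in>?Z. real_of_int (zorder h b) * ln (max s (cmod b)))"
    proof (rule sum.cong)
      fix b assume "b \<in> ?Z"
      then have "cmod b \<noteq> s" using nzs[of b] by auto
      then show "real_of_int (zorder h b) * circ_mean (\<lambda>z. ln (cmod (z - b))) s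
        = real_of_int (zorder h b) * ln (max s (cmod b))"
        using s by (simp add: circ_mean_ln_linear)
    qed simp
    finally show ?thesis .
  qed
  have "circ_mean (\<lambda>z. ln (cmod (h z))) r - circ_mean (\<lambda>z. ln (cmod (h z))) r1 =
    (\<Sum>b\<in>?Z. real_of_int (zorder h b) * (ln (max r (cmod b)) - ln (max r1 (cmod b))))"
    using mean[OF _ _ nzr] mean[OF _ _ nz1] r R'
    by (simp add: sum_subtractf[symmetric] right_diff_distrib)
  also have "\<dots> = (\<Sum>b\<in>{b\<in>ball 0 r. h b = 0}. real_of_int (zorder h b) * (ln r - ln (max r1 (cmod b))))"
    by (rule sum.mono_neutral_cong_right[OF fin]) (use r R' in \<open>auto simp: max_def\<close>)
  finally show ?thesis .
qed

section \<open>Growth outside a set of finite hyperbolic length\<close>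

text \<open>The measure that has to be finite on the exceptional set.\<close>

definition hyp_measure :: "real measure" where
  "hyp_measure = density lborel (\<lambda>r. ennreal (1 / (1 - r)))"

lemma sets_hyp_measure [simp]: "sets hyp_measure = sets borel"
  by (simp add: hyp_measure_def)

lemma emeasure_hyp_measure:
  "E \<in> sets borel \<Longrightarrow> emeasure hyp_measure E = (\<integral>\<^sup>+r\<in>E. ennreal (1 / (1 - r)) \<partial>lborel)"
  unfolding hyp_measure_def by (subst emeasure_density) auto

text \<open>Borel's lemma: on the set in question \<open>1 / (1 - r) \<le> S' / S^2\<close>, and the right-hand side is the
  derivative of \<open>- 1 / S\<close>, which increases by at most \<open>1\<close>.\<close>

lemma borel_growth:
  fixes S s :: "real \<Rightarrow> real"
  assumes D: "\<And>r. r \<in> {r1<..<1} \<Longrightarrow> (S has_real_derivative s r) (at r)"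
    and c: "continuous_on {r1<..<1} s" and s0: "\<And>r. r \<in> {r1<..<1} \<Longrightarrow> s r \<ge> 0"
    and S1: "\<And>r. r \<in> {r1<..<1} \<Longrightarrow> S r \<ge> 1"
  defines "E \<equiv> {r \<in> {r1<..<1}. (S r)\<^sup>2 < s r * (1 - r)}"
  shows "E \<in> sets borel" and "emeasure hyp_measure E \<le> 1"
proof -
  have cS: "continuous_on {r1<..<1} S"
    using D by (intro continuous_at_imp_continuous_on) (blast dest: DERIV_isCont)
  have "continuous_on {r1<..<1} (\<lambda>r. s r * (1 - r) - (S r)\<^sup>2)"
    using c cS by (intro continuous_intros)
  then have "open ({r1<..<1} \<inter> (\<lambda>r. s r * (1 - r) - (S r)\<^sup>2) -` {0<..})"
    by (intro continuous_open_preimage) auto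
  also have "{r1<..<1} \<inter> (\<lambda>r. s r * (1 - r) - (S r)\<^sup>2) -` {0<..} = E"
    by (auto simp: E_def)
  finally have "open E" .
  then show E: "E \<in> sets borel" by simp
  have bd: "emeasure hyp_measure (E \<inter> {u..v}) \<le> 1" if uv: "r1 < u" "u \<le> v" "v < 1" for u v
  proof -
    define f where "f = (\<lambda>x. if x \<in> {u..v} then s x / (S x)\<^sup>2 else 0)"
    have "(S x)\<^sup>2 \<noteq> 0" if "x \<in> {u..v}" for x
      using S1[of x] uv that by auto
    then have "continuous_on {u..v} (\<lambda>x. s x / (S x)\<^sup>2)"
      using uv by (intro continuous_intros continuous_on_subset[OF c] continuous_on_subset[OF cS]) auto
    then have fm: "f \<in> borel_measurable borel"
      using borel_measurable_continuous_on_indicator[of "{u..v}" "\<lambda>x. s x / (S x)\<^sup>2"]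
      by (auto simp: f_def indicator_def fun_eq_iff elim!: back_subst[of "\<lambda>g. g \<in> _"])
    have "(\<integral>\<^sup>+x. ennreal (f x) * indicator {u..v} x \<partial>lborel) = (- 1 / S v) - (- 1 / S u)"
    proof (rule nn_integral_FTC_Icc[OF fm])
      fix x assume x: "x \<in> {u..v}"
      then have "x \<in> {r1<..<1}" using uv by auto
      then show "((\<lambda>x. - 1 / S x) has_real_derivative f x) (at x)" "0 \<le> f x"
        using x S1[of x] s0[of x] D[of x] unfolding f_def
        by (auto intro!: derivative_eq_intros simp: power2_eq_square)
    qed (use uv in auto)
    also have "\<dots> \<le> ennreal 1"
    proof (rule ennreal_leI)
      have "S u \<ge> 1" "S v \<ge> 1" using S1 uv by auto
      then have "1 / S u \<le> 1" "1 / S v \<ge> 0" by auto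
      then show "- 1 / S v - - 1 / S u \<le> 1" unfolding minus_divide_left[symmetric] by linarith
    qed
    finally have *: "(\<integral>\<^sup>+x. ennreal (f x) * indicator {u..v} x \<partial>lborel) \<le> 1" by simp
    have "emeasure hyp_measure (E \<inter> {u..v}) = (\<integral>\<^sup>+x. ennreal (1 / (1 - x)) * indicator (E \<inter> {u..v}) x \<partial>lborel)"
      using E by (subst emeasure_hyp_measure) auto
    also have "\<dots> \<le> (\<integral>\<^sup>+x. ennreal (f x) * indicator {u..v} x \<partial>lborel)"
    proof (rule nn_integral_mono)
      fix x
      show "ennreal (1 / (1 - x)) * indicator (E \<inter> {u..v}) x \<le> ennreal (f x) * indicator {u..v} x"
      proof (cases "x \<in> E \<inter> {u..v}")
        case True
        then have x: "x \<in> {r1<..<1}" "(S x)\<^sup>2 < s x * (1 - x)" by (auto simp: E_def)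
        have "S x ^ 2 > 0" using S1[OF x(1)] by simp
        with x have "1 / (1 - x) \<le> s x / (S x)\<^sup>2" by (simp add: field_simps)
        with True show ?thesis by (auto simp: f_def intro!: ennreal_leI)
      qed auto
    qed
    finally show ?thesis using * by order
  qed
  show "emeasure hyp_measure E \<le> 1"
  proof (cases "r1 < 1")
    case False
    then have "E = {}" by (auto simp: E_def)
    then show ?thesis by simp
  next
    case True
    define d where "d = (\<lambda>n::nat. (1 - r1) / (real n + 2))"
    have d: "0 < d n" "d n \<le> (1 - r1) / 2" "d (Suc n) \<le> d n" for n
      using True divide_left_mono[of 2 "real n + 2" "1 - r1"]
      by (auto simp: d_def intro!: divide_left_mono)
    define I where "I = (\<lambda>n. E \<inter> {r1 + d n .. 1 - d n})"
    have "incseq I" 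
    proof (rule incseq_SucI)
      show "I n \<subseteq> I (Suc n)" for n using d(3)[of n] by (auto simp: I_def)
    qed
    have "(\<Union>n. I n) = E"
    proof (intro equalityI subsetI)
      fix x assume x: "x \<in> E"
      have m: "min (x - r1) (1 - x) > 0" using x by (auto simp: E_def)
      obtain n where "(1 - r1) / min (x - r1) (1 - x) < real n" using reals_Archimedean2 by blast
      then have "(1 - r1) / min (x - r1) (1 - x) < real n + 2" by linarith
      then have "d n < min (x - r1) (1 - x)" using m unfolding d_def
        by (subst (asm) pos_divide_less_eq, simp, subst pos_divide_less_eq) (auto simp only: mult.commute)
      then have "x \<in> I n" using x by (auto simp: I_def)
      then show "x \<in> (\<Union>n. I n)" by blast
    qed (auto simp: I_def)
    moreover have "emeasure hyp_measure (\<Union>n. I n) = (SUP n. emeasure hyp_measure (I n))"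
      using \<open>incseq I\<close> E by (intro SUP_emeasure_incseq[symmetric]) (auto simp: I_def)
    moreover have "(SUP n. emeasure hyp_measure (I n)) \<le> 1"
    proof (rule SUP_least)
      fix n
      have "r1 < r1 + d n" "1 - d n < 1" "r1 + d n \<le> 1 - d n" using d[of n] by auto
      then show "emeasure hyp_measure (I n) \<le> 1" unfolding I_def by (intro bd)
    qed
    ultimately show ?thesis by simp
  qed
qed

definition area :: "(complex \<Rightarrow> real) \<Rightarrow> real \<Rightarrow> real" where
  "area \<phi> t = integral {0..t} (\<lambda>s. s * circ_mean \<phi> s)"

definition height :: "real \<Rightarrow> (complex \<Rightarrow> real) \<Rightarrow> real \<Rightarrow> real" where
  "height r1 \<phi> r = integral {r1..r} (\<lambda>t. area \<phi> t / t)"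

lemma continuous_on_times_circ_mean:
  fixes \<phi> :: "complex \<Rightarrow> real"
  assumes "continuous_on (ball 0 R) \<phi>" "b < R"
  shows "continuous_on {0..b} (\<lambda>s. s * circ_mean \<phi> s)"
  by (intro continuous_intros continuous_on_subset[OF continuous_on_circ_mean[OF assms(1)]]) (use assms in auto)

lemma DERIV_area:
  assumes c: "continuous_on (ball 0 R) \<phi>" and t: "0 < t" "t < R"
  shows "(area \<phi> has_real_derivative t * circ_mean \<phi> t) (at t)"
proof -
  obtain b where b: "t < b" "b < R" using dense t by blast
  have "((\<lambda>u. integral {0..u} (\<lambda>s. s * circ_mean \<phi> s)) has_real_derivative t * circ_mean \<phi> t) (at t within {0..b})"
    by (rule integral_has_real_derivative[OF continuous_on_times_circ_mean[OF c b(2)]]) (use t b in auto)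
  moreover have "at t within {0..b} = at t" by (rule at_within_Icc_at) (use t b in auto)
  ultimately show ?thesis by (simp add: area_def[abs_def])
qed

lemma continuous_on_area:
  assumes c: "continuous_on (ball 0 R) \<phi>"
  shows "continuous_on {0<..<R} (area \<phi>)"
  by (intro continuous_at_imp_continuous_on ballI DERIV_isCont[OF DERIV_area[OF c]]) auto

lemma continuous_on_area_div:
  assumes c: "continuous_on (ball 0 R) \<phi>" and "0 < a" "b < R"
  shows "continuous_on {a..b} (\<lambda>t. area \<phi> t / t)"
  by (intro continuous_intros continuous_on_subset[OF continuous_on_area[OF c]]) (use assms in auto)

lemma DERIV_height:
  assumes c: "continuous_on (ball 0 R) \<phi>" and t: "0 < r1" "r1 < t" "t < R"
  shows "(height r1 \<phi> has_real_derivative area \<phi> t / t) (at t)"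
proof -
  obtain b where b: "t < b" "b < R" using dense t by blast
  have "((\<lambda>u. integral {r1..u} (\<lambda>s. area \<phi> s / s)) has_real_derivative area \<phi> t / t) (at t within {r1..b})"
    by (rule integral_has_real_derivative[OF continuous_on_area_div[OF c t(1) b(2)]]) (use t b in auto)
  moreover have "at t within {r1..b} = at t" by (rule at_within_Icc_at) (use t b in auto)
  ultimately show ?thesis by (simp add: height_def[abs_def])
qed

lemma continuous_on_sphere_of_ball:
  fixes \<phi> :: "complex \<Rightarrow> real"
  shows "continuous_on (ball 0 R) \<phi> \<Longrightarrow> s < R \<Longrightarrow> continuous_on (sphere 0 s) \<phi>"
  by (erule continuous_on_subset) auto

lemma area_nonneg:
  assumes c: "continuous_on (ball 0 R) \<phi>" and nn: "\<And>z. z \<in> ball 0 R \<Longrightarrow> 0 \<le> \<phi> z" and t: "t < R"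
  shows "0 \<le> area \<phi> t"
  unfolding area_def
proof (rule Henstock_Kurzweil_Integration.integral_nonneg)
  show "(\<lambda>s. s * circ_mean \<phi> s) integrable_on {0..t}"
    by (intro integrable_continuous_interval continuous_on_times_circ_mean[OF c t])
  fix s assume s: "s \<in> {0..t}"
  then have "0 \<le> circ_mean \<phi> s" using t nn
    by (intro circ_mean_nonneg continuous_on_sphere_of_ball[OF c]) auto
  then show "0 \<le> s * circ_mean \<phi> s" using s by simp
qed

lemma height_nonneg:
  assumes c: "continuous_on (ball 0 R) \<phi>" and nn: "\<And>z. z \<in> ball 0 R \<Longrightarrow> 0 \<le> \<phi> z" and t: "0 < r1" "r < R"
  shows "0 \<le> height r1 \<phi> r"
  unfolding height_def
  by (intro Henstock_Kurzweil_Integration.integral_nonneg integrable_continuous_interval continuous_on_area_div[OF c] t)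
     (use t area_nonneg[OF c nn] in auto)

lemma height_cong:
  assumes eq: "\<And>z. z \<in> ball 0 R \<Longrightarrow> \<phi> z = \<psi> z" and r: "0 < r1" "r < R"
  shows "height r1 \<phi> r = height r1 \<psi> r"
proof -
  have "area \<phi> t = area \<psi> t" if "t < R" for t
    unfolding area_def
  proof (rule Henstock_Kurzweil_Integration.integral_cong)
    fix s assume "s \<in> {0..t}"
    then have "circ_mean \<phi> s = circ_mean \<psi> s" using that by (intro circ_mean_cong eq) auto
    then show "s * circ_mean \<phi> s = s * circ_mean \<psi> s" by simp
  qed
  then show ?thesis unfolding height_def using r
    by (intro Henstock_Kurzweil_Integration.integral_cong) auto
qed

lemma height_cmult: "height r1 (\<lambda>z. c * \<phi> z) r = c * height r1 \<phi> r"
proof -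
  have "area (\<lambda>z. c * \<phi> z) t = c * area \<phi> t" for t
    by (simp add: area_def circ_mean_cmult mult.left_commute[of _ c])
  then show ?thesis by (simp add: height_def times_divide_eq_right[symmetric] del: times_divide_eq_right)
qed

lemma height_add:
  assumes c: "continuous_on (ball 0 R) \<phi>" "continuous_on (ball 0 R) \<psi>" and r: "0 < r1" "r < R"
  shows "height r1 (\<lambda>z. \<phi> z + \<psi> z) r = height r1 \<phi> r + height r1 \<psi> r"
proof -
  have a: "area (\<lambda>z. \<phi> z + \<psi> z) t = area \<phi> t + area \<psi> t" if "t < R" for t
  proof -
    have "area (\<lambda>z. \<phi> z + \<psi> z) t = integral {0..t} (\<lambda>s. s * circ_mean \<phi> s + s * circ_mean \<psi> s)"
      unfolding area_def
    proof (rule Henstock_Kurzweil_Integration.integral_cong)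
      fix s assume "s \<in> {0..t}"
      then show "s * circ_mean (\<lambda>z. \<phi> z + \<psi> z) s = s * circ_mean \<phi> s + s * circ_mean \<psi> s"
        using that c by (subst circ_mean_add) (auto intro: continuous_on_sphere_of_ball simp: distrib_left)
    qed
    also have "\<dots> = area \<phi> t + area \<psi> t" unfolding area_def
      by (intro integral_add integrable_continuous_interval continuous_on_times_circ_mean[OF _ that] c)
    finally show ?thesis .
  qed
  have "height r1 (\<lambda>z. \<phi> z + \<psi> z) r = integral {r1..r} (\<lambda>t. area \<phi> t / t + area \<psi> t / t)"
    unfolding height_def
    by (rule Henstock_Kurzweil_Integration.integral_cong) (use r a in \<open>auto simp: add_divide_distrib\<close>)
  also have "\<dots> = height r1 \<phi> r + height r1 \<psi> r" unfolding height_def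
    by (intro integral_add integrable_continuous_interval continuous_on_area_div[OF _ r] c)
  finally show ?thesis .
qed

lemma height_sum:
  assumes "\<And>i. i \<in> I \<Longrightarrow> continuous_on (ball 0 R) (\<phi> i)" and r: "0 < r1" "r < R"
  shows "height r1 (\<lambda>z. \<Sum>i\<in>I. \<phi> i z) r = (\<Sum>i\<in>I. height r1 (\<phi> i) r)"
  using assms(1)
proof (induction I rule: infinite_finite_induct)
  case (insert i I)
  then show ?case by (simp add: height_add[OF _ _ r] continuous_on_sum)
qed (simp_all add: height_def area_def)

text \<open>\<open>height r1 \<phi>\<close> has derivative \<open>area \<phi> r / r\<close>, and \<open>area \<phi>\<close> has derivative \<open>r\<close> times the circle
  mean; Borel's lemma is used once for each, which accounts for the total length \<open>2\<close> and for the
  fourth power.\<close>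

lemma growth_circ_mean:
  assumes c: "continuous_on (ball 0 1) \<phi>" and nn: "\<And>z. z \<in> ball 0 1 \<Longrightarrow> 0 \<le> \<phi> z" and r1: "0 < r1"
  obtains E where "E \<in> sets borel" "emeasure hyp_measure E \<le> 2"
    "\<And>r. r \<in> {r1<..<1} - E \<Longrightarrow> r * circ_mean \<phi> r \<le> 4 * (1 + height r1 \<phi> r) ^ 4 / (1 - r) ^ 3"
proof -
  let ?E1 = "{r \<in> {r1<..<1}. (1 + height r1 \<phi> r)\<^sup>2 < area \<phi> r / r * (1 - r)}"
  let ?E2 = "{r \<in> {r1<..<1}. (1 + area \<phi> r)\<^sup>2 < r * circ_mean \<phi> r * (1 - r)}"
  have cm0: "0 \<le> circ_mean \<phi> r" if "r \<in> {r1<..<1}" for r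
    using that r1 nn by (intro circ_mean_nonneg continuous_on_sphere_of_ball[OF c]) auto
  have E1: "?E1 \<in> sets borel" "emeasure hyp_measure ?E1 \<le> 1"
  proof -
    have 1: "((\<lambda>r. 1 + height r1 \<phi> r) has_real_derivative area \<phi> r / r) (at r)" if "r \<in> {r1<..<1}" for r
      using DERIV_height[OF c r1, of r] that by (auto intro!: derivative_eq_intros)
    have 2: "continuous_on {r1<..<1} (\<lambda>r. area \<phi> r / r)"
      by (intro continuous_intros continuous_on_subset[OF continuous_on_area[OF c]]) (use r1 in auto)
    have 3: "0 \<le> area \<phi> r / r" "1 \<le> 1 + height r1 \<phi> r" if "r \<in> {r1<..<1}" for r
      using that r1 area_nonneg[OF c nn, of r] height_nonneg[OF c nn r1, of r] by auto
    show "?E1 \<in> sets borel" by (rule borel_growth(1)[OF 1 2 3])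
    show "emeasure hyp_measure ?E1 \<le> 1" by (rule borel_growth(2)[OF 1 2 3])
  qed
  have E2: "?E2 \<in> sets borel" "emeasure hyp_measure ?E2 \<le> 1"
  proof -
    have 1: "((\<lambda>r. 1 + area \<phi> r) has_real_derivative r * circ_mean \<phi> r) (at r)" if "r \<in> {r1<..<1}" for r
      using DERIV_area[OF c, of r] that r1 by (auto intro!: derivative_eq_intros)
    have 2: "continuous_on {r1<..<1} (\<lambda>r. r * circ_mean \<phi> r)"
      by (intro continuous_intros continuous_on_subset[OF continuous_on_circ_mean[OF c]]) (use r1 in auto)
    have 3: "0 \<le> r * circ_mean \<phi> r" "1 \<le> 1 + area \<phi> r" if "r \<in> {r1<..<1}" for r
      using that r1 area_nonneg[OF c nn, of r] cm0[of r] by auto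
    show "?E2 \<in> sets borel" by (rule borel_growth(1)[OF 1 2 3])
    show "emeasure hyp_measure ?E2 \<le> 1" by (rule borel_growth(2)[OF 1 2 3])
  qed
  have E: "?E1 \<union> ?E2 \<in> sets borel" using E1(1) E2(1) by (rule sets.Un)
  have "emeasure hyp_measure (?E1 \<union> ?E2) \<le> emeasure hyp_measure ?E1 + emeasure hyp_measure ?E2"
    by (rule emeasure_subadditive) (simp_all only: sets_hyp_measure E1(1) E2(1))
  also have "\<dots> \<le> 1 + 1" by (rule add_mono[OF E1(2) E2(2)])
  finally have "emeasure hyp_measure (?E1 \<union> ?E2) \<le> 2" by (simp only: one_add_one)
  moreover have "r * circ_mean \<phi> r \<le> 4 * (1 + height r1 \<phi> r) ^ 4 / (1 - r) ^ 3"
    if r: "r \<in> {r1<..<1} - (?E1 \<union> ?E2)" for r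
  proof -
    let ?S = "1 + height r1 \<phi> r" and ?A = "area \<phi> r"
    have r': "0 < r" "0 < 1 - r" "1 - r \<le> 1" using r r1 by auto
    have S1: "1 \<le> ?S" using height_nonneg[OF c nn r1, of r] r by auto
    have A0: "0 \<le> ?A" using area_nonneg[OF c nn, of r] r by auto
    have "?A / r * (1 - r) \<le> ?S\<^sup>2" using r by auto
    moreover have "?A \<le> ?A / r"
      using mult_left_le[of r ?A] A0 r r' by (simp add: pos_le_divide_eq)
    ultimately have "?A * (1 - r) \<le> ?S\<^sup>2" using r' by (meson mult_right_mono less_imp_le order.trans)
    then have "(1 + ?A) * (1 - r) \<le> 2 * ?S\<^sup>2"
      using one_le_power[OF S1, of 2] r' by (simp only: distrib_right mult_1_left)
    then have A: "1 + ?A \<le> 2 * ?S\<^sup>2 / (1 - r)" using r' by (simp add: field_simps)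
    have "r * circ_mean \<phi> r * (1 - r) \<le> (1 + ?A)\<^sup>2" using r by auto
    also have "\<dots> \<le> (2 * ?S\<^sup>2 / (1 - r))\<^sup>2" using A A0 by (intro power_mono) auto
    also have "\<dots> = 4 * ?S ^ 4 / (1 - r)\<^sup>2" by (simp add: power_divide power_mult_distrib flip: power_mult)
    finally have "r * circ_mean \<phi> r \<le> 4 * ?S ^ 4 / (1 - r)\<^sup>2 / (1 - r)" using r' by (simp add: pos_le_divide_eq mult_ac)
    then show ?thesis by (simp add: power3_eq_cube power2_eq_square mult_ac)
  qed
  ultimately show thesis by (rule that[OF E])
qed

text \<open>The exceptional sets of the individual \<open>\<phi> n\<close> have lengths bounded by \<open>2\<close>, but their union need
  not have finite length. Since the means increase with \<open>n\<close> and the bound does not depend on \<open>n\<close>, it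
  suffices that \<open>r\<close> avoids infinitely many of these sets, so their limit inferior is exceptional
  enough, and its length is still at most \<open>2\<close>.\<close>

lemma growth_circ_mean_incseq:
  fixes \<phi> :: "nat \<Rightarrow> complex \<Rightarrow> real"
  assumes c: "\<And>n. continuous_on (ball 0 1) (\<phi> n)" and nn: "\<And>n z. z \<in> ball 0 1 \<Longrightarrow> 0 \<le> \<phi> n z"
    and mono: "\<And>m n z. z \<in> ball 0 1 \<Longrightarrow> m \<le> n \<Longrightarrow> \<phi> m z \<le> \<phi> n z" and r1: "0 < r1"
    and B: "\<And>n r. r \<in> {r1<..<1} \<Longrightarrow> height r1 (\<phi> n) r \<le> B r"
  obtains E where "E \<in> sets borel" "emeasure hyp_measure E \<le> 2"
    "\<And>r n. r \<in> {r1<..<1} - E \<Longrightarrow> r * circ_mean (\<phi> n) r \<le> 4 * (1 + B r) ^ 4 / (1 - r) ^ 3"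
proof -
  have "\<exists>E. E \<in> sets borel \<and> emeasure hyp_measure E \<le> 2 \<and>
    (\<forall>r. r \<in> {r1<..<1} - E \<longrightarrow> r * circ_mean (\<phi> n) r \<le> 4 * (1 + height r1 (\<phi> n) r) ^ 4 / (1 - r) ^ 3)" for n
    using growth_circ_mean[OF c nn r1] by metis
  then obtain E where E: "\<And>n. E n \<in> sets borel" "\<And>n. emeasure hyp_measure (E n) \<le> 2"
    "\<And>n r. r \<in> {r1<..<1} - E n \<Longrightarrow> r * circ_mean (\<phi> n) r \<le> 4 * (1 + height r1 (\<phi> n) r) ^ 4 / (1 - r) ^ 3"
    by metis
  \<comment> \<open>The union of the \<open>?F n\<close> is the limit inferior of the sets \<open>E n\<close>.\<close>
  let ?F = "\<lambda>n. \<Inter>m\<in>{n..}. E m"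
  have F: "?F n \<in> sets borel" for n using E(1) by (intro sets.countable_INT') auto
  have "emeasure hyp_measure (\<Union>n. ?F n) = (SUP n. emeasure hyp_measure (?F n))"
    by (rule SUP_emeasure_incseq[symmetric]) (use F in \<open>auto simp: incseq_def\<close>)
  also have "\<dots> \<le> 2"
  proof (rule SUP_least)
    fix n
    have "emeasure hyp_measure (?F n) \<le> emeasure hyp_measure (E n)"
      using E(1) by (intro emeasure_mono) auto
    then show "emeasure hyp_measure (?F n) \<le> 2" using E(2) order.trans by blast
  qed
  finally have le: "emeasure hyp_measure (\<Union>n. ?F n) \<le> 2" .
  have "(\<Union>n. ?F n) \<in> sets borel" using F by blast
  moreover note le
  moreover have "r * circ_mean (\<phi> n) r \<le> 4 * (1 + B r) ^ 4 / (1 - r) ^ 3" if r: "r \<in> {r1<..<1} - (\<Union>n. ?F n)" for r n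
  proof -
    have r': "r \<in> {r1<..<1}" using r by blast
    obtain m where m: "m \<ge> n" "r \<notin> E m" using r by auto
    have "circ_mean (\<phi> n) r \<le> circ_mean (\<phi> m) r"
      using r r1 m mono by (intro circ_mean_mono continuous_on_sphere_of_ball[OF c]) auto
    then have "r * circ_mean (\<phi> n) r \<le> r * circ_mean (\<phi> m) r" using r r1 by auto
    also have "\<dots> \<le> 4 * (1 + height r1 (\<phi> m) r) ^ 4 / (1 - r) ^ 3" using E(3) r m by blast
    also have "\<dots> \<le> 4 * (1 + B r) ^ 4 / (1 - r) ^ 3"
      using B[OF r'] height_nonneg[OF c nn r1, of r m] r
      by (intro divide_right_mono mult_left_mono power_mono) auto
    finally show ?thesis .
  qed
  ultimately show thesis by (rule that)
qed

section \<open>Chordal distance on the sphere\<close>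

text \<open>With \<open>e = 2^-k\<close> and \<open>x = |L|^2 / N\<close> this is the factor by which the density changes when the pair
  \<open>(u, v)\<close> is replaced by one with \<open>|h1|^2 + |h2|^2 = |L|^2 + e N\<close>.\<close>

definition peak :: "nat \<Rightarrow> real \<Rightarrow> real" where
  "peak k x = (1/2)^k * (1 + (1/2)^k) / (x + (1/2)^k)\<^sup>2"

lemma peak_nonneg: "0 \<le> peak k x"
  by (simp add: peak_def)

text \<open>One term suffices, the first \<open>k\<close> with \<open>2^-k \<le> x\<close>; its weight \<open>1 / (k + 1)^2\<close> costs the square of
  the logarithm.\<close>

lemma inverse_le_sum_peaks:
  assumes x: "0 < x" "x \<le> 1" and n: "(1/2)^n \<le> x"
  shows "1 / x \<le> 8 * (2 - log 2 x)\<^sup>2 * (\<Sum>k\<le>n. peak k x / (real k + 1)\<^sup>2)"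
proof -
  define k where "k = (LEAST k. (1/2)^k \<le> x)"
  define e where "e = (1/2::real)^k"
  have e: "e \<le> x" unfolding e_def k_def by (rule LeastI[of _ n]) (rule n)
  have kn: "k \<le> n" unfolding k_def by (rule Least_le) (rule n)
  have e0: "0 < e" by (simp add: e_def)
  have x2: "x < 2 * e"
  proof (cases k)
    case 0
    then show ?thesis using x by (simp add: e_def)
  next
    case (Suc j)
    then have "\<not> (1/2)^j \<le> x" using not_less_Least[of j "\<lambda>k. (1/2)^k \<le> x"] by (simp add: k_def)
    then show ?thesis using Suc by (simp add: e_def)
  qed
  have "log 2 x < log 2 (2 * e)" using x x2 e0 by (subst log_less_cancel_iff) auto
  also have "log 2 (2 * e) = 1 - real k"
    by (simp add: e_def log_mult log_nat_power log_divide)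
  finally have k: "real k + 1 \<le> 2 - log 2 x" by simp
  have "1 / x \<le> 8 * peak k x"
  proof -
    have "(x + e)\<^sup>2 \<le> (2 * x)\<^sup>2" using e x e0 by (intro power_mono) auto
    also have "(2 * x)\<^sup>2 \<le> 8 * x * (e * (1 + e))"
    proof -
      have "x \<le> 2 * (e * (1 + e))" using x2 mult_pos_pos[OF e0 e0] by (simp add: distrib_left)
      then have "4 * x * x \<le> 4 * x * (2 * (e * (1 + e)))" using x by (intro mult_left_mono) auto
      then show ?thesis by (simp add: power2_eq_square)
    qed
    finally have "(x + e)\<^sup>2 \<le> 8 * x * (e * (1 + e))" .
    moreover have "0 < (x + e)\<^sup>2" using x e0 by simp
    ultimately have "1 / x \<le> 8 * (e * (1 + e) / (x + e)\<^sup>2)"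
      using x by (simp add: divide_le_eq le_divide_eq mult_ac)
    then show ?thesis by (simp only: peak_def e_def)
  qed
  also have "8 * peak k x = 8 * (real k + 1)\<^sup>2 * (peak k x / (real k + 1)\<^sup>2)" by simp
  also have "\<dots> \<le> 8 * (2 - log 2 x)\<^sup>2 * (peak k x / (real k + 1)\<^sup>2)"
    by (intro mult_right_mono mult_left_mono power_mono k divide_nonneg_nonneg peak_nonneg) auto
  also have "\<dots> \<le> 8 * (2 - log 2 x)\<^sup>2 * (\<Sum>k\<le>n. peak k x / (real k + 1)\<^sup>2)"
    by (intro mult_left_mono member_le_sum) (use kn peak_nonneg in auto)
  finally show ?thesis .
qed

lemma sum_inverse_squares_le_2: "(\<Sum>k\<le>n. 1 / (real k + 1)\<^sup>2) \<le> 2"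
proof -
  have "(\<Sum>k\<le>n. 1 / (real k + 1)\<^sup>2) \<le> 2 - 1 / (real n + 1)"
  proof (induction n)
    case (Suc n)
    have "1 / (real (Suc n) + 1)\<^sup>2 \<le> 1 / (real n + 1) - 1 / (real (Suc n) + 1)"
    proof -
      have "1 / (real (Suc n) + 1)\<^sup>2 \<le> 1 / ((real n + 1) * (real (Suc n) + 1))"
        by (rule divide_left_mono) (auto simp: power2_eq_square intro!: mult_right_mono)
      also have "\<dots> = 1 / (real n + 1) - 1 / (real (Suc n) + 1)"
        by (simp add: field_simps)
      finally show ?thesis .
    qed
    then show ?case using Suc by simp
  qed simp
  also have "\<dots> \<le> 2" by simp
  finally show ?thesis .
qed

text \<open>\<open>(cov0 a, cov1 a)\<close> is a covector of norm one that annihilates the line of \<open>\<complex>^2\<close> representing \<open>a\<close>,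
  where \<open>(u, v)\<close> represents \<open>v / u\<close>.\<close>

definition cov0 :: "riemann_sphere \<Rightarrow> complex" where
  "cov0 a = (case a of None \<Rightarrow> 1 | Some w \<Rightarrow> - w / of_real (sqrt (1 + (cmod w)\<^sup>2)))"

definition cov1 :: "riemann_sphere \<Rightarrow> complex" where
  "cov1 a = (case a of None \<Rightarrow> 0 | Some w \<Rightarrow> 1 / of_real (sqrt (1 + (cmod w)\<^sup>2)))"

lemma cov_unit: "(cmod (cov0 a))\<^sup>2 + (cmod (cov1 a))\<^sup>2 = 1"
proof (cases a)
  case (Some w)
  have "0 < 1 + (cmod w)\<^sup>2" by (simp add: add_pos_nonneg)
  then show ?thesis using Some
    by (simp add: cov0_def cov1_def norm_divide power_divide flip: add_divide_distrib)
qed (simp add: cov0_def cov1_def)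

lemma sqrt_Suc_norm: "complex_of_real (sqrt (1 + (cmod w)\<^sup>2)) \<noteq> 0"
  using add_pos_nonneg[of 1 "(cmod w)\<^sup>2"] by (simp del: of_real_add)

lemma cov_zero_iff:
  assumes "u \<noteq> 0 \<or> v \<noteq> 0"
  shows "cov0 a * u + cov1 a * v = 0 \<longleftrightarrow> a = (if u = 0 then None else Some (v / u))"
  using assms sqrt_Suc_norm
  by (cases a) (auto simp: cov0_def cov1_def field_simps)

lemma cov_det_nonzero:
  assumes "a \<noteq> b"
  shows "cov0 a * cov1 b - cov0 b * cov1 a \<noteq> 0"
proof
  assume *: "cov0 a * cov1 b - cov0 b * cov1 a = 0"
  have nz: "cov1 b \<noteq> 0 \<or> - cov0 b \<noteq> 0" using cov_unit[of b] by auto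
  have "cov0 a * cov1 b + cov1 a * (- cov0 b) = 0" "cov0 b * cov1 b + cov1 b * (- cov0 b) = 0"
    using * by (simp_all add: algebra_simps)
  then show False using assms cov_zero_iff[OF nz] by metis
qed

text \<open>The squared chordal distance, normalised to have maximum \<open>1\<close>, from \<open>a\<close> to the point with
  homogeneous coordinates \<open>(u, v)\<close>.\<close>

definition chord_sq :: "riemann_sphere \<Rightarrow> complex \<Rightarrow> complex \<Rightarrow> real" where
  "chord_sq a u v = (cmod (cov0 a * u + cov1 a * v))\<^sup>2 / ((cmod u)\<^sup>2 + (cmod v)\<^sup>2)"

lemma cov_orthogonal:
  "(cmod (cov0 a * u + cov1 a * v))\<^sup>2 + (cmod (- cnj (cov1 a) * u + cnj (cov0 a) * v))\<^sup>2
    = (cmod u)\<^sup>2 + (cmod v)\<^sup>2"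
proof -
  have c: "cov0 a * cnj (cov0 a) + cov1 a * cnj (cov1 a) = 1"
    using cov_unit[of a] unfolding complex_norm_square[symmetric] of_real_add[symmetric] by simp
  have "complex_of_real ((cmod (cov0 a * u + cov1 a * v))\<^sup>2 + (cmod (- cnj (cov1 a) * u + cnj (cov0 a) * v))\<^sup>2)
     = (cov0 a * cnj (cov0 a) + cov1 a * cnj (cov1 a)) * (u * cnj u + v * cnj v)"
    unfolding of_real_add complex_norm_square by (simp add: algebra_simps)
  also have "\<dots> = of_real ((cmod u)\<^sup>2 + (cmod v)\<^sup>2)"
    unfolding c of_real_add complex_norm_square by simp
  finally show ?thesis by (simp only: of_real_eq_iff)
qed

lemma chord_sq_nonneg: "0 \<le> chord_sq a u v"
  by (simp add: chord_sq_def)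

lemma chord_sq_le_1: "chord_sq a u v \<le> 1"
proof (cases "(cmod u)\<^sup>2 + (cmod v)\<^sup>2 = 0")
  case False
  then have "0 < (cmod u)\<^sup>2 + (cmod v)\<^sup>2" by (simp add: order_less_le)
  then show ?thesis using cov_orthogonal[of a u v] zero_le_power2[of "cmod (- cnj (cov1 a) * u + cnj (cov0 a) * v)"]
    unfolding chord_sq_def by (simp only: pos_divide_le_eq mult_1_left)
qed (simp only: chord_sq_def; simp)

lemma chord_sq_scale:
  assumes "c \<noteq> 0"
  shows "chord_sq a (c * u) (c * v) = chord_sq a u v"
proof -
  have "cov0 a * (c * u) + cov1 a * (c * v) = c * (cov0 a * u + cov1 a * v)" by (simp add: algebra_simps)
  moreover have "(cmod (c * u))\<^sup>2 + (cmod (c * v))\<^sup>2 = (cmod c)\<^sup>2 * ((cmod u)\<^sup>2 + (cmod v)\<^sup>2)"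
    by (simp add: norm_mult power_mult_distrib algebra_simps)
  ultimately show ?thesis using assms by (simp add: chord_sq_def norm_mult power_mult_distrib)
qed

lemma norm_two_term_bound:
  fixes p q x y :: complex
  shows "(cmod (p * x - q * y))\<^sup>2 \<le> ((cmod p)\<^sup>2 + (cmod q)\<^sup>2) * ((cmod x)\<^sup>2 + (cmod y)\<^sup>2)"
proof -
  have "cmod (p * x - q * y) \<le> cmod p * cmod x + cmod q * cmod y"
    using norm_triangle_ineq4[of "p * x" "q * y"] by (simp add: norm_mult)
  then have "(cmod (p * x - q * y))\<^sup>2 \<le> (cmod p * cmod x + cmod q * cmod y)\<^sup>2"
    by (intro power_mono) auto
  also have "\<dots> \<le> ((cmod p)\<^sup>2 + (cmod q)\<^sup>2) * ((cmod x)\<^sup>2 + (cmod y)\<^sup>2)"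
    using zero_le_power2[of "cmod p * cmod y - cmod q * cmod x"]
    by (simp add: power2_eq_square algebra_simps)
  finally show ?thesis .
qed

text \<open>Cramer's rule recovers \<open>(u, v)\<close> from the two linear forms, so both cannot be small at once.\<close>

lemma chord_sq_sum_lower_bound:
  assumes nz: "u \<noteq> 0 \<or> v \<noteq> 0"
  shows "(cmod (cov0 a * cov1 b - cov0 b * cov1 a))\<^sup>2 / 2 \<le> chord_sq a u v + chord_sq b u v"
proof -
  let ?d = "cov0 a * cov1 b - cov0 b * cov1 a"
  let ?La = "cov0 a * u + cov1 a * v" and ?Lb = "cov0 b * u + cov1 b * v"
  have N: "0 < (cmod u)\<^sup>2 + (cmod v)\<^sup>2" using nz by (auto intro: add_pos_nonneg add_nonneg_pos)
  have u: "?d * u = cov1 b * ?La - cov1 a * ?Lb" and v: "?d * v = cov0 a * ?Lb - cov0 b * ?La"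
    by (simp_all add: algebra_simps)
  have "(cmod ?d)\<^sup>2 * ((cmod u)\<^sup>2 + (cmod v)\<^sup>2) = (cmod (?d * u))\<^sup>2 + (cmod (?d * v))\<^sup>2"
    by (simp add: norm_mult power_mult_distrib distrib_left)
  also have "\<dots> \<le> ((cmod (cov1 b))\<^sup>2 + (cmod (cov1 a))\<^sup>2) * ((cmod ?La)\<^sup>2 + (cmod ?Lb)\<^sup>2)
      + ((cmod (cov0 a))\<^sup>2 + (cmod (cov0 b))\<^sup>2) * ((cmod ?Lb)\<^sup>2 + (cmod ?La)\<^sup>2)"
    unfolding u v by (intro add_mono norm_two_term_bound)
  also have "\<dots> = 2 * ((cmod ?La)\<^sup>2 + (cmod ?Lb)\<^sup>2)"
  proof -
    have "((cmod (cov1 b))\<^sup>2 + (cmod (cov1 a))\<^sup>2) + ((cmod (cov0 a))\<^sup>2 + (cmod (cov0 b))\<^sup>2) = 2"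
      using cov_unit[of a] cov_unit[of b] by simp
    moreover have "P * (X + Y) + Q * (Y + X) = 2 * (X + Y)" if "P + Q = 2" for P Q X Y :: real
    proof -
      have "P * (X + Y) + Q * (Y + X) = (P + Q) * (X + Y)" by (simp add: algebra_simps)
      then show ?thesis using that by simp
    qed
    ultimately show ?thesis by blast
  qed
  finally show ?thesis unfolding chord_sq_def add_divide_distrib[symmetric] pos_le_divide_eq[OF N]
    by simp
qed

text \<open>Only the factor of the nearest target can be large: for every other target the distance is at
  least half the minimal separation \<open>k\<close>.\<close>

lemma prod_inverse_chord_le:
  assumes fin: "finite A" and ne: "A \<noteq> {}"
  obtains C where "C > 0" "\<And>u v. (\<And>a. a \<in> A \<Longrightarrow> 0 < chord_sq a u v) \<Longrightarrow>
     (\<Prod>a\<in>A. 1 / chord_sq a u v) \<le> C * (\<Sum>a\<in>A. 1 / chord_sq a u v)"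
proof -
  let ?D = "insert 1 ((\<lambda>(a, b). (cmod (cov0 a * cov1 b - cov0 b * cov1 a))\<^sup>2 / 2) ` {(a, b) \<in> A \<times> A. a \<noteq> b})"
  \<comment> \<open>The number \<open>1\<close> in \<open>?D\<close> keeps the set nonempty when there is a single target.\<close>
  define k where "k = Min ?D"
  have finD: "finite ?D" using fin by (auto intro: finite_subset[of _ "A \<times> A"])
  have "k \<in> ?D" unfolding k_def by (rule Min_in[OF finD]) auto
  then have k: "0 < k" using cov_det_nonzero by auto
  have kab: "k \<le> (cmod (cov0 a * cov1 b - cov0 b * cov1 a))\<^sup>2 / 2" if "a \<in> A" "b \<in> A" "a \<noteq> b" for a b
    unfolding k_def using finD by (rule Min_le) (use that in force)
  have main: "(\<Prod>a\<in>A. 1 / chord_sq a u v) \<le> (2 / k) ^ (card A - 1) * (\<Sum>a\<in>A. 1 / chord_sq a u v)"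
    if pos: "\<And>a. a \<in> A \<Longrightarrow> 0 < chord_sq a u v" for u v
  proof -
    have nz: "u \<noteq> 0 \<or> v \<noteq> 0" using ne pos by (force simp: chord_sq_def)
    obtain a where a: "a \<in> A" "\<And>b. b \<in> A \<Longrightarrow> chord_sq a u v \<le> chord_sq b u v"
      using arg_min_if_finite[OF fin ne, of "\<lambda>a. chord_sq a u v"] not_le by blast
    have b: "1 / chord_sq b u v \<le> 2 / k" if "b \<in> A - {a}" for b
    proof -
      have "k \<le> chord_sq a u v + chord_sq b u v"
        using kab[of a b] that a chord_sq_sum_lower_bound[OF nz, of a b] by force
      also have "\<dots> \<le> 2 * chord_sq b u v" using a(2)[of b] that by simp
      finally show ?thesis using k pos[of b] that by (simp add: field_simps)
    qed
    have "(\<Prod>a\<in>A. 1 / chord_sq a u v) = 1 / chord_sq a u v * (\<Prod>b\<in>A - {a}. 1 / chord_sq b u v)"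
      by (rule prod.remove[OF fin a(1)])
    also have "\<dots> \<le> 1 / chord_sq a u v * (\<Prod>b\<in>A - {a}. 2 / k)"
      using pos b by (intro mult_left_mono prod_mono) (auto simp: chord_sq_nonneg)
    also have "\<dots> = (2 / k) ^ (card A - 1) * (1 / chord_sq a u v)"
      using fin a by (simp add: card_Diff_singleton)
    also have "\<dots> \<le> (2 / k) ^ (card A - 1) * (\<Sum>a\<in>A. 1 / chord_sq a u v)"
      using k a fin by (intro mult_left_mono member_le_sum) (auto simp: chord_sq_nonneg)
    finally show ?thesis .
  qed
  show thesis
    by (rule that[of "(2 / k) ^ (card A - 1)", OF _ main]) (use k in auto)
qed

section \<open>The second main inequality for a holomorphic pair\<close>

lemma height_fs_density:
  assumes "u holomorphic_on ball 0 R" "v holomorphic_on ball 0 R"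
    and "\<And>z. z \<in> ball 0 R \<Longrightarrow> u z \<noteq> 0 \<or> v z \<noteq> 0" and r: "0 < r1" "r1 \<le> r" "r < R"
  shows "circ_mean (\<lambda>z. ln (sq_norm u v z)) r - circ_mean (\<lambda>z. ln (sq_norm u v z)) r1
    = 4 * height r1 (fs_density u v) r"
proof -
  have "integral {0..t} (\<lambda>s. 4 * s * circ_mean (fs_density u v) s) = 4 * area (fs_density u v) t" for t
    by (simp add: area_def mult.assoc)
  then have "integral {r1..r} (\<lambda>t. integral {0..t} (\<lambda>s. 4 * s * circ_mean (fs_density u v) s) / t)
    = 4 * height r1 (fs_density u v) r"
    by (simp add: height_def times_divide_eq_right[symmetric] del: times_divide_eq_right)
  then show ?thesis using circ_mean_fs_potential[OF assms] by (simp add: fs_potential_sq_norm)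
qed

text \<open>This inequality is what truncates the counting functions: a zero of order \<open>m\<close> of \<open>g\<close> is counted
  with \<open>m\<close> on the one side and with at least \<open>m - 1\<close>, through the Wronskian, on the other.\<close>

lemma zorder_wronskian_ge:
  assumes S: "open S" "connected S" "b \<in> S" and g: "g holomorphic_on S" and h: "h holomorphic_on S"
    and ng: "\<exists>z\<in>S. g z \<noteq> 0" and nW: "\<exists>z\<in>S. wronskian g h z \<noteq> 0" and gb: "g b = 0"
  shows "zorder g b - 1 \<le> zorder (wronskian g h) b"
proof -
  define m where "m = nat (zorder g b)"
  obtain \<rho> where pos: "0 < zorder g b" and \<rho>: "0 < \<rho>" "cball b \<rho> \<subseteq> S"
    and p: "zor_poly g b holomorphic_on cball b \<rho>"
    and gp: "\<And>w. w \<in> cball b \<rho> \<Longrightarrow> g w = zor_poly g b w * (w - b) ^ m"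
    using zorder_exist_zero[OF g S ng] gb unfolding m_def by auto
  obtain k where k: "m = Suc k" using pos by (cases m) (auto simp: m_def)
  let ?p = "zor_poly g b"
  have p': "?p holomorphic_on ball b \<rho>" by (rule holomorphic_on_subset[OF p]) auto
  have h': "h holomorphic_on ball b \<rho>" by (rule holomorphic_on_subset[OF h]) (use \<rho> in auto)
  define G where "G = (\<lambda>w. ?p w * (w - b) * deriv h w - (deriv ?p w * (w - b) + of_nat m * ?p w) * h w)"
  have G: "G holomorphic_on ball b \<rho>" unfolding G_def
    by (intro holomorphic_intros p' h' open_ball)
  have W: "wronskian g h w = (w - b) ^ k * G w" if w: "w \<in> ball b \<rho>" for w
  proof -
    have "(?p has_field_derivative deriv ?p w) (at w)" by (rule holomorphic_derivI[OF p' open_ball w])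
    moreover have "((\<lambda>w. (w - b) ^ m) has_field_derivative of_nat m * (w - b) ^ k) (at w)"
    proof -
      have "((\<lambda>w. w - b) has_field_derivative 1) (at w)" by (auto intro!: derivative_eq_intros)
      from DERIV_power[OF this, of m] show ?thesis by (simp add: k)
    qed
    ultimately have "((\<lambda>w. ?p w * (w - b) ^ m) has_field_derivative
        deriv ?p w * (w - b) ^ m + of_nat m * (w - b) ^ k * ?p w) (at w)"
      by (rule DERIV_mult)
    then have "(g has_field_derivative deriv ?p w * (w - b) ^ m + of_nat m * (w - b) ^ k * ?p w) (at w)"
      by (rule has_field_derivative_transform_within_open[OF _ open_ball w]) (use gp in auto)
    then have "deriv g w = deriv ?p w * (w - b) ^ m + of_nat m * (w - b) ^ k * ?p w"
      by (rule DERIV_imp_deriv)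
    moreover have "g w = ?p w * (w - b) ^ m" using gp w by auto
    ultimately show ?thesis unfolding wronskian_def G_def k
      by (simp only:) (simp add: algebra_simps)
  qed
  have hW: "wronskian g h holomorphic_on S"
    unfolding wronskian_def[abs_def] by (intro holomorphic_intros g h S)
  obtain z where z: "z \<in> S" "wronskian g h z \<noteq> 0" using nW by blast
  have ev0: "\<forall>\<^sub>F w in at b. wronskian g h w \<noteq> 0"
    using non_zero_neighbour_alt[OF hW S z] by (auto elim: eventually_mono)
  have evB: "\<forall>\<^sub>F w in at b. w \<in> ball b \<rho>" using \<rho> by (intro eventually_at_in_open') auto
  have evW: "\<forall>\<^sub>F w in at b. wronskian g h w = (w - b) ^ k * G w"
    using evB by eventually_elim (rule W)
  have ev1: "\<forall>\<^sub>F w in at b. (w - b) ^ k * G w \<noteq> 0"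
    using ev0 evW by eventually_elim simp
  have an: "G analytic_on {b}" unfolding analytic_at
    using G \<rho> by (intro exI[of _ "ball b \<rho>"]) auto
  have "zorder (wronskian g h) b = zorder (\<lambda>w. (w - b) ^ k * G w) b"
    by (rule zorder_cong[OF evW refl])
  also have "\<dots> = zorder (\<lambda>w. (w - b) ^ k) b + zorder G b"
    by (rule zorder_times_analytic[OF _ an ev1]) (auto intro!: analytic_intros)
  also have "zorder (\<lambda>w. (w - b) ^ k) b = int k"
    by (rule zorder_eqI[of UNIV _ "\<lambda>_. 1"]) auto
  finally have "zorder (wronskian g h) b = int k + zorder G b" .
  moreover have "zorder G b \<ge> 0"
    by (rule zorder_ge_0[OF an]) (use ev1 in \<open>auto intro!: eventually_frequently elim: eventually_mono\<close>)
  ultimately show ?thesis using k pos by (simp add: m_def)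
qed

text \<open>A lift of a nonconstant map to the sphere to homogeneous coordinates.\<close>

locale proj_lift =
  fixes u v :: "complex \<Rightarrow> complex" and R :: real
  assumes hol_u: "u holomorphic_on ball 0 R" and hol_v: "v holomorphic_on ball 0 R"
    and nonzero: "\<And>z. z \<in> ball 0 R \<Longrightarrow> u z \<noteq> 0 \<or> v z \<noteq> 0"
    and wronskian_nontrivial: "\<exists>z\<in>ball 0 R. wronskian u v z \<noteq> 0"
begin

definition L :: "riemann_sphere \<Rightarrow> complex \<Rightarrow> complex" where
  "L a z = cov0 a * u z + cov1 a * v z"

definition L_perp :: "riemann_sphere \<Rightarrow> complex \<Rightarrow> complex" where
  "L_perp a z = - cnj (cov1 a) * u z + cnj (cov0 a) * v z"

definition dist_sq :: "riemann_sphere \<Rightarrow> complex \<Rightarrow> real" where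
  "dist_sq a z = chord_sq a (u z) (v z)"

lemma hol_L: "L a holomorphic_on ball 0 R" and hol_L_perp: "L_perp a holomorphic_on ball 0 R"
  unfolding L_def[abs_def] L_perp_def[abs_def] by (intro holomorphic_intros hol_u hol_v)+

lemma hol_wronskian: "wronskian u v holomorphic_on ball 0 R"
  unfolding wronskian_def[abs_def] by (intro holomorphic_intros hol_u hol_v open_ball)

lemmas cont_u = holomorphic_on_imp_continuous_on[OF hol_u]
  and cont_v = holomorphic_on_imp_continuous_on[OF hol_v]
  and cont_L = holomorphic_on_imp_continuous_on[OF hol_L]
  and cont_wronskian = holomorphic_on_imp_continuous_on[OF hol_wronskian]

lemma N_pos: "z \<in> ball 0 R \<Longrightarrow> 0 < sq_norm u v z"
  using sq_norm_pos[of u z v] nonzero by blast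

lemma cont_sq_norm: "continuous_on (ball 0 R) (sq_norm u v)"
  unfolding sq_norm_def[abs_def] by (intro continuous_intros cont_u cont_v)

lemma cont_fs_density: "continuous_on (ball 0 R) (fs_density u v)"
  unfolding fs_density_def[abs_def]
  by (intro continuous_intros cont_sq_norm cont_wronskian) (use N_pos in force)

lemma dist_sq_eq: "dist_sq a z = (cmod (L a z))\<^sup>2 / sq_norm u v z"
  by (simp add: dist_sq_def chord_sq_def L_def sq_norm_def)

lemma cont_dist_sq: "continuous_on (ball 0 R) (dist_sq a)"
  unfolding dist_sq_eq[abs_def]
  by (intro continuous_intros cont_sq_norm cont_L) (use N_pos in force)

lemma dist_sq_nonneg: "0 \<le> dist_sq a z" and dist_sq_le_1: "dist_sq a z \<le> 1"
  unfolding dist_sq_def by (rule chord_sq_nonneg chord_sq_le_1)+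

lemma dist_sq_pos: "z \<in> ball 0 R \<Longrightarrow> L a z \<noteq> 0 \<Longrightarrow> 0 < dist_sq a z"
  using N_pos by (simp add: dist_sq_eq)

lemma
  assumes s: "s < R"
  shows cont_ln_sq_norm: "continuous_on (sphere 0 s) (\<lambda>z. ln (sq_norm u v z))"
    and cont_ln_L: "(\<And>z. cmod z = s \<Longrightarrow> L a z \<noteq> 0) \<Longrightarrow> continuous_on (sphere 0 s) (\<lambda>z. ln (cmod (L a z)))"
    and cont_ln_wronskian: "(\<And>z. cmod z = s \<Longrightarrow> wronskian u v z \<noteq> 0) \<Longrightarrow>
      continuous_on (sphere 0 s) (\<lambda>z. ln (cmod (wronskian u v z)))"
proof -
  have zs: "z \<in> ball 0 R" if "cmod z = s" for z using that s by simp
  show "continuous_on (sphere 0 s) (\<lambda>z. ln (sq_norm u v z))"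
    by (intro continuous_intros continuous_on_sphere_of_ball[OF cont_sq_norm s]) (use N_pos zs in force)
  show "continuous_on (sphere 0 s) (\<lambda>z. ln (cmod (L a z)))" if "\<And>z. cmod z = s \<Longrightarrow> L a z \<noteq> 0"
    by (intro continuous_intros continuous_on_subset[OF cont_L[of a]]) (use zs that in auto)
  show "continuous_on (sphere 0 s) (\<lambda>z. ln (cmod (wronskian u v z)))" if "\<And>z. cmod z = s \<Longrightarrow> wronskian u v z \<noteq> 0"
    by (intro continuous_intros continuous_on_subset[OF cont_wronskian]) (use zs that in auto)
qed

lemma sq_norm_L: "(cmod (L a z))\<^sup>2 + (cmod (L_perp a z))\<^sup>2 = sq_norm u v z"
  unfolding L_def L_perp_def sq_norm_def by (rule cov_orthogonal)

lemma deriv_comb: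
  assumes "z \<in> ball 0 R"
  shows "deriv (\<lambda>w. c * u w + d * v w) z = c * deriv u z + d * deriv v z"
proof -
  have "(u has_field_derivative deriv u z) (at z)" "(v has_field_derivative deriv v z) (at z)"
    by (rule holomorphic_derivI[OF hol_u open_ball assms] holomorphic_derivI[OF hol_v open_ball assms])+
  then show ?thesis by (intro DERIV_imp_deriv) (auto intro!: derivative_eq_intros)
qed

lemma wronskian_L:
  assumes z: "z \<in> ball 0 R"
  shows "wronskian (\<lambda>w. c * L a w) (\<lambda>w. d * L_perp a w) z = c * d * wronskian u v z"
proof -
  have c: "cov0 a * cnj (cov0 a) + cov1 a * cnj (cov1 a) = 1"
    using cov_unit[of a] unfolding complex_norm_square[symmetric] of_real_add[symmetric] by simp
  have dL: "deriv (\<lambda>w. c * L a w) z = c * (cov0 a * deriv u z + cov1 a * deriv v z)"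
    using deriv_comb[OF z, of "c * cov0 a" "c * cov1 a"] by (simp add: L_def[abs_def] algebra_simps)
  have dP: "deriv (\<lambda>w. d * L_perp a w) z = d * (- cnj (cov1 a) * deriv u z + cnj (cov0 a) * deriv v z)"
    using deriv_comb[OF z, of "- d * cnj (cov1 a)" "d * cnj (cov0 a)"] by (simp add: L_perp_def[abs_def] algebra_simps)
  have "wronskian (\<lambda>w. c * L a w) (\<lambda>w. d * L_perp a w) z
     = c * d * ((cov0 a * cnj (cov0 a) + cov1 a * cnj (cov1 a)) * wronskian u v z)"
    unfolding wronskian_def dL dP unfolding L_def L_perp_def by (simp add: algebra_simps)
  then show ?thesis by (simp add: c)
qed

lemma L_nontrivial: "\<exists>z\<in>ball 0 R. L a z \<noteq> 0"
proof (rule ccontr)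
  assume "\<not> ?thesis"
  then have 0: "L a z = 0" if "z \<in> ball 0 R" for z using that by blast
  have "wronskian u v z = 0" if z: "z \<in> ball 0 R" for z
  proof -
    have "deriv (L a) z = 0"
      by (rule DERIV_imp_deriv, rule has_field_derivative_transform_within_open[OF DERIV_const[of 0] open_ball z])
         (simp add: 0)
    then show ?thesis using wronskian_L[OF z, of 1 a 1] 0[OF z] by (simp add: wronskian_def)
  qed
  then show False using wronskian_nontrivial by blast
qed

text \<open>The potential \<open>ln (|L|^2 + e N)\<close> belongs to the pair \<open>sqrt (1 + e) L, sqrt e L_perp\<close>. Compared with
  \<open>ln N\<close> its mean differs by that of \<open>ln (x + e)\<close>, which lies between the mean of \<open>ln x\<close> and \<open>ln 2\<close>;
  the resulting bound does not depend on \<open>e\<close>.\<close>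

lemma height_peak_le:
  assumes r: "0 < r1" "r1 \<le> r" "r < R" and nz: "\<And>z. cmod z = r1 \<Longrightarrow> L a z \<noteq> 0"
  shows "height r1 (\<lambda>z. fs_density u v z * peak k (dist_sq a z)) r
    \<le> height r1 (fs_density u v) r + (ln 2 - circ_mean (\<lambda>z. ln (dist_sq a z)) r1) / 4"
proof -
  define e where "e = (1/2::real)^k"
  have e: "0 < e" "e \<le> 1" by (auto simp: e_def power_le_one)
  let ?h1 = "\<lambda>z. of_real (sqrt (1 + e)) * L a z" and ?h2 = "\<lambda>z. of_real (sqrt e) * L_perp a z"
  have N: "sq_norm ?h1 ?h2 z = sq_norm u v z * (dist_sq a z + e)" if z: "z \<in> ball 0 R" for z
  proof -
    have "sq_norm ?h1 ?h2 z = (cmod (L a z))\<^sup>2 + e * ((cmod (L a z))\<^sup>2 + (cmod (L_perp a z))\<^sup>2)"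
      using e by (simp add: sq_norm_def norm_mult power_mult_distrib algebra_simps)
    then show ?thesis using N_pos[OF z] by (simp add: sq_norm_L dist_sq_eq algebra_simps)
  qed
  have Npos: "0 < sq_norm ?h1 ?h2 z" if "z \<in> ball 0 R" for z
    using N[OF that] N_pos[OF that] dist_sq_nonneg[of a z] e by (simp add: add_nonneg_pos)
  have dens: "fs_density ?h1 ?h2 z = fs_density u v z * peak k (dist_sq a z)" if z: "z \<in> ball 0 R" for z
    unfolding fs_density_def N[OF z] wronskian_L[OF z] peak_def e_def[symmetric]
    using e by (simp add: norm_mult power_mult_distrib)
  have G: "circ_mean (\<lambda>z. ln (sq_norm ?h1 ?h2 z)) r - circ_mean (\<lambda>z. ln (sq_norm ?h1 ?h2 z)) r1
      = 4 * height r1 (\<lambda>z. fs_density u v z * peak k (dist_sq a z)) r"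
  proof -
    have "?h1 z \<noteq> 0 \<or> ?h2 z \<noteq> 0" if "z \<in> ball 0 R" for z
      using Npos[OF that] by (auto simp: sq_norm_def)
    moreover have "?h1 holomorphic_on ball 0 R" "?h2 holomorphic_on ball 0 R"
      by (intro holomorphic_intros hol_L hol_L_perp)+
    ultimately show ?thesis using height_fs_density[of ?h1 R ?h2 r1 r] r
      height_cong[of R "fs_density ?h1 ?h2" "\<lambda>z. fs_density u v z * peak k (dist_sq a z)" r1 r] dens
      by simp
  qed
  have cx: "continuous_on (sphere 0 s) (dist_sq a)" if "s < R" for s
    by (rule continuous_on_sphere_of_ball[OF cont_dist_sq that])
  have cxe: "continuous_on (sphere 0 s) (\<lambda>z. ln (dist_sq a z + e))" if "s < R" for s
    by (intro continuous_intros cx[OF that]) (use dist_sq_nonneg e in \<open>metis add_nonneg_pos less_irrefl\<close>)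
  have split: "circ_mean (\<lambda>z. ln (sq_norm ?h1 ?h2 z)) s
      = circ_mean (\<lambda>z. ln (sq_norm u v z)) s + circ_mean (\<lambda>z. ln (dist_sq a z + e)) s" if s: "0 < s" "s < R" for s
  proof -
    have "circ_mean (\<lambda>z. ln (sq_norm ?h1 ?h2 z)) s = circ_mean (\<lambda>z. ln (sq_norm u v z) + ln (dist_sq a z + e)) s"
    proof (rule circ_mean_cong)
      fix z assume "cmod z = \<bar>s\<bar>"
      then have z: "z \<in> ball 0 R" using s by simp
      show "ln (sq_norm ?h1 ?h2 z) = ln (sq_norm u v z) + ln (dist_sq a z + e)"
        unfolding N[OF z] by (rule ln_mult_pos) (use N_pos[OF z] dist_sq_nonneg[of a z] e in auto)
    qed
    also have "\<dots> = circ_mean (\<lambda>z. ln (sq_norm u v z)) s + circ_mean (\<lambda>z. ln (dist_sq a z + e)) s"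
      by (rule circ_mean_add) (use s cont_ln_sq_norm cxe in auto)
    finally show ?thesis .
  qed
  have "circ_mean (\<lambda>z. ln (dist_sq a z + e)) r \<le> circ_mean (\<lambda>_. ln 2) r"
  proof (rule circ_mean_mono)
    fix z
    show "ln (dist_sq a z + e) \<le> ln 2"
      using dist_sq_nonneg[of a z] dist_sq_le_1[of a z] e by (subst ln_le_cancel_iff) auto
  qed (use r cxe in auto)
  moreover have "circ_mean (\<lambda>z. ln (dist_sq a z)) r1 \<le> circ_mean (\<lambda>z. ln (dist_sq a z + e)) r1"
  proof (rule circ_mean_mono)
    have pos: "0 < dist_sq a z" if "cmod z = r1" for z using that nz r dist_sq_pos[of z a] by simp
    then show "ln (dist_sq a z) \<le> ln (dist_sq a z + e)" if "cmod z = r1" for z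
      using e pos[OF that] by (subst ln_le_cancel_iff) (auto intro: add_pos_pos)
    show "continuous_on (sphere 0 r1) (\<lambda>z. ln (dist_sq a z))"
      by (intro continuous_intros cx) (use r pos in force)+
  qed (use r cxe in auto)
  moreover have "circ_mean (\<lambda>z. ln (sq_norm u v z)) r - circ_mean (\<lambda>z. ln (sq_norm u v z)) r1
      = 4 * height r1 (fs_density u v) r"
    using height_fs_density[OF hol_u hol_v nonzero r] by simp
  moreover have "0 < r" "r1 < R" using r by auto
  moreover have "P \<le> H + (l - Y) / 4"
    if "X \<le> l" "Y \<le> X1" "N - N1 = 4 * H" "h - h1 = 4 * P" "h = N + X" "h1 = N1 + X1"
    for P H l Y X X1 N N1 h h1 :: real
    using that by argo
  ultimately show ?thesis using G split[of r] split[of r1] r unfolding circ_mean_const by blast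
qed

lemma ln_dist_sq_split:
  assumes s: "0 < s" "s < R" and nz: "\<And>z. cmod z = s \<Longrightarrow> L a z \<noteq> 0"
  shows "circ_mean (\<lambda>z. ln (dist_sq a z)) s = 2 * circ_mean (\<lambda>z. ln (cmod (L a z))) s - circ_mean (\<lambda>z. ln (sq_norm u v z)) s"
    and "continuous_on (sphere 0 s) (\<lambda>z. ln (dist_sq a z))"
proof -
  have zs: "z \<in> ball 0 R" if "cmod z = s" for z using that s by simp
  note cN = cont_ln_sq_norm[OF s(2)] and cL = cont_ln_L[OF s(2) nz]
  show "continuous_on (sphere 0 s) (\<lambda>z. ln (dist_sq a z))"
    by (intro continuous_intros continuous_on_sphere_of_ball[OF cont_dist_sq s(2)])
       (use nz zs dist_sq_pos in force)
  have "circ_mean (\<lambda>z. ln (dist_sq a z)) s = circ_mean (\<lambda>z. 2 * ln (cmod (L a z)) - ln (sq_norm u v z)) s"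
  proof (rule circ_mean_cong)
    fix z assume "cmod z = \<bar>s\<bar>"
    then have z: "cmod z = s" using s by simp
    then show "ln (dist_sq a z) = 2 * ln (cmod (L a z)) - ln (sq_norm u v z)"
      using nz[OF z] N_pos[OF zs[OF z]] by (simp add: dist_sq_eq ln_div ln_realpow)
  qed
  also have "\<dots> = 2 * circ_mean (\<lambda>z. ln (cmod (L a z))) s - circ_mean (\<lambda>z. ln (sq_norm u v z)) s"
    using s cL cN by (subst circ_mean_diff) (auto simp: circ_mean_cmult intro!: continuous_on_mult)
  finally show "circ_mean (\<lambda>z. ln (dist_sq a z)) s = 2 * circ_mean (\<lambda>z. ln (cmod (L a z))) s - circ_mean (\<lambda>z. ln (sq_norm u v z)) s" .
qed

text \<open>The contribution of a simple point \<open>b\<close> to the counting function between \<open>r1\<close> and \<open>r\<close>, i.e. the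
  integral of \<open>1 / t\<close> over those \<open>t\<close> in \<open>{r1..r}\<close> with \<open>|b| < t\<close>.\<close>

definition gap :: "real \<Rightarrow> real \<Rightarrow> complex \<Rightarrow> real" where
  "gap r1 r b = ln r - ln (max r1 (cmod b))"

lemma gap_nonneg: "0 < r1 \<Longrightarrow> r1 \<le> r \<Longrightarrow> cmod b < r \<Longrightarrow> 0 \<le> gap r1 r b"
  by (simp add: gap_def)

lemma finite_zeros:
  assumes h: "h holomorphic_on ball 0 R" and nz: "\<exists>z\<in>ball 0 R. h z \<noteq> 0" and r: "r < R"
  shows "finite {b\<in>ball 0 r. h b = 0}"
proof (cases "\<exists>z\<in>ball 0 R. h z = 0")
  case True
  then have "\<not> h constant_on ball 0 R" using nz unfolding constant_on_def by force
  then have "finite {b\<in>cball 0 r. h b = 0}"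
    using r by (intro holomorphic_compact_finite_zeros[OF h]) auto
  then show ?thesis by (rule finite_subset[rotated]) auto
next
  case False
  then have "{b\<in>ball 0 r. h b = 0} = {}" using r by auto
  then show ?thesis by (simp only: finite.emptyI)
qed

lemma zorder_nonneg:
  assumes "h holomorphic_on ball 0 R" "\<exists>z\<in>ball 0 R. h z \<noteq> 0" "b \<in> ball 0 R"
  shows "0 \<le> zorder h b"
  using zorder_exist_zero[OF assms(1) open_ball _ assms(3,2)] by (auto split: if_splits)

text \<open>The First Main Theorem in the form of an inequality: Jensen's formula for \<open>L a\<close> has a nonnegative
  right-hand side.\<close>

lemma mean_ln_dist_sq_ge:
  assumes r: "0 < r1" "r1 \<le> r" "r < R"
    and nz1: "\<And>z. cmod z = r1 \<Longrightarrow> L a z \<noteq> 0" and nzr: "\<And>z. cmod z = r \<Longrightarrow> L a z \<noteq> 0"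
  shows "circ_mean (\<lambda>z. ln (dist_sq a z)) r1 - 4 * height r1 (fs_density u v) r
    \<le> circ_mean (\<lambda>z. ln (dist_sq a z)) r"
proof -
  have "0 \<le> circ_mean (\<lambda>z. ln (cmod (L a z))) r - circ_mean (\<lambda>z. ln (cmod (L a z))) r1"
  proof -
    have "circ_mean (\<lambda>z. ln (cmod (L a z))) r - circ_mean (\<lambda>z. ln (cmod (L a z))) r1
      = (\<Sum>b\<in>{b\<in>ball 0 r. L a b = 0}. real_of_int (zorder (L a) b) * gap r1 r b)"
      unfolding gap_def by (rule jensen_formula[OF hol_L L_nontrivial r]) (use nz1 nzr in auto)
    also have "\<dots> \<ge> 0"
    proof (intro sum_nonneg mult_nonneg_nonneg)
      fix b assume b: "b \<in> {b\<in>ball 0 r. L a b = 0}"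
      show "0 \<le> real_of_int (zorder (L a) b)"
        using zorder_nonneg[OF hol_L L_nontrivial, of b a] b r by simp
      show "0 \<le> gap r1 r b" by (rule gap_nonneg) (use b r in auto)
    qed
    finally show ?thesis .
  qed
  then show ?thesis
    using ln_dist_sq_split(1)[of r a] ln_dist_sq_split(1)[of r1 a] r nz1 nzr
      height_fs_density[OF hol_u hol_v nonzero r] by simp
qed

lemma L_disjoint_zeros:
  assumes "z \<in> ball 0 R" "L a z = 0" "L b z = 0"
  shows "a = b"
  using assms cov_zero_iff[OF nonzero[OF assms(1)]] by (auto simp: L_def)

text \<open>The zero sets of the forms \<open>L a\<close> for different targets are disjoint, so the zeros of the Wronskian
  are used at most once when all multiplicities are reduced to one.\<close>

lemma sum_zeros_truncation:
  assumes A: "finite A" and r: "0 < r1" "r1 \<le> r" "r < R"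
  shows "(\<Sum>a\<in>A. \<Sum>b\<in>{b\<in>ball 0 r. L a b = 0}. real_of_int (zorder (L a) b) * gap r1 r b)
    \<le> (\<Sum>a\<in>A. \<Sum>b\<in>{b\<in>ball 0 r. L a b = 0}. gap r1 r b)
      + (\<Sum>b\<in>{b\<in>ball 0 r. wronskian u v b = 0}. real_of_int (zorder (wronskian u v) b) * gap r1 r b)"
proof -
  let ?Z = "\<lambda>a. {b\<in>ball 0 r. L a b = 0}" and ?W = "{b\<in>ball 0 r. wronskian u v b = 0}"
  define g where "g = (\<lambda>b. real_of_int (zorder (wronskian u v) b) * gap r1 r b)"
  have finZ: "finite (?Z a)" for a by (rule finite_zeros[OF hol_L L_nontrivial r(3)])
  have finW: "finite ?W" by (rule finite_zeros[OF hol_wronskian wronskian_nontrivial r(3)])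
  have g0: "0 \<le> g b" if "b \<in> ball 0 r" for b unfolding g_def
    using that r by (intro mult_nonneg_nonneg gap_nonneg)
      (auto intro!: zorder_nonneg[OF hol_wronskian wronskian_nontrivial])
  have le: "real_of_int (zorder (L a) b) * gap r1 r b \<le> gap r1 r b + g b" if b: "b \<in> ?Z a" for a b
  proof -
    have bR: "b \<in> ball 0 R" using b r by auto
    have eq: "wronskian (L a) (L_perp a) z = wronskian u v z" if "z \<in> ball 0 R" for z
      using wronskian_L[OF that, of 1 a 1] by simp
    have "zorder (L a) b - 1 \<le> zorder (wronskian (L a) (L_perp a)) b"
      by (rule zorder_wronskian_ge[OF open_ball _ bR hol_L hol_L_perp L_nontrivial])
         (use wronskian_nontrivial eq b in auto)
    also have "\<dots> = zorder (wronskian u v) b"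
    proof (rule zorder_cong[OF _ refl])
      have "\<forall>\<^sub>F z in at b. z \<in> ball 0 R" using bR by (intro eventually_at_in_open') auto
      then show "\<forall>\<^sub>F z in at b. wronskian (L a) (L_perp a) z = wronskian u v z"
        by eventually_elim (rule eq)
    qed
    finally have "real_of_int (zorder (L a) b) \<le> 1 + real_of_int (zorder (wronskian u v) b)" by linarith
    then have "real_of_int (zorder (L a) b) * gap r1 r b \<le> (1 + real_of_int (zorder (wronskian u v) b)) * gap r1 r b"
      using gap_nonneg[of r1 r b] r b by (intro mult_right_mono) auto
    then show ?thesis by (simp add: g_def distrib_right)
  qed
  have "(\<Sum>a\<in>A. \<Sum>b\<in>?Z a. real_of_int (zorder (L a) b) * gap r1 r b)
     \<le> (\<Sum>a\<in>A. \<Sum>b\<in>?Z a. gap r1 r b + g b)"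
    by (intro sum_mono le)
  also have "\<dots> = (\<Sum>a\<in>A. \<Sum>b\<in>?Z a. gap r1 r b) + (\<Sum>a\<in>A. \<Sum>b\<in>?Z a. g b)"
    by (simp add: sum.distrib)
  also have "(\<Sum>a\<in>A. \<Sum>b\<in>?Z a. g b) = (\<Sum>b\<in>(\<Union>a\<in>A. ?Z a). g b)"
  proof (rule sum.UNION_disjoint[symmetric])
    have "a = a'" if "z \<in> ?Z a" "z \<in> ?Z a'" for z a a'
      using L_disjoint_zeros[of z a a'] that r by simp
    then show "\<forall>a\<in>A. \<forall>a'\<in>A. a \<noteq> a' \<longrightarrow> ?Z a \<inter> ?Z a' = {}" by blast
  qed (use A finZ in auto)
  also have "\<dots> = (\<Sum>b\<in>(\<Union>a\<in>A. ?Z a) \<inter> ?W. g b)"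
  proof (rule sum.mono_neutral_right)
    show "finite (\<Union>a\<in>A. ?Z a)" using A finZ by blast
    show "\<forall>b\<in>(\<Union>a\<in>A. ?Z a) - (\<Union>a\<in>A. ?Z a) \<inter> ?W. g b = 0"
    proof
      fix b assume b: "b \<in> (\<Union>a\<in>A. ?Z a) - (\<Union>a\<in>A. ?Z a) \<inter> ?W"
      then have bR: "b \<in> ball 0 R" and W: "wronskian u v b \<noteq> 0" using r by auto
      have "zorder (wronskian u v) b = 0"
        using zorder_exist_zero[OF hol_wronskian open_ball _ bR wronskian_nontrivial] W by auto
      then show "g b = 0" by (simp add: g_def)
    qed
  qed auto
  also have "\<dots> \<le> (\<Sum>b\<in>?W. g b)"
    by (rule sum_mono2) (use finW g0 in auto)
  finally show ?thesis by (simp add: g_def)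
qed

text \<open>On a circle \<open>ln (|W|^2 / N^2 * \<Prod> 1 / x_a) = 2 ln |W| - 2 \<Sum> ln |L_a| + (q - 2) ln N\<close>. Jensen's
  formula evaluates the growth of the means of the first two terms, and that of \<open>ln N\<close> is the
  characteristic.\<close>

theorem second_main_inequality:
  assumes A: "finite A" and r: "0 < r1" "r1 \<le> r" "r < R"
    and nz: "\<And>a z. a \<in> A \<Longrightarrow> cmod z \<in> {r1, r} \<Longrightarrow> L a z \<noteq> 0"
    and nW: "\<And>z. cmod z \<in> {r1, r} \<Longrightarrow> wronskian u v z \<noteq> 0"
  defines "M \<equiv> \<lambda>s. circ_mean (\<lambda>z. ln (fs_density u v z * (\<Prod>a\<in>A. 1 / dist_sq a z))) s"
  shows "(real (card A) - 2) * (2 * height r1 (fs_density u v) r)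
    \<le> (\<Sum>a\<in>A. \<Sum>b\<in>{b\<in>ball 0 r. L a b = 0}. gap r1 r b) + (M r - M r1) / 2"
proof -
  let ?mW = "circ_mean (\<lambda>z. ln (cmod (wronskian u v z)))"
  let ?mL = "\<lambda>a. circ_mean (\<lambda>z. ln (cmod (L a z)))"
  let ?mN = "circ_mean (\<lambda>z. ln (sq_norm u v z))"
  have M: "M s = 2 * ?mW s - 2 * (\<Sum>a\<in>A. ?mL a s) + (real (card A) - 2) * ?mN s" if s: "s \<in> {r1, r}" for s
  proof -
    have s': "0 \<le> s" "s < R" using s r by auto
    have zs: "z \<in> ball 0 R" if "cmod z = s" for z using that s' by simp
    note cN = cont_ln_sq_norm[OF s'(2)]
    have cL: "continuous_on (sphere 0 s) (\<lambda>z. ln (cmod (L a z)))" if "a \<in> A" for a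
      by (rule cont_ln_L[OF s'(2)]) (use nz that s in blast)
    have cW: "continuous_on (sphere 0 s) (\<lambda>z. ln (cmod (wronskian u v z)))"
      by (rule cont_ln_wronskian[OF s'(2)]) (use nW s in blast)
    have "M s = circ_mean (\<lambda>z. 2 * ln (cmod (wronskian u v z)) + ((- 2) * (\<Sum>a\<in>A. ln (cmod (L a z)))
        + (real (card A) - 2) * ln (sq_norm u v z))) s"
      unfolding M_def
    proof (rule circ_mean_cong)
      fix z assume "cmod z = \<bar>s\<bar>"
      then have z: "cmod z = s" using s' by simp
      note zR = zs[OF z]
      have W: "wronskian u v z \<noteq> 0" and La: "\<And>a. a \<in> A \<Longrightarrow> L a z \<noteq> 0" using nW nz z s by auto
      have d: "0 < dist_sq a z" if "a \<in> A" for a using dist_sq_pos[OF zR La[OF that]] .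
      have "ln (\<Prod>a\<in>A. 1 / dist_sq a z) = (\<Sum>a\<in>A. ln (1 / dist_sq a z))"
      proof (rule ln_prod[OF A])
        show "1 / dist_sq a z \<noteq> 0" if "a \<in> A" for a using d[OF that] by simp
      qed
      also have "\<dots> = (\<Sum>a\<in>A. ln (sq_norm u v z) - 2 * ln (cmod (L a z)))"
        by (rule sum.cong) (use La N_pos[OF zR] in \<open>auto simp: dist_sq_eq ln_div ln_realpow\<close>)
      also have "\<dots> = real (card A) * ln (sq_norm u v z) - 2 * (\<Sum>a\<in>A. ln (cmod (L a z)))"
        by (simp add: sum_subtractf sum_distrib_left)
      finally have P: "ln (\<Prod>a\<in>A. 1 / dist_sq a z) = \<dots>" .
      have D: "0 < fs_density u v z" "ln (fs_density u v z) = 2 * ln (cmod (wronskian u v z)) - 2 * ln (sq_norm u v z)"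
        using W N_pos[OF zR] by (auto simp: fs_density_def ln_div ln_realpow)
      have "ln (fs_density u v z * (\<Prod>a\<in>A. 1 / dist_sq a z)) = ln (fs_density u v z) + ln (\<Prod>a\<in>A. 1 / dist_sq a z)"
        by (rule ln_mult_pos[OF D(1)]) (use d in \<open>auto intro!: prod_pos\<close>)
      then show "ln (fs_density u v z * (\<Prod>a\<in>A. 1 / dist_sq a z)) = 2 * ln (cmod (wronskian u v z))
         + ((- 2) * (\<Sum>a\<in>A. ln (cmod (L a z))) + (real (card A) - 2) * ln (sq_norm u v z))"
        unfolding P D(2) by (simp add: algebra_simps)
    qed
    also have "\<dots> = 2 * ?mW s + ((- 2) * (\<Sum>a\<in>A. ?mL a s) + (real (card A) - 2) * ?mN s)"
      using s' cN cL cW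
      by (simp only: circ_mean_add circ_mean_cmult circ_mean_sum continuous_on_add continuous_on_mult continuous_on_const continuous_on_sum)
    finally show ?thesis by simp
  qed
  have JW: "?mW r - ?mW r1 = (\<Sum>b\<in>{b\<in>ball 0 r. wronskian u v b = 0}. real_of_int (zorder (wronskian u v) b) * gap r1 r b)"
    unfolding gap_def by (rule jensen_formula[OF hol_wronskian wronskian_nontrivial r]) (use nW in auto)
  have JL: "?mL a r - ?mL a r1 = (\<Sum>b\<in>{b\<in>ball 0 r. L a b = 0}. real_of_int (zorder (L a) b) * gap r1 r b)"
    if "a \<in> A" for a
    unfolding gap_def by (rule jensen_formula[OF hol_L L_nontrivial r]) (use nz that in auto)
  have "(\<Sum>a\<in>A. ?mL a r) - (\<Sum>a\<in>A. ?mL a r1)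
     \<le> (\<Sum>a\<in>A. \<Sum>b\<in>{b\<in>ball 0 r. L a b = 0}. gap r1 r b) + (?mW r - ?mW r1)"
    using sum_zeros_truncation[OF A r] JL unfolding JW sum_subtractf[symmetric] by simp
  moreover have "(real (card A) - 2) * ?mN r - (real (card A) - 2) * ?mN r1
     = (real (card A) - 2) * (4 * height r1 (fs_density u v) r)"
    using height_fs_density[OF hol_u hol_v nonzero r] by (simp add: right_diff_distrib[symmetric])
  moreover have "c * (2 * H) \<le> S + (m - m1) / 2"
    if "l - l1 \<le> S + (w - w1)" "n - n1 = c * (4 * H)" "m = 2 * w - 2 * l + n" "m1 = 2 * w1 - 2 * l1 + n1"
    for c H S m m1 l l1 w w1 n n1 :: real
  proof -
    have "c * (4 * H) = 2 * (c * (2 * H))" by simp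
    then show ?thesis using that by argo
  qed
  ultimately show ?thesis using M[of r] M[of r1] by blast
qed

end

section \<open>Meromorphic functions as quotients of holomorphic pairs\<close>

lemma fs_density_quotient:
  assumes S: "open S" "z \<in> S" and p: "p holomorphic_on S" and q: "q holomorphic_on S"
    and nz: "\<And>w. w \<in> S \<Longrightarrow> q w \<noteq> 0" and k: "\<And>w. w \<in> S \<Longrightarrow> k w = p w / q w"
  shows "k holomorphic_on S" "fs_density k (\<lambda>_. 1) z = fs_density p q z"
proof -
  have "(\<lambda>w. p w / q w) holomorphic_on S" by (intro holomorphic_intros p q nz)
  then show "k holomorphic_on S" using k by (simp cong: holomorphic_cong)
  have "((\<lambda>w. p w / q w) has_field_derivative (deriv p z * q z - p z * deriv q z) / (q z * q z)) (at z)"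
    by (intro DERIV_divide holomorphic_derivI[OF p S] holomorphic_derivI[OF q S] nz S)
  then have "(k has_field_derivative (deriv p z * q z - p z * deriv q z) / (q z * q z)) (at z)"
    by (rule has_field_derivative_transform_within_open[OF _ S]) (simp add: k)
  then have d: "deriv k z = - wronskian p q z / (q z * q z)"
    by (simp add: DERIV_imp_deriv wronskian_def)
  have q0: "q z \<noteq> 0" by (rule nz[OF S(2)])
  have "sq_norm k (\<lambda>_. 1) z = sq_norm p q z / (cmod (q z))\<^sup>2"
    using q0 by (simp add: sq_norm_def k[OF S(2)] norm_divide power_divide add_divide_distrib)
  moreover have "cmod (wronskian k (\<lambda>_. 1) z) = cmod (wronskian p q z) / (cmod (q z))\<^sup>2"
    by (simp add: wronskian_def[of k] d norm_divide norm_mult power2_eq_square)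
  ultimately show "fs_density k (\<lambda>_. 1) z = fs_density p q z"
    using q0 by (simp add: fs_density_def power_divide)
qed

lemma fs_density_swap: "fs_density v u z = fs_density u v z"
proof -
  have "wronskian v u z = - wronskian u v z" by (simp add: wronskian_def)
  then show ?thesis by (simp add: fs_density_def sq_norm_def add.commute)
qed

lemma ddc_fs_potential_quotient:
  assumes S: "open S" "z \<in> S" and p: "p holomorphic_on S" and q: "q holomorphic_on S"
    and nz: "\<And>w. w \<in> S \<Longrightarrow> q w \<noteq> 0" and k: "\<And>w. w \<in> S \<Longrightarrow> k w = p w / q w"
  shows "ddc (\<lambda>w. fs_potential (k w) 1) z = fs_density p q z / pi"
  using ddc_fs_potential[OF S fs_density_quotient(1)[OF S p q nz k] holomorphic_on_const[of 1]]
    fs_density_quotient(2)[OF S p q nz k] by simp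

text \<open>The equation \<open>f = v / u\<close> holds at the poles as well, both sides being \<open>0\<close> there.\<close>

locale meromorphic_lift = proj_lift +
  fixes f :: "complex \<Rightarrow> complex"
  assumes lift: "\<And>z. z \<in> ball 0 R \<Longrightarrow> f z = v z / u z"
    and pole_iff: "\<And>z. z \<in> ball 0 R \<Longrightarrow> is_pole f z \<longleftrightarrow> u z = 0"
begin

lemma fs_pullback_eq:
  assumes z: "z \<in> ball 0 R"
  shows "fs_pullback f z = fs_density u v z / pi"
proof (cases "u z = 0")
  case False
  let ?S = "ball 0 R \<inter> u -` (- {0})"
  have S: "open ?S" by (intro continuous_open_preimage cont_u) auto
  have "ddc (\<lambda>w. fs_potential (f w) 1) z = fs_density v u z / pi"
    by (rule ddc_fs_potential_quotient[OF S])
       (use z False lift in \<open>auto intro: holomorphic_on_subset[OF hol_u] holomorphic_on_subset[OF hol_v]\<close>)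
  then show ?thesis using False pole_iff[OF z]
    by (simp add: fs_pullback_def fs_potential_def add.commute fs_density_swap)
next
  case True
  let ?S = "ball 0 R \<inter> v -` (- {0})"
  have S: "open ?S" by (intro continuous_open_preimage cont_v) auto
  have "ddc (\<lambda>w. fs_potential (inverse (f w)) 1) z = fs_density u v z / pi"
    by (rule ddc_fs_potential_quotient[OF S])
       (use z True nonzero[OF z] lift in \<open>auto intro: holomorphic_on_subset[OF hol_u] holomorphic_on_subset[OF hol_v]\<close>)
  then show ?thesis using True pole_iff[OF z] by (simp add: fs_pullback_def)
qed

lemma sphere_map_eq_iff:
  assumes z: "z \<in> ball 0 R"
  shows "sphere_map f z = a \<longleftrightarrow> L a z = 0"
  unfolding L_def cov_zero_iff[OF nonzero[OF z]] sphere_map_def using pole_iff[OF z] lift[OF z] by auto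

lemma dist_sq_sphere:
  assumes z: "z \<in> ball 0 R"
  shows "dist_sq a z = (if is_pole f z then chord_sq a 0 1 else chord_sq a 1 (f z))"
proof (cases "u z = 0")
  case True
  then show ?thesis using nonzero[OF z] pole_iff[OF z] chord_sq_scale[of "v z" a 0 1] by (simp add: dist_sq_def)
next
  case False
  then show ?thesis using pole_iff[OF z] lift[OF z] chord_sq_scale[of "u z" a 1 "f z"] by (simp add: dist_sq_def)
qed

lemma nev_Nbar_eq:
  assumes r: "0 < r1" "r1 \<le> r" "r < R"
  shows "nev_Nbar r1 f r a = (\<Sum>b\<in>{b\<in>ball 0 r. L a b = 0}. gap r1 r b)"
proof -
  let ?Z = "{b\<in>ball 0 r. L a b = 0}"
  have fin: "finite ?Z" by (rule finite_zeros[OF hol_L L_nontrivial r(3)])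
  have one: "((\<lambda>t. if cmod b < t then 1 / t else 0) has_integral gap r1 r b) {r1..r}" if b: "b \<in> ?Z" for b
  proof -
    let ?m = "max r1 (cmod b)"
    have m: "0 < ?m" "?m \<le> r" "r1 \<le> ?m" using b r by auto
    have "((\<lambda>t. 1 / t) has_integral ln r - ln ?m) {?m..r}"
      by (rule fundamental_theorem_of_calculus[OF m(2)])
         (use m in \<open>auto intro!: derivative_eq_intros simp: has_real_derivative_iff_has_vector_derivative[symmetric]\<close>)
    then have "((\<lambda>t. if t \<in> {?m..r} then 1 / t else 0) has_integral gap r1 r b) {r1..r}"
      using m by (subst has_integral_restrict) (auto simp: gap_def)
    then show ?thesis
      by (rule has_integral_spike_finite[of "{cmod b}", rotated 2]) auto
  qed
  have "nev_Nbar r1 f r a = integral {r1..r} (\<lambda>t. \<Sum>b\<in>?Z. if cmod b < t then 1 / t else 0)"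
    unfolding nev_Nbar_def
  proof (rule Henstock_Kurzweil_Integration.integral_cong)
    fix t assume t: "t \<in> {r1..r}"
    have "sphere_map f z = a \<longleftrightarrow> L a z = 0" if "cmod z < t" for z
      using that t r by (intro sphere_map_eq_iff) auto
    then have "{z \<in> ball 0 t. sphere_map f z = a} = {b\<in>?Z. cmod b < t}"
      using t by auto
    then have "nbar f t a = card {b\<in>?Z. cmod b < t}" by (simp add: nbar_def)
    then show "real (nbar f t a) / t = (\<Sum>b\<in>?Z. if cmod b < t then 1 / t else 0)"
      using fin by (simp add: sum.If_cases Int_def)
  qed
  also have "\<dots> = (\<Sum>b\<in>?Z. gap r1 r b)"
    by (rule integral_unique, rule has_integral_sum[OF fin one])
  finally show ?thesis .
qed

end

text \<open>Inside \<open>ball 0 1\<close> zeros and poles cannot accumulate at the circle \<open>|z| = R\<close>, which makes the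
  Weierstrass factorisation on \<open>ball 0 R\<close> available. The Wronskian is \<open>u^2 f'\<close> off the poles and so
  does not vanish identically.\<close>

lemma meromorphic_lift_exists:
  assumes f: "f nicely_meromorphic_on ball 0 1" and nc: "\<not> f constant_on ball 0 1" and R: "0 < R" "R < 1"
  obtains u v where "meromorphic_lift u v R f"
proof -
  have fR: "f nicely_meromorphic_on ball 0 R" by (rule nicely_meromorphic_on_subset[OF f]) (use R in auto)
  have sparse: "\<not> z islimpt {w\<in>ball 0 R. f w = 0 \<or> is_pole f w}" if z: "z \<in> frontier (ball 0 R)" for z
  proof
    assume lim: "z islimpt {w\<in>ball 0 R. f w = 0 \<or> is_pole f w}"
    have z1: "z \<in> ball 0 1" using z R by (simp add: frontier_ball)
    have "\<exists>\<^sub>F w in at z. f w = 0 \<or> is_pole f w"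
      using lim unfolding islimpt_conv_frequently_at by (rule frequently_elim1) auto
    moreover have "\<forall>\<^sub>F w in at z. w \<in> ball 0 1" using z1 by (intro eventually_at_in_open') auto
    ultimately have "\<exists>\<^sub>F w in at z. (f w = 0 \<or> is_pole f w) \<and> w \<in> ball 0 1"
      by (rule frequently_eventually_frequently)
    then have "\<exists>\<^sub>F w in at z. f w = 0"
    proof (rule frequently_elim1)
      fix w assume w: "(f w = 0 \<or> is_pole f w) \<and> w \<in> ball 0 1"
      have "f w = 0" if p: "is_pole f w"
      proof -
        have "(is_pole f w \<and> f w = 0) \<or> f \<midarrow>w\<rightarrow> f w" using f w by (auto simp: nicely_meromorphic_on_def)
        then show ?thesis using p not_tendsto_and_filterlim_at_infinity[of "at w" f "f w"] by (auto simp: is_pole_def)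
      qed
      then show "f w = 0" using w by blast
    qed
    then have "\<And>w. w \<in> ball 0 1 \<Longrightarrow> f w = 0"
      by (rule frequently_eq_meromorphic_imp_constant[OF _ f open_ball convex_connected[OF convex_ball] z1])
    then show False using nc by (auto simp: constant_on_def)
  qed
  obtain h f1 f2 where hf: "h holomorphic_on ball 0 R" "f1 holomorphic_on UNIV" "f2 holomorphic_on UNIV"
    "\<forall>z\<in>ball 0 R. f1 z = 0 \<longleftrightarrow> \<not> is_pole f z \<and> f z = 0"
    "\<forall>z\<in>ball 0 R. f2 z = 0 \<longleftrightarrow> is_pole f z"
    "\<forall>z\<in>ball 0 R. h z \<noteq> 0" "\<forall>z\<in>ball 0 R. f z = h z * f1 z / f2 z"
    by (rule weierstrass_factorization_meromorphic[OF fR open_ball convex_connected[OF convex_ball] sparse])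
       (assumption, rule that, assumption+)
  let ?v = "\<lambda>z. h z * f1 z"
  have hol: "f2 holomorphic_on ball 0 R" "?v holomorphic_on ball 0 R"
    using hf(1,2,3) by (auto intro!: holomorphic_intros intro: holomorphic_on_subset)
  have nz: "f2 z \<noteq> 0 \<or> ?v z \<noteq> 0" if "z \<in> ball 0 R" for z using hf(4-6) that by auto
  have "\<exists>z\<in>ball 0 R. wronskian f2 ?v z \<noteq> 0"
  proof (rule ccontr)
    assume "\<not> ?thesis"
    then have W0: "wronskian f2 ?v z = 0" if "z \<in> ball 0 R" for z using that by blast
    let ?S = "ball 0 R \<inter> f2 -` (- {0})"
    have S: "open ?S" by (intro continuous_open_preimage holomorphic_on_imp_continuous_on hol) auto
    have "?S \<noteq> {}"
    proof
      assume "?S = {}"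
      then have p: "is_pole f z" if "z \<in> ball 0 R" for z using hf(5) that by auto
      have "f meromorphic_on ball 0 1" using f by (simp add: nicely_meromorphic_on_def)
      then have "isolated_singularity_at f 0" by (rule meromorphic_onE) simp
      then have "\<forall>\<^sub>F w in at 0. \<not> is_pole f w" by (rule eventually_not_pole)
      moreover have "\<forall>\<^sub>F w in at 0. w \<in> ball 0 R" using R by (intro eventually_at_in_open') auto
      ultimately have "\<forall>\<^sub>F w in at (0::complex). False"
        by eventually_elim (use p in auto)
      then show False by simp
    qed
    then obtain z0 where z0: "z0 \<in> ?S" by blast
    then obtain e where e: "0 < e" "ball z0 e \<subseteq> ?S" using S open_contains_ball by blast
    have "\<exists>c. \<forall>z\<in>ball z0 e. ?v z / f2 z = c"
    proof (rule has_field_derivative_zero_constant[OF convex_ball])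
      fix z assume z: "z \<in> ball z0 e"
      then have zR: "z \<in> ball 0 R" "f2 z \<noteq> 0" using e by auto
      have "((\<lambda>z. ?v z / f2 z) has_field_derivative (deriv ?v z * f2 z - ?v z * deriv f2 z) / (f2 z * f2 z)) (at z)"
        by (intro DERIV_divide holomorphic_derivI[OF hol(2) open_ball zR(1)] holomorphic_derivI[OF hol(1) open_ball zR(1)] zR)
      moreover have "deriv ?v z * f2 z - ?v z * deriv f2 z = 0"
        using W0[OF zR(1)] by (simp add: wronskian_def mult.commute)
      ultimately show "((\<lambda>z. ?v z / f2 z) has_field_derivative 0) (at z within ball z0 e)"
        by (simp add: has_field_derivative_at_within)
    qed
    then obtain c where c: "\<And>z. z \<in> ball z0 e \<Longrightarrow> f z = c" using hf(7) e by fastforce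
    have "\<forall>\<^sub>F w in at z0. f w = c"
      using eventually_at_in_open'[of "ball z0 e" z0] e by (auto elim!: eventually_mono simp: c)
    then have "\<exists>\<^sub>F w in at z0. f w = c" by (intro eventually_frequently) auto
    then have "\<And>w. w \<in> ball 0 1 \<Longrightarrow> f w = c"
      by (rule frequently_eq_meromorphic_imp_constant[OF _ f open_ball convex_connected[OF convex_ball]]) (use z0 R in auto)
    then show False using nc by (auto simp: constant_on_def)
  qed
  then have "meromorphic_lift f2 ?v R f"
    by unfold_locales (use hol nz hf(5,7) in auto)
  then show thesis by (rule that)
qed

section \<open>The error term for a meromorphic function on the disc\<close>

lemma continuous_on_ball_exhaust:
  fixes \<phi> :: "complex \<Rightarrow> real"
  assumes "\<And>R. 0 < R \<Longrightarrow> R < 1 \<Longrightarrow> continuous_on (ball 0 R) \<phi>"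
  shows "continuous_on (ball 0 1) \<phi>"
proof (rule continuous_at_imp_continuous_on, rule ballI)
  fix z :: complex assume "z \<in> ball 0 1"
  then obtain R where R: "cmod z < R" "R < 1" using dense by auto
  then have "0 < R" using norm_ge_zero[of z] by linarith
  with R show "isCont \<phi> z"
    using assms[of R] by (intro continuous_on_interior[of "ball 0 R"]) auto
qed

lemma ln_affine_le:
  assumes "1 \<le> \<alpha>" "0 \<le> \<beta>" "0 \<le> H" "H \<le> T"
  shows "ln (\<alpha> + \<beta> * H) \<le> ln (\<alpha> + \<beta>) + ln 2 + pos_part (ln T)"
proof -
  have "\<alpha> + \<beta> * H \<le> (\<alpha> + \<beta>) * (1 + T)"
  proof -
    have "\<beta> * H \<le> \<beta> * T" "0 \<le> \<alpha> * T" using assms by (auto intro: mult_left_mono)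
    then show ?thesis using assms(2) by (simp add: algebra_simps)
  qed
  moreover have "0 < \<alpha> + \<beta> * H" using assms by (simp add: add_pos_nonneg)
  ultimately have "ln (\<alpha> + \<beta> * H) \<le> ln ((\<alpha> + \<beta>) * (1 + T))" by (subst ln_le_cancel_iff) auto
  also have "\<dots> = ln (\<alpha> + \<beta>) + ln (1 + T)" using assms by (intro ln_mult_pos) auto
  also have "ln (1 + T) \<le> ln 2 + pos_part (ln T)"
  proof (cases "T \<le> 1")
    case True
    then have "ln (1 + T) \<le> ln 2" using assms by (subst ln_le_cancel_iff) auto
    then show ?thesis by (simp add: pos_part_def)
  next
    case False
    then have "ln (1 + T) \<le> ln (2 * T)" by (subst ln_le_cancel_iff) auto
    also have "\<dots> = ln 2 + ln T" using False by (intro ln_mult_pos) auto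
    finally show ?thesis by (simp add: pos_part_def)
  qed
  finally show ?thesis by simp
qed

text \<open>A lift exists only on smaller discs and depends on them. Therefore all quantities that enter
  the growth lemma are expressed through \<open>f\<close> itself, and lifts are chosen only to transfer
  identities up to a given radius.\<close>

locale meromorphic_on_disc =
  fixes f :: "complex \<Rightarrow> complex"
  assumes mero: "f nicely_meromorphic_on ball 0 1" and nonconst: "\<not> f constant_on ball 0 1"
begin

definition speed_sq :: "complex \<Rightarrow> real" where "speed_sq z = pi * fs_pullback f z"

definition chord :: "riemann_sphere \<Rightarrow> complex \<Rightarrow> real" where
  "chord a z = (if is_pole f z then chord_sq a 0 1 else chord_sq a 1 (f z))"

lemma lift_ex:
  assumes "0 < R" "R < 1"
  obtains u v where "meromorphic_lift u v R f"
  using meromorphic_lift_exists[OF mero nonconst assms] .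

lemma speed_sq_lift: "meromorphic_lift u v R f \<Longrightarrow> z \<in> ball 0 R \<Longrightarrow> speed_sq z = fs_density u v z"
  using meromorphic_lift.fs_pullback_eq by (simp add: speed_sq_def)

lemma chord_lift: "meromorphic_lift u v R f \<Longrightarrow> z \<in> ball 0 R \<Longrightarrow> chord a z = proj_lift.dist_sq u v a z"
  using meromorphic_lift.dist_sq_sphere by (simp add: chord_def)

lemma cont_speed_sq: "continuous_on (ball 0 1) speed_sq"
proof (rule continuous_on_ball_exhaust)
  fix R :: real assume "0 < R" "R < 1"
  then obtain u v where l: "meromorphic_lift u v R f" by (rule lift_ex)
  then interpret meromorphic_lift u v R f .
  show "continuous_on (ball 0 R) speed_sq"
    using cont_fs_density by (rule continuous_on_cong[THEN iffD1, rotated -1]) (use speed_sq_lift[OF l] in auto)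
qed

lemma cont_chord: "continuous_on (ball 0 1) (chord a)"
proof (rule continuous_on_ball_exhaust)
  fix R :: real assume "0 < R" "R < 1"
  then obtain u v where l: "meromorphic_lift u v R f" by (rule lift_ex)
  then interpret meromorphic_lift u v R f .
  show "continuous_on (ball 0 R) (chord a)"
    using cont_dist_sq[of a] by (rule continuous_on_cong[THEN iffD1, rotated -1]) (use chord_lift[OF l] in auto)
qed

lemma speed_sq_nonneg: "z \<in> ball 0 1 \<Longrightarrow> 0 \<le> speed_sq z"
proof -
  assume "z \<in> ball 0 1"
  then obtain R where R: "cmod z < R" "R < 1" using dense by auto
  then have "0 < R" using norm_ge_zero[of z] by linarith
  then obtain u v where l: "meromorphic_lift u v R f" using R lift_ex by blast
  show ?thesis using speed_sq_lift[OF l, of z] R by (simp add: fs_density_def)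
qed

lemma chord_nonneg: "0 \<le> chord a z" and chord_le_1: "chord a z \<le> 1"
  by (simp_all add: chord_def chord_sq_nonneg chord_sq_le_1)

lemma nev_T_eq_height:
  assumes r: "0 < r1" "r < 1"
  shows "nev_T r1 f r = 2 * height r1 speed_sq r"
proof -
  have c: "continuous_on (ball 0 1) (fs_pullback f)"
    using continuous_on_divide[OF cont_speed_sq continuous_on_const[of _ pi]] by (simp add: speed_sq_def[abs_def])
  have "integral (ball 0 t) (fs_pullback f) = 2 * area speed_sq t" if t: "0 < t" "t < 1" for t
  proof -
    have "integral (ball 0 t) (fs_pullback f) = integral {0..t} (\<lambda>s. 2 * pi * s * circ_mean (fs_pullback f) s)"
    proof (rule integral_ball_polar[OF c _ t])
      fix z :: complex assume "z \<in> ball 0 1"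
      from speed_sq_nonneg[OF this] show "0 \<le> fs_pullback f z"
        using pi_gt_zero by (simp add: speed_sq_def zero_le_mult_iff)
    qed
    also have "\<dots> = integral {0..t} (\<lambda>s. 2 * (s * circ_mean speed_sq s))"
      by (simp add: speed_sq_def[abs_def] circ_mean_cmult mult_ac)
    also have "\<dots> = 2 * area speed_sq t" by (simp add: area_def)
    finally show ?thesis .
  qed
  then have "nev_T r1 f r = integral {r1..r} (\<lambda>t. 2 * (area speed_sq t / t))"
    unfolding nev_T_def using r by (intro Henstock_Kurzweil_Integration.integral_cong) auto
  then show ?thesis unfolding height_def integral_mult_right .
qed

lemma height_speed_sq_nonneg: "0 < r1 \<Longrightarrow> r < 1 \<Longrightarrow> 0 \<le> height r1 speed_sq r"
  by (rule height_nonneg[OF cont_speed_sq speed_sq_nonneg])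

lemma nev_T_split:
  assumes r: "0 < r0" "r0 \<le> r1" "r1 \<le> r" "r < 1"
  shows "nev_T r0 f r = nev_T r0 f r1 + nev_T r1 f r"
proof -
  have "(\<lambda>t. area speed_sq t / t) integrable_on {r0..r}"
    by (intro integrable_continuous_interval continuous_on_area_div[OF cont_speed_sq] r)
  from Henstock_Kurzweil_Integration.integral_combine[OF r(2,3) this] show ?thesis
    using r by (simp add: nev_T_eq_height height_def)
qed

lemma nev_Nbar_mono:
  assumes r: "0 < r0" "r0 \<le> r1" "r1 \<le> r" "r < 1"
  shows "nev_Nbar r1 f r a \<le> nev_Nbar r0 f r a"
proof -
  obtain R where R: "r < R" "R < 1" using dense r by blast
  then obtain u v where "meromorphic_lift u v R f" using r lift_ex[of R] by auto
  then interpret meromorphic_lift u v R f .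
  have "0 < r1" "r0 \<le> r" using r by auto
  then show ?thesis
    using r R unfolding nev_Nbar_eq[OF \<open>0 < r1\<close> r(3) R(1)] nev_Nbar_eq[OF r(1) \<open>r0 \<le> r\<close> R(1)]
    by (intro sum_mono) (auto simp: gap_def)
qed

text \<open>Radii of circles on which one of the logarithms to be averaged is singular.\<close>

definition bad_radii :: "riemann_sphere set \<Rightarrow> real set" where
  "bad_radii A = {s \<in> {0<..<1}. \<exists>z. cmod z = s \<and> (speed_sq z = 0 \<or> (\<exists>a\<in>A. chord a z = 0))}"

lemma countable_bad_radii:
  assumes A: "finite A"
  shows "countable (bad_radii A)"
proof -
  have fin: "finite (bad_radii A \<inter> {..<r})" if r: "0 < r" "r < 1" for r
  proof -
    obtain R where R: "r < R" "R < 1" using dense r by blast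
    then obtain u v where l: "meromorphic_lift u v R f" using r lift_ex[of R] by auto
    then interpret meromorphic_lift u v R f .
    let ?Z = "{b\<in>ball 0 r. wronskian u v b = 0} \<union> (\<Union>a\<in>A. {b\<in>ball 0 r. L a b = 0})"
    have "finite ?Z"
      by (intro finite_UnI finite_UN_I A finite_zeros[OF hol_wronskian wronskian_nontrivial R(1)]
        finite_zeros[OF hol_L L_nontrivial R(1)])
    moreover have "bad_radii A \<inter> {..<r} \<subseteq> cmod ` ?Z"
    proof
      fix s assume s: "s \<in> bad_radii A \<inter> {..<r}"
      then obtain z where z: "cmod z = s" "speed_sq z = 0 \<or> (\<exists>a\<in>A. chord a z = 0)" by (auto simp: bad_radii_def)
      have zR: "z \<in> ball 0 R" "z \<in> ball 0 r" using s z R by auto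
      have "wronskian u v z = 0 \<or> (\<exists>a\<in>A. L a z = 0)"
        using z(2) N_pos[OF zR(1)] by (auto simp: speed_sq_lift[OF l zR(1)] chord_lift[OF l zR(1)] fs_density_def dist_sq_eq)
      then have "z \<in> ?Z" using zR by blast
      then show "s \<in> cmod ` ?Z" using z by blast
    qed
    ultimately show ?thesis by (meson finite_imageI finite_subset)
  qed
  have "bad_radii A \<subseteq> (\<Union>n. bad_radii A \<inter> {..<1 - 1 / (real n + 2)})"
  proof
    fix s assume s: "s \<in> bad_radii A"
    then have s1: "s < 1" by (simp add: bad_radii_def)
    obtain n where "1 / (1 - s) < real n" using reals_Archimedean2 by blast
    then have "1 / (1 - s) < real n + 2" by linarith
    then have "1 / (real n + 2) < 1 - s" using s1 by (simp add: field_simps)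
    then show "s \<in> (\<Union>n. bad_radii A \<inter> {..<1 - 1 / (real n + 2)})" using s by (intro UN_I[of n]) auto
  qed
  moreover have "countable (\<Union>n. bad_radii A \<inter> {..<1 - 1 / (real n + 2)})"
  proof (rule countable_UN)
    fix n :: nat
    have "0 < 1 / (real n + 2)" "1 / (real n + 2) < 1" by auto
    then show "countable (bad_radii A \<inter> {..<1 - 1 / (real n + 2)})" by (intro countable_finite fin) auto
  qed simp
  ultimately show ?thesis by (rule countable_subset)
qed

lemma good_radius:
  assumes "r \<in> {0<..<1} - bad_radii A" "cmod z = r"
  shows "0 < speed_sq z" and "a \<in> A \<Longrightarrow> 0 < chord a z"
  using assms speed_sq_nonneg[of z] chord_nonneg[of a z] by (auto simp: bad_radii_def less_le)

definition peak_sum :: "riemann_sphere set \<Rightarrow> nat \<Rightarrow> complex \<Rightarrow> real" where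
  "peak_sum A n z = (\<Sum>a\<in>A. \<Sum>k\<le>n. 1 / (real k + 1)\<^sup>2 * (speed_sq z * peak k (chord a z)))"

lemma cont_peak: "continuous_on (ball 0 1) (\<lambda>z. speed_sq z * peak k (chord a z))"
proof -
  have "(chord a z + (1/2) ^ k)\<^sup>2 \<noteq> 0" for z
    using chord_nonneg[of a z] add_nonneg_pos[of "chord a z" "(1/2) ^ k"] by simp
  then show ?thesis unfolding peak_def by (intro continuous_intros cont_speed_sq cont_chord) auto
qed

lemma cont_peak_sum: "continuous_on (ball 0 1) (peak_sum A n)"
  unfolding peak_sum_def[abs_def] by (intro continuous_on_sum continuous_on_mult[OF continuous_on_const] cont_peak)

lemma peak_sum_nonneg: "z \<in> ball 0 1 \<Longrightarrow> 0 \<le> peak_sum A n z"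
  unfolding peak_sum_def by (intro sum_nonneg mult_nonneg_nonneg speed_sq_nonneg peak_nonneg) auto

lemma peak_sum_mono: "z \<in> ball 0 1 \<Longrightarrow> m \<le> n \<Longrightarrow> peak_sum A m z \<le> peak_sum A n z"
  unfolding peak_sum_def
  by (intro sum_mono sum_mono2) (auto intro!: divide_nonneg_nonneg mult_nonneg_nonneg speed_sq_nonneg peak_nonneg)

text \<open>Twice the proximity function of \<open>a\<close>, in its chordal form.\<close>

definition proximity :: "real \<Rightarrow> riemann_sphere \<Rightarrow> real" where
  "proximity r a = - circ_mean (\<lambda>z. ln (chord a z)) r"

lemma
  assumes r: "r \<in> {0<..<1} - bad_radii A" and a: "a \<in> A"
  shows cont_ln_chord: "continuous_on (sphere 0 r) (\<lambda>z. ln (chord a z))" and proximity_nonneg: "0 \<le> proximity r a"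
proof -
  show c: "continuous_on (sphere 0 r) (\<lambda>z. ln (chord a z))"
    by (intro continuous_intros continuous_on_sphere_of_ball[OF cont_chord]) (use r good_radius(2)[OF r _ a] in force)+
  have "circ_mean (\<lambda>z. ln (chord a z)) r \<le> circ_mean (\<lambda>_. 0) r"
  proof (rule circ_mean_mono[OF c])
    fix z assume "cmod z = r"
    then have "0 < chord a z" using good_radius(2)[OF r _ a] by blast
    then show "ln (chord a z) \<le> 0" using chord_le_1[of a z] by simp
  qed (use r in auto)
  then show "0 \<le> proximity r a" by (simp add: proximity_def)
qed

lemma height_peak_sum_le:
  assumes A: "finite A" and r1: "r1 \<in> {0<..<1} - bad_radii A" and r: "r1 \<le> r" "r < 1"
  shows "height r1 (peak_sum A n) r \<le> (\<Sum>a\<in>A. 2 * (height r1 speed_sq r + (ln 2 + proximity r1 a) / 4))"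
proof -
  have r1': "0 < r1" using r1 by simp
  obtain R where R: "r < R" "R < 1" using dense r by blast
  then obtain u v where l: "meromorphic_lift u v R f" using r r1' lift_ex[of R] by auto
  then interpret meromorphic_lift u v R f .
  have one: "height r1 (\<lambda>z. speed_sq z * peak k (chord a z)) r \<le> height r1 speed_sq r + (ln 2 + proximity r1 a) / 4"
    if a: "a \<in> A" for a k
  proof -
    have nz: "L a z \<noteq> 0" if "cmod z = r1" for z
      using good_radius(2)[OF r1 that a] chord_lift[OF l, of z a] that r R by (auto simp: dist_sq_eq)
    have "circ_mean (\<lambda>z. ln (chord a z)) r1 = circ_mean (\<lambda>z. ln (dist_sq a z)) r1"
      by (rule circ_mean_cong) (use chord_lift[OF l] r1' r R in auto)
    moreover have "height r1 (\<lambda>z. speed_sq z * peak k (chord a z)) r = height r1 (\<lambda>z. fs_density u v z * peak k (dist_sq a z)) r"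
      by (rule height_cong[of R]) (use chord_lift[OF l] speed_sq_lift[OF l] r1' r R in auto)
    moreover have "height r1 speed_sq r = height r1 (fs_density u v) r"
      by (rule height_cong[of R]) (use speed_sq_lift[OF l] r1' r R in auto)
    ultimately show ?thesis using height_peak_le[OF r1' r(1) R(1) nz, of k] by (simp add: proximity_def)
  qed
  have "height r1 (peak_sum A n) r = (\<Sum>a\<in>A. \<Sum>k\<le>n. 1 / (real k + 1)\<^sup>2 * height r1 (\<lambda>z. speed_sq z * peak k (chord a z)) r)"
  proof -
    have "height r1 (peak_sum A n) r = (\<Sum>a\<in>A. height r1 (\<lambda>z. \<Sum>k\<le>n. 1 / (real k + 1)\<^sup>2 * (speed_sq z * peak k (chord a z))) r)"
      unfolding peak_sum_def[abs_def]
      by (rule height_sum[OF _ r1' r(2)]) (intro continuous_on_sum continuous_on_mult[OF continuous_on_const] cont_peak)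
    also have "\<dots> = (\<Sum>a\<in>A. \<Sum>k\<le>n. height r1 (\<lambda>z. 1 / (real k + 1)\<^sup>2 * (speed_sq z * peak k (chord a z))) r)"
      by (intro sum.cong refl height_sum[OF _ r1' r(2)] continuous_on_mult[OF continuous_on_const] cont_peak)
    finally show ?thesis by (simp only: height_cmult)
  qed
  also have "\<dots> \<le> (\<Sum>a\<in>A. \<Sum>k\<le>n. 1 / (real k + 1)\<^sup>2 * (height r1 speed_sq r + (ln 2 + proximity r1 a) / 4))"
    by (intro sum_mono mult_left_mono one) auto
  also have "\<dots> = (\<Sum>a\<in>A. (\<Sum>k\<le>n. 1 / (real k + 1)\<^sup>2) * (height r1 speed_sq r + (ln 2 + proximity r1 a) / 4))"
    by (simp only: sum_distrib_right)
  also have "\<dots> \<le> (\<Sum>a\<in>A. 2 * (height r1 speed_sq r + (ln 2 + proximity r1 a) / 4))"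
    using height_speed_sq_nonneg[OF r1' r(2)] proximity_nonneg[OF r1]
    by (intro sum_mono mult_right_mono sum_inverse_squares_le_2) auto
  finally show ?thesis .
qed

lemma proximity_le:
  assumes r1: "r1 \<in> {0<..<1} - bad_radii A" and r: "r \<in> {r1<..<1} - bad_radii A" and a: "a \<in> A"
  shows "proximity r a \<le> proximity r1 a + 4 * height r1 speed_sq r"
proof -
  have r': "0 < r1" "r1 \<le> r" "r < 1" using r r1 by auto
  obtain R where R: "r < R" "R < 1" using dense r' by blast
  then obtain u v where l: "meromorphic_lift u v R f" using r' lift_ex[of R] by auto
  then interpret meromorphic_lift u v R f .
  have rg: "r \<in> {0<..<1} - bad_radii A" using r r' by auto
  have nz: "L a z \<noteq> 0" if "cmod z = s" "s = r1 \<or> s = r" for z s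
    using good_radius(2)[OF r1 _ a, of z] good_radius(2)[OF rg _ a, of z] chord_lift[OF l, of z a] that r' R
    by (auto simp: dist_sq_eq)
  have "circ_mean (\<lambda>z. ln (chord a z)) s = circ_mean (\<lambda>z. ln (dist_sq a z)) s" if "s = r1 \<or> s = r" for s
    by (rule circ_mean_cong) (use chord_lift[OF l] r' R that in auto)
  moreover have "height r1 speed_sq r = height r1 (fs_density u v) r"
    by (rule height_cong[of R]) (use speed_sq_lift[OF l] r' R in auto)
  ultimately show ?thesis using mean_ln_dist_sq_ge[OF r'(1,2) R(1), of a] nz by (simp add: proximity_def)
qed

definition log_mean :: "riemann_sphere set \<Rightarrow> real \<Rightarrow> real" where
  "log_mean A r = circ_mean (\<lambda>z. ln (speed_sq z * (\<Prod>a\<in>A. 1 / chord a z))) r"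

lemma second_main_disc:
  assumes A: "finite A" and r1: "r1 \<in> {0<..<1} - bad_radii A" and r: "r \<in> {r1<..<1} - bad_radii A"
  shows "(real (card A) - 2) * nev_T r1 f r
    \<le> (\<Sum>a\<in>A. nev_Nbar r1 f r a) + (log_mean A r - log_mean A r1) / 2"
proof -
  have r': "0 < r1" "r1 \<le> r" "r < 1" using r r1 by auto
  obtain R where R: "r < R" "R < 1" using dense r' by blast
  then obtain u v where l: "meromorphic_lift u v R f" using r' lift_ex[of R] by auto
  then interpret meromorphic_lift u v R f .
  have rg: "r \<in> {0<..<1} - bad_radii A" using r r' by auto
  have zR: "z \<in> ball 0 R" if "cmod z \<in> {r1, r}" for z using that r' R by auto
  have nz: "L a z \<noteq> 0" if "a \<in> A" "cmod z \<in> {r1, r}" for z a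
    using good_radius(2)[OF r1 _ that(1), of z] good_radius(2)[OF rg _ that(1), of z] chord_lift[OF l zR[OF that(2)], of a] that(2)
    by (auto simp: dist_sq_eq)
  have nW: "wronskian u v z \<noteq> 0" if "cmod z \<in> {r1, r}" for z
    using good_radius(1)[OF r1, of z] good_radius(1)[OF rg, of z] speed_sq_lift[OF l zR[OF that]] that
    by (auto simp: fs_density_def)
  have M: "log_mean A s = circ_mean (\<lambda>z. ln (fs_density u v z * (\<Prod>a\<in>A. 1 / dist_sq a z))) s" if "s \<in> {r1, r}" for s
    unfolding log_mean_def
  proof (rule circ_mean_cong)
    fix z assume "cmod z = \<bar>s\<bar>"
    then have "z \<in> ball 0 R" using that r' R by auto
    then show "ln (speed_sq z * (\<Prod>a\<in>A. 1 / chord a z)) = ln (fs_density u v z * (\<Prod>a\<in>A. 1 / dist_sq a z))"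
      by (simp add: chord_lift[OF l] speed_sq_lift[OF l])
  qed
  have "height r1 speed_sq r = height r1 (fs_density u v) r"
    by (rule height_cong[of R]) (use speed_sq_lift[OF l] r' R in auto)
  then have T: "nev_T r1 f r = 2 * height r1 (fs_density u v) r" using nev_T_eq_height[OF r'(1,3)] by simp
  have Nb: "nev_Nbar r1 f r a = (\<Sum>b\<in>{b\<in>ball 0 r. L a b = 0}. gap r1 r b)" for a
    by (rule nev_Nbar_eq[OF r'(1,2) R(1)])
  have Mr: "log_mean A r = circ_mean (\<lambda>z. ln (fs_density u v z * (\<Prod>a\<in>A. 1 / dist_sq a z))) r"
    "log_mean A r1 = circ_mean (\<lambda>z. ln (fs_density u v z * (\<Prod>a\<in>A. 1 / dist_sq a z))) r1"
    using M by auto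
  show ?thesis unfolding T Nb Mr
    by (rule second_main_inequality[OF A r'(1,2) R(1) nz nW])
qed

text \<open>An upper bound for the mean of \<open>ln (2 - log 2 x_a)\<close>, by concavity and the First Main Theorem.\<close>

definition log_error :: "real \<Rightarrow> real \<Rightarrow> riemann_sphere \<Rightarrow> real" where
  "log_error r1 r a = ln (2 + (proximity r1 a + 4 * height r1 speed_sq r) / ln 2)"

text \<open>On a circle avoiding the singularities the \<open>x_a\<close> are bounded below, so that the finite sum
  \<open>peak_sum A n\<close> with \<open>n\<close> large enough dominates there; \<open>m\<close> has to bound the means for all \<open>n\<close> because
  that \<open>n\<close> depends on the circle.\<close>

lemma log_mean_le:
  assumes A: "finite A" "A \<noteq> {}"
  obtains C where "C > 0" "\<And>r1 r m. r1 \<in> {0<..<1} - bad_radii A \<Longrightarrow> r \<in> {r1<..<1} - bad_radii A \<Longrightarrow>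
    (\<And>n. circ_mean (peak_sum A n) r \<le> m) \<Longrightarrow>
    log_mean A r \<le> ln (8 * C) + 2 * (\<Sum>a\<in>A. log_error r1 r a) + ln m"
proof -
  obtain C where C: "C > 0" "\<And>u v. (\<And>a. a \<in> A \<Longrightarrow> 0 < chord_sq a u v) \<Longrightarrow>
     (\<Prod>a\<in>A. 1 / chord_sq a u v) \<le> C * (\<Sum>a\<in>A. 1 / chord_sq a u v)"
    using prod_inverse_chord_le[OF A] by blast
  have CX: "(\<Prod>a\<in>A. 1 / chord a z) \<le> C * (\<Sum>a\<in>A. 1 / chord a z)" if "\<And>a. a \<in> A \<Longrightarrow> 0 < chord a z" for z
    using C(2)[of 0 1] C(2)[of 1 "f z"] that unfolding chord_def by (cases "is_pole f z") auto
  have main: "log_mean A r \<le> ln (8 * C) + 2 * (\<Sum>a\<in>A. log_error r1 r a) + ln m"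
    if r1: "r1 \<in> {0<..<1} - bad_radii A" and r: "r \<in> {r1<..<1} - bad_radii A"
      and m: "\<And>n. circ_mean (peak_sum A n) r \<le> m" for r1 r m
  proof -
    have rg: "r \<in> {0<..<1} - bad_radii A" and r': "0 < r" "r < 1" using r r1 by auto
    have pos: "0 < chord a z" if "a \<in> A" "cmod z = r" for a z using good_radius(2)[OF rg that(2,1)] .
    have deriv_pos: "0 < speed_sq z" if "cmod z = r" for z using good_radius(1)[OF rg that] .
    let ?D = "\<lambda>z. speed_sq z * (\<Prod>a\<in>A. 1 / chord a z)"
    have Dpos: "0 < ?D z" if "cmod z = r" for z
      using deriv_pos[OF that] pos[OF _ that] by (intro mult_pos_pos prod_pos) auto
    have cX: "continuous_on (sphere 0 r) (chord a)" for a
      by (rule continuous_on_sphere_of_ball[OF cont_chord r'(2)])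
    obtain n where n: "\<And>a z. a \<in> A \<Longrightarrow> cmod z = r \<Longrightarrow> (1/2) ^ n \<le> chord a z"
    proof -
      have "\<exists>e>0. \<forall>z. cmod z = r \<longrightarrow> e \<le> chord a z" if a: "a \<in> A" for a
      proof -
        have "compact (sphere (0::complex) r)" "sphere (0::complex) r \<noteq> {}" using r' by auto
        then obtain z0 where "z0 \<in> sphere 0 r" "\<And>z. z \<in> sphere 0 r \<Longrightarrow> chord a z0 \<le> chord a z"
          using continuous_attains_inf[OF _ _ cX] by blast
        then show ?thesis using pos[OF a, of z0] by (intro exI[of _ "chord a z0"]) auto
      qed
      then obtain e where e: "\<And>a. a \<in> A \<Longrightarrow> 0 < e a" "\<And>a z. a \<in> A \<Longrightarrow> cmod z = r \<Longrightarrow> e a \<le> chord a z"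
        by metis
      have "0 < Min (e ` A)" using A e by (subst Min_gr_iff) auto
      then obtain n where n: "(1/2) ^ n < Min (e ` A)" using real_arch_pow_inv[of "Min (e ` A)" "1/2"] by auto
      have "(1/2) ^ n \<le> chord a z" if "a \<in> A" "cmod z = r" for a z
      proof -
        have "Min (e ` A) \<le> e a" using A that by (intro Min_le) auto
        then show ?thesis using n e(2)[OF that] by linarith
      qed
      then show thesis by (rule that)
    qed
    \<comment> \<open>The logarithmic factor of \<open>inverse_le_sum_peaks\<close>; it is at least \<open>2\<close>, so a single \<open>K a z\<close> may be
      replaced by the product over all targets.\<close>
    define K where "K = (\<lambda>a z. 2 - log 2 (chord a z))"
    have K: "2 \<le> K a z" if "a \<in> A" "cmod z = r" for a z
      using pos[OF that] chord_le_1[of a z] by (simp add: K_def)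
    have point: "?D z \<le> 8 * C * ((\<Prod>a\<in>A. K a z)\<^sup>2 * peak_sum A n z)" if z: "cmod z = r" for z
    proof -
      let ?S = "\<lambda>a. \<Sum>k\<le>n. peak k (chord a z) / (real k + 1)\<^sup>2" and ?K = "\<Prod>a\<in>A. K a z"
      have "1 / chord a z \<le> 8 * ?K\<^sup>2 * ?S a" if a: "a \<in> A" for a
      proof -
        have "1 / chord a z \<le> 8 * (K a z)\<^sup>2 * ?S a"
          unfolding K_def by (rule inverse_le_sum_peaks[OF pos[OF a z] chord_le_1 n[OF a z]])
        also have "\<dots> \<le> 8 * ?K\<^sup>2 * ?S a"
        proof (intro mult_right_mono mult_left_mono power_mono sum_nonneg divide_nonneg_nonneg peak_nonneg)
          have "1 \<le> (\<Prod>b\<in>A - {a}. K b z)" using K[OF _ z] by (intro prod_ge_1) force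
          then have "K a z * 1 \<le> K a z * (\<Prod>b\<in>A - {a}. K b z)" using K[OF a z] by (intro mult_left_mono) auto
          then show "K a z \<le> (\<Prod>a\<in>A. K a z)" using prod.remove[OF A(1) a, of "\<lambda>a. K a z"] by simp
        qed (use K[OF a z] in auto)
        finally show ?thesis .
      qed
      then have "(\<Sum>a\<in>A. 1 / chord a z) \<le> (\<Sum>a\<in>A. 8 * ?K\<^sup>2 * ?S a)"
        by (rule sum_mono)
      then have "C * (\<Sum>a\<in>A. 1 / chord a z) \<le> C * (\<Sum>a\<in>A. 8 * ?K\<^sup>2 * ?S a)"
        using C(1) by (intro mult_left_mono) auto
      then have "?D z \<le> speed_sq z * (C * (\<Sum>a\<in>A. 8 * ?K\<^sup>2 * ?S a))"
        using CX[of z] pos[OF _ z] deriv_pos[OF z] by (intro mult_left_mono) auto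
      also have "\<dots> = 8 * C * ((\<Prod>a\<in>A. K a z)\<^sup>2 * peak_sum A n z)"
        by (simp add: peak_sum_def sum_distrib_left mult_ac)
      finally show ?thesis .
    qed
    have sum_pos: "0 < peak_sum A n z" if z: "cmod z = r" for z
    proof -
      have "0 < (8 * C * (\<Prod>a\<in>A. K a z)\<^sup>2) * peak_sum A n z" using Dpos[OF z] point[OF z] by (simp add: mult_ac)
      moreover have "0 \<le> 8 * C * (\<Prod>a\<in>A. K a z)\<^sup>2" using C(1) by simp
      ultimately show ?thesis by (simp add: zero_less_mult_iff)
    qed
    have c_sum: "continuous_on (sphere 0 r) (peak_sum A n)"
      by (rule continuous_on_sphere_of_ball[OF cont_peak_sum r'(2)])
    have clX: "continuous_on (sphere 0 r) (\<lambda>z. ln (chord a z))" if "a \<in> A" for a by (rule cont_ln_chord[OF rg that])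
    have cK: "continuous_on (sphere 0 r) (K a)" if "a \<in> A" for a
      unfolding K_def log_def by (intro continuous_on_diff continuous_on_divide continuous_on_const clX that) auto
    have clK: "continuous_on (sphere 0 r) (\<lambda>z. ln (K a z))" if "a \<in> A" for a
      by (intro continuous_on_ln cK that) (use K[OF that] in force)
    have cl_sum: "continuous_on (sphere 0 r) (\<lambda>z. ln (peak_sum A n z))"
      by (intro continuous_on_ln c_sum) (use sum_pos in force)
    have "log_mean A r \<le> circ_mean (\<lambda>z. ln (8 * C) + (2 * (\<Sum>a\<in>A. ln (K a z)) + ln (peak_sum A n z))) r"
      unfolding log_mean_def
    proof (rule circ_mean_mono)
      have "continuous_on (sphere 0 r) ?D"
        by (intro continuous_on_mult continuous_on_prod continuous_on_divide continuous_on_const cX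
            continuous_on_sphere_of_ball[OF cont_speed_sq r'(2)]) (use pos in force)
      then show "continuous_on (sphere 0 r) (\<lambda>z. ln (?D z))"
      proof (rule continuous_on_ln, intro ballI)
        fix z :: complex assume "z \<in> sphere 0 r"
        then have "0 < ?D z" by (intro Dpos) simp
        then show "?D z \<noteq> 0" by (rule less_imp_neq[symmetric])
      qed
      show "continuous_on (sphere 0 r) (\<lambda>z. ln (8 * C) + (2 * (\<Sum>a\<in>A. ln (K a z)) + ln (peak_sum A n z)))"
        by (intro continuous_on_add continuous_on_const continuous_on_mult continuous_on_sum clK cl_sum)
      fix z assume z: "cmod z = r"
      have Kp: "0 < (\<Prod>a\<in>A. K a z)" by (rule prod_pos) (use K[OF _ z] in force)
      have "ln (?D z) \<le> ln (8 * C * ((\<Prod>a\<in>A. K a z)\<^sup>2 * peak_sum A n z))"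
        using Dpos[OF z] point[OF z] less_le_trans[OF _ point[OF z]] by (subst ln_le_cancel_iff) blast+
      also have "\<dots> = ln (8 * C) + (ln ((\<Prod>a\<in>A. K a z)\<^sup>2) + ln (peak_sum A n z))"
        using C(1) Kp sum_pos[OF z] by (simp only: ln_mult_pos mult_pos_pos zero_less_power zero_less_numeral)
      also have "ln ((\<Prod>a\<in>A. K a z)\<^sup>2) = 2 * ln (\<Prod>a\<in>A. K a z)" using Kp by (simp add: ln_realpow)
      also have "ln (\<Prod>a\<in>A. K a z) = (\<Sum>a\<in>A. ln (K a z))"
        by (rule ln_prod[OF A(1)]) (use K[OF _ z] in force)
      finally show "ln (?D z) \<le> ln (8 * C) + (2 * (\<Sum>a\<in>A. ln (K a z)) + ln (peak_sum A n z))" .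
    qed (use r' in auto)
    also have "\<dots> = ln (8 * C) + (2 * (\<Sum>a\<in>A. circ_mean (\<lambda>z. ln (K a z)) r) + circ_mean (\<lambda>z. ln (peak_sum A n z)) r)"
      using r' clK cl_sum
      by (simp only: circ_mean_add circ_mean_cmult circ_mean_sum circ_mean_const continuous_on_add continuous_on_mult
          continuous_on_const continuous_on_sum less_imp_le)
    also have "\<dots> \<le> ln (8 * C) + (2 * (\<Sum>a\<in>A. log_error r1 r a) + ln m)"
    proof (intro add_left_mono add_mono mult_left_mono sum_mono)
      fix a assume a: "a \<in> A"
      have Kpos: "0 < K a z" if "cmod z = r" for z using K[OF a that] by simp
      have "circ_mean (\<lambda>z. ln (K a z)) r \<le> ln (circ_mean (K a) r)"
        by (rule circ_mean_ln_le(1)[OF cK[OF a] _ Kpos]) (use r' in auto)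
      also have "circ_mean (K a) r = circ_mean (\<lambda>z. 2 - (1 / ln 2) * ln (chord a z)) r"
        by (rule circ_mean_cong) (simp add: K_def log_def)
      also have "\<dots> = 2 + proximity r a / ln 2"
      proof -
        have "circ_mean (\<lambda>z. 2 - (1 / ln 2) * ln (chord a z)) r = circ_mean (\<lambda>_. 2) r - circ_mean (\<lambda>z. (1 / ln 2) * ln (chord a z)) r"
          using r' by (intro circ_mean_diff continuous_on_const continuous_on_mult clX[OF a]) auto
        then show ?thesis by (simp only: circ_mean_cmult circ_mean_const proximity_def) simp
      qed
      also have "ln (2 + proximity r a / ln 2) \<le> log_error r1 r a"
      proof -
        have "proximity r a / ln 2 \<le> (proximity r1 a + 4 * height r1 speed_sq r) / ln 2"
          by (rule divide_right_mono[OF proximity_le[OF r1 r a]]) simp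
        moreover have "0 \<le> proximity r a / ln 2" using proximity_nonneg[OF rg a] by simp
        ultimately show ?thesis unfolding log_error_def by (subst ln_le_cancel_iff) auto
      qed
      finally show "circ_mean (\<lambda>z. ln (K a z)) r \<le> log_error r1 r a" .
    next
      have p: "0 < circ_mean (peak_sum A n) r" by (rule circ_mean_ln_le(2)[OF c_sum _ sum_pos]) (use r' in auto)
      have "circ_mean (\<lambda>z. ln (peak_sum A n z)) r \<le> ln (circ_mean (peak_sum A n) r)"
        by (rule circ_mean_ln_le(1)[OF c_sum _ sum_pos]) (use r' in auto)
      also have "\<dots> \<le> ln m" using p m[of n] by (subst ln_le_cancel_iff) auto
      finally show "circ_mean (\<lambda>z. ln (peak_sum A n z)) r \<le> ln m" .
    qed simp
    finally show ?thesis by simp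
  qed
  show thesis by (rule that[OF C(1) main])
qed

end

section \<open>The Second Main Theorem\<close>

lemma nn_integral_hyp_measure:
  "E \<in> sets borel \<Longrightarrow> (\<integral>\<^sup>+r\<in>E. ennreal (1 / (1 - r)) \<partial>lebesgue) = emeasure hyp_measure E"
  by (simp add: emeasure_hyp_measure nn_integral_completion)

lemma emeasure_hyp_measure_Ioc:
  assumes "s < 1"
  shows "emeasure hyp_measure {0<..s} < \<infinity>"
proof -
  have "emeasure hyp_measure {0<..s} = (\<integral>\<^sup>+r. ennreal (1 / (1 - r)) * indicator {0<..s} r \<partial>lborel)"
    by (rule emeasure_hyp_measure) simp
  also have "\<dots> \<le> (\<integral>\<^sup>+r. ennreal (1 / (1 - s)) * indicator {0<..s} r \<partial>lborel)"
    by (rule nn_integral_mono) (use assms in \<open>auto simp: indicator_def intro!: ennreal_leI divide_left_mono\<close>)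
  also have "\<dots> = ennreal (1 / (1 - s)) * emeasure lborel {0<..s}"
    by (simp add: nn_integral_cmult_indicator)
  also have "\<dots> < \<infinity>" by (cases "0 \<le> s") (auto simp: ennreal_mult_less_top)
  finally show ?thesis .
qed

lemma emeasure_hyp_measure_countable:
  assumes "countable S"
  shows "emeasure hyp_measure S = 0"
proof -
  have "S \<in> sets borel" by (rule sets.countable[OF _ assms]) simp
  then have "emeasure hyp_measure S = (\<integral>\<^sup>+r. ennreal (1 / (1 - r)) * indicator S r \<partial>lborel)"
    by (rule emeasure_hyp_measure)
  also have "\<dots> = 0"
  proof (rule nn_integral_0_iff_AE[THEN iffD2])
    have "AE r in lborel. r \<notin> S"
      by (rule AE_not_in) (rule countable_imp_null_set_lborel[OF assms])
    then show "AE r in lborel. ennreal (1 / (1 - r)) * indicator S r = 0"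
      by eventually_elim simp
  qed (use \<open>S \<in> sets borel\<close> in auto)
  finally show ?thesis .
qed

context meromorphic_on_disc
begin

lemma nev_T_nonneg: "0 < r0 \<Longrightarrow> r < 1 \<Longrightarrow> 0 \<le> nev_T r0 f r"
  using nev_T_eq_height height_speed_sq_nonneg by simp

text \<open>The lower radius is moved from \<open>r0\<close> to a slightly larger \<open>r1\<close> whose circle is free of
  singularities; this changes the characteristic by a constant and only decreases the counting
  functions.\<close>

theorem second_main_theorem:
  assumes r0: "0 < r0" "r0 < 1" and A: "finite A" "A \<noteq> {}"
  obtains C E where "E \<in> sets borel" "{0<..r0} \<subseteq> E" "E \<subseteq> {0<..<1}" "emeasure hyp_measure E < \<infinity>"
    "\<And>r. r \<in> {0<..<1} - E \<Longrightarrow> (real (card A) - 2) * nev_T r0 f r \<le> (\<Sum>a\<in>A. nev_Nbar r0 f r a) +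
          C * (1 + pos_part (ln (nev_T r0 f r)) + pos_part (ln (1 / (1 - r))))"
proof -
  let ?q = "real (card A)"
  have "uncountable {r0<..<1}" using r0 by (simp add: uncountable_open_interval)
  then have "{r0<..<1} - bad_radii A \<noteq> {}"
    using countable_bad_radii[OF A(1)] by (metis countable_empty uncountable_minus_countable)
  then obtain r1 where r1: "r0 < r1" "r1 < 1" "r1 \<notin> bad_radii A"
    unfolding ex_in_conv[symmetric] by auto
  have r1': "r1 \<in> {0<..<1} - bad_radii A" "0 < r1" using r1 r0 by auto
  define b where "b = (\<Sum>a\<in>A. (ln 2 + proximity r1 a) / 2)"
  have b0: "0 \<le> b" unfolding b_def using proximity_nonneg[OF r1'(1)] by (intro sum_nonneg) auto
  define B where "B = (\<lambda>r. 2 * ?q * height r1 speed_sq r + b)"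
  have B: "height r1 (peak_sum A n) r \<le> B r" if "r \<in> {r1<..<1}" for n r
  proof -
    have "height r1 (peak_sum A n) r \<le> (\<Sum>a\<in>A. 2 * (height r1 speed_sq r + (ln 2 + proximity r1 a) / 4))"
      by (rule height_peak_sum_le[OF A(1) r1'(1)]) (use that in auto)
    also have "\<dots> = B r" by (simp add: B_def b_def sum.distrib distrib_left sum_divide_distrib[symmetric] sum_distrib_left[symmetric])
    finally show ?thesis .
  qed
  obtain E0 where E0: "E0 \<in> sets borel" "emeasure hyp_measure E0 \<le> 2"
    "\<And>r n. r \<in> {r1<..<1} - E0 \<Longrightarrow> r * circ_mean (peak_sum A n) r \<le> 4 * (1 + B r) ^ 4 / (1 - r) ^ 3"
  proof (rule growth_circ_mean_incseq[of "peak_sum A" r1 B])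
    fix E assume "E \<in> sets borel" "emeasure hyp_measure E \<le> 2"
      "\<And>r n. r \<in> {r1<..<1} - E \<Longrightarrow> r * circ_mean (peak_sum A n) r \<le> 4 * (1 + B r) ^ 4 / (1 - r) ^ 3"
    then show thesis by (rule that)
  qed (use cont_peak_sum peak_sum_nonneg peak_sum_mono r1'(2) B in auto)
  obtain C where C: "C > 0" "\<And>r1 r m. r1 \<in> {0<..<1} - bad_radii A \<Longrightarrow> r \<in> {r1<..<1} - bad_radii A \<Longrightarrow>
    (\<And>n. circ_mean (peak_sum A n) r \<le> m) \<Longrightarrow>
    log_mean A r \<le> ln (8 * C) + 2 * (\<Sum>a\<in>A. log_error r1 r a) + ln m"
  proof (rule log_mean_le[OF A])
    fix C :: real assume "C > 0" "\<And>r1 r m. r1 \<in> {0<..<1} - bad_radii A \<Longrightarrow> r \<in> {r1<..<1} - bad_radii A \<Longrightarrow>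
      (\<And>n. circ_mean (peak_sum A n) r \<le> m) \<Longrightarrow>
      log_mean A r \<le> ln (8 * C) + 2 * (\<Sum>a\<in>A. log_error r1 r a) + ln m"
    then show thesis by (rule that)
  qed
  define E where "E = {0<..r1} \<union> (E0 \<inter> {r1<..<1}) \<union> (bad_radii A \<inter> {r1<..<1})"
  have ctb: "countable (bad_radii A \<inter> {r1<..<1})" using countable_bad_radii[OF A(1)] by auto
  have sb: "bad_radii A \<inter> {r1<..<1} \<in> sets borel" by (rule sets.countable[OF _ ctb]) simp
  have Em: "E \<in> sets borel" unfolding E_def using E0(1) sb by (intro sets.Un) auto
  have Efin: "emeasure hyp_measure E < \<infinity>"
  proof -
    have "emeasure hyp_measure E \<le> emeasure hyp_measure ({0<..r1} \<union> (E0 \<inter> {r1<..<1})) + emeasure hyp_measure (bad_radii A \<inter> {r1<..<1})"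
      unfolding E_def by (rule emeasure_subadditive) (use E0(1) sb in auto)
    also have "\<dots> \<le> (emeasure hyp_measure {0<..r1} + emeasure hyp_measure (E0 \<inter> {r1<..<1})) + 0"
      using E0(1) emeasure_hyp_measure_countable[OF ctb] by (intro add_mono emeasure_subadditive) auto
    also have "\<dots> \<le> emeasure hyp_measure {0<..r1} + 2"
    proof -
      have "emeasure hyp_measure (E0 \<inter> {r1<..<1}) \<le> emeasure hyp_measure E0"
        by (rule emeasure_mono) (use E0(1) in auto)
      also have "\<dots> \<le> 2" by (rule E0(2))
      finally show ?thesis by (simp add: add_left_mono)
    qed
    also have "\<dots> < \<infinity>" using emeasure_hyp_measure_Ioc[OF r1(2)] by (simp add: ennreal_add_less_top)
    finally show ?thesis .
  qed
  define ca where "ca = (\<lambda>a. ln (2 + proximity r1 a / ln 2 + 4 / ln 2) + ln 2)"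
  define cb where "cb = ln (1 + b + 2 * ?q) + ln 2"
  define c0 where "c0 = ln (8 * C) + 2 * (\<Sum>a\<in>A. ca a) + ln 4 + 4 * cb - ln r1"
  \<comment> \<open>The additive constants of the final estimate; \<open>l\<close> and \<open>\<mu>\<close> below enter with the coefficients
      \<open>?q + 2\<close> and at most \<open>2\<close>.\<close>
  define c1 where "c1 = (?q - 2) * nev_T r0 f r1 + (c0 - log_mean A r1) / 2"
  define D where "D = \<bar>c1\<bar> + (?q + 2)"
  have main: "(?q - 2) * nev_T r0 f r \<le> (\<Sum>a\<in>A. nev_Nbar r0 f r a) +
          D * (1 + pos_part (ln (nev_T r0 f r)) + pos_part (ln (1 / (1 - r))))"
    if r: "r \<in> {0<..<1} - E" for r
  proof -
    have rr: "r \<in> {r1<..<1} - E0" "r \<in> {r1<..<1} - bad_radii A" and r': "r1 < r" "r < 1" "0 < r"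
      using r r1'(2) by (auto simp: E_def)
    let ?H = "height r1 speed_sq r" and ?T = "nev_T r0 f r"
    define l where "l = pos_part (ln ?T)"
    define \<mu> where "\<mu> = pos_part (ln (1 / (1 - r)))"
    have l0: "0 \<le> l" "0 \<le> \<mu>" by (auto simp: l_def \<mu>_def pos_part_def)
    have \<mu>: "ln (1 / (1 - r)) \<le> \<mu>" by (simp add: \<mu>_def pos_part_def)
    have H0: "0 \<le> ?H" by (rule height_speed_sq_nonneg[OF r1'(2) r'(2)])
    have T: "?T = nev_T r0 f r1 + nev_T r1 f r" by (rule nev_T_split) (use r0 r1 r' in auto)
    have HT: "?H \<le> ?T"
      using T nev_T_nonneg[OF r0(1) r1(2)] nev_T_eq_height[OF r1'(2) r'(2)] H0 by linarith
    let ?m = "4 * (1 + B r) ^ 4 / (1 - r) ^ 3 / r1"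
    have B0: "0 \<le> B r" unfolding B_def using H0 b0 by simp
    have m: "circ_mean (peak_sum A n) r \<le> ?m" for n
    proof -
      have "0 \<le> circ_mean (peak_sum A n) r"
        by (rule circ_mean_nonneg[OF continuous_on_sphere_of_ball[OF cont_peak_sum r'(2)]]) (use r' peak_sum_nonneg in auto)
      then have "r1 * circ_mean (peak_sum A n) r \<le> r * circ_mean (peak_sum A n) r" using r' by (intro mult_right_mono) auto
      also have "\<dots> \<le> 4 * (1 + B r) ^ 4 / (1 - r) ^ 3" by (rule E0(3)[OF rr(1)])
      finally show ?thesis unfolding pos_le_divide_eq[OF r1'(2)] by (subst mult.commute)
    qed
    have lm: "ln ?m = ln 4 + 4 * ln (1 + B r) + 3 * ln (1 / (1 - r)) - ln r1"
    proof -
      have "ln (4 * x ^ 4 / y ^ 3 / s) = ln 4 + 4 * ln x + 3 * ln (1 / y) - ln s"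
        if "0 < x" "0 < y" "0 < s" for x y s :: real
        using that by (simp add: ln_div ln_mult ln_realpow)
      then show ?thesis using B0 r' r1'(2) by force
    qed
    have eB: "1 + B r = (1 + b) + (2 * ?q) * ?H" by (simp add: B_def)
    have lB: "ln (1 + B r) \<le> cb + l"
      unfolding eB cb_def l_def by (rule ln_affine_le[OF _ _ H0 HT]) (use b0 in auto)
    have la: "log_error r1 r a \<le> ca a + l" if "a \<in> A" for a
    proof -
      have eq: "2 + (proximity r1 a + 4 * ?H) / ln 2 = (2 + proximity r1 a / ln 2) + (4 / ln 2) * ?H"
        by (simp add: add_divide_distrib)
      have "0 \<le> proximity r1 a / ln 2" using proximity_nonneg[OF r1'(1) that] by simp
      then show ?thesis unfolding log_error_def eq ca_def l_def by (intro ln_affine_le H0 HT) auto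
    qed
    have "log_mean A r \<le> ln (8 * C) + 2 * (\<Sum>a\<in>A. log_error r1 r a) + ln ?m"
      by (rule C(2)[OF r1'(1) rr(2) m])
    also have "\<dots> \<le> ln (8 * C) + 2 * (\<Sum>a\<in>A. ca a + l) + (ln 4 + 4 * (cb + l) + 3 * \<mu> - ln r1)"
      unfolding lm by (intro add_mono mult_left_mono sum_mono la diff_mono lB \<mu> order_refl) auto
    also have "\<dots> = c0 + (2 * (?q * l) + 4 * l) + 3 * \<mu>"
      by (simp add: c0_def sum.distrib algebra_simps)
    finally have lr: "log_mean A r \<le> c0 + (2 * (?q * l) + 4 * l) + 3 * \<mu>" .
    have S: "(?q - 2) * nev_T r1 f r \<le> (\<Sum>a\<in>A. nev_Nbar r1 f r a) + (log_mean A r - log_mean A r1) / 2"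
      by (rule second_main_disc[OF A(1) r1'(1) rr(2)])
    have N: "(\<Sum>a\<in>A. nev_Nbar r1 f r a) \<le> (\<Sum>a\<in>A. nev_Nbar r0 f r a)"
      by (intro sum_mono nev_Nbar_mono) (use r0 r1 r' in auto)
    have "(?q - 2) * ?T = (?q - 2) * nev_T r0 f r1 + (?q - 2) * nev_T r1 f r"
      by (simp add: T distrib_left)
    then have 1: "(?q - 2) * ?T \<le> (\<Sum>a\<in>A. nev_Nbar r0 f r a) + (c1 + (?q * l + 2 * l) + 2 * \<mu>)"
      using S N lr l0 unfolding c1_def by argo
    have "c1 + (?q * l + 2 * l) + 2 * \<mu> \<le> D * (1 + l + \<mu>)"
    proof -
      have "D * (1 + l + \<mu>) = \<bar>c1\<bar> + (?q + 2) + (\<bar>c1\<bar> * l + \<bar>c1\<bar> * \<mu>) + (?q * l + 2 * l) + (?q * \<mu> + 2 * \<mu>)"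
        by (simp add: D_def algebra_simps)
      moreover have "0 \<le> \<bar>c1\<bar> * l" "0 \<le> \<bar>c1\<bar> * \<mu>" "0 \<le> ?q * \<mu>" "0 \<le> ?q" using l0 by auto
      moreover have "c1 \<le> \<bar>c1\<bar>" by simp
      ultimately show ?thesis by linarith
    qed
    with 1 show ?thesis unfolding l_def \<mu>_def by linarith
  qed
  have "{0<..r0} \<subseteq> E" "E \<subseteq> {0<..<1}" using r1 r1'(2) by (auto simp: E_def)
  then show thesis using that[OF Em _ _ Efin main] by blast
qed

end

theorem mainTheorem3:
  fixes f :: "complex \<Rightarrow> complex" and q :: nat and a :: "nat \<Rightarrow> riemann_sphere"
    and r0 :: real
  assumes "0 < r0" and "r0 < 1"
    and "f nicely_meromorphic_on ball 0 1"
    and "\<not> f constant_on ball 0 1"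
    and "inj_on a {1..q}"
  shows "\<exists>C::real. \<forall>\<delta>::real. \<delta> > 0 \<longrightarrow>
    (\<exists>E :: real set. E \<in> sets lebesgue \<and> {0<..r0} \<subseteq> E \<and> E \<subseteq> {0<..<1} \<and>
      (\<integral>\<^sup>+r\<in>E. ennreal (1 / (1 - r)) \<partial>lebesgue) < \<infinity> \<and>
      (\<forall>r\<in>{0<..<1} - E.
        (real q - 2) * nev_T r0 f r \<le>
          (\<Sum>j=1..q. nev_Nbar r0 f r (a j)) +
          C * (1 + pos_part (ln (nev_T r0 f r)) + pos_part (ln (1 / (1 - r))))))"
proof -
  interpret meromorphic_on_disc f by unfold_locales fact+
  obtain C E where E: "E \<in> sets borel" "{0<..r0} \<subseteq> E" "E \<subseteq> {0<..<1}" "emeasure hyp_measure E < \<infinity>"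
    and main: "\<And>r. r \<in> {0<..<1} - E \<Longrightarrow> (real q - 2) * nev_T r0 f r \<le> (\<Sum>j=1..q. nev_Nbar r0 f r (a j)) +
          C * (1 + pos_part (ln (nev_T r0 f r)) + pos_part (ln (1 / (1 - r))))"
  \<comment> \<open>Without targets the left-hand side is \<open>- 2 T \<le> 0\<close>; otherwise the sum over the targets is
      nonempty, as the estimate of the product requires.\<close>
  proof (cases "q = 0")
    case True
    have "(real q - 2) * nev_T r0 f r \<le> (\<Sum>j=1..q. nev_Nbar r0 f r (a j)) +
          0 * (1 + pos_part (ln (nev_T r0 f r)) + pos_part (ln (1 / (1 - r))))" if "r \<in> {0<..<1} - {0<..r0}" for r
      using nev_T_nonneg[OF assms(1), of r] that True by simp
    moreover have "{0<..r0} \<in> sets borel" "{0<..r0} \<subseteq> {0<..<1}" using assms(2) by auto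
    ultimately show thesis
      using emeasure_hyp_measure_Ioc[OF assms(2)] by (intro that[of "{0<..r0}" 0] order_refl)
  next
    case False
    then have A: "finite (a ` {1..q})" "a ` {1..q} \<noteq> {}" by auto
    have card: "card (a ` {1..q}) = q" using card_image[OF assms(5)] by simp
    have sum: "(\<Sum>x\<in>a ` {1..q}. nev_Nbar r0 f r x) = (\<Sum>j=1..q. nev_Nbar r0 f r (a j))" for r
      using sum.reindex[OF assms(5), of "nev_Nbar r0 f r"] by (simp add: o_def)
    show thesis
      by (rule second_main_theorem[OF assms(1,2) A, unfolded card sum]) (rule that)
  qed
  have "E \<in> sets lebesgue" using E(1) by simp
  moreover have "(\<integral>\<^sup>+r\<in>E. ennreal (1 / (1 - r)) \<partial>lebesgue) < \<infinity>"
    using E(4) by (simp add: nn_integral_hyp_measure[OF E(1)])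
  ultimately show ?thesis using E(2,3) main by blast
qed

end
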